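(* Let $q\colon E\to M$ be a smooth vector bundle and let $D_E\colon\Gamma(E)\to\Gamma(E)$ be a linear derivation with symbol $X\in\mathfrak{X}(M)$. Let $\phi\colon\Omega\to M$ be the flow of $X$ and let $\Phi^E$ be the flow of the linear vector field $\widehat{D_E}\in\mathfrak{X}^l(E)$. Let $D_E^*$ be the dual derivation on $E^*$ and let $q_{E^*}\colon E^*\to M$ be the projection. Then the flow $\Phi^{E^*}$ of the linear vector field $\widehat{D_E^*}\in\mathfrak{X}^l(E^* )$ is given by \[ \Phi^{E^*}\colon\{(t,\epsilon)\in\mathbb{R}\times E^*\mid(t,q_{E^*}(\epsilon))\in\Omega\}\to E^*,\qquad (t,\epsilon)\mapsto\epsilon\circ\Phi^E_{-t}, \] where for $\epsilon\in E^*_x$ the composition $\epsilon\circ\Phi^E_{-t}$ is understood as the element $\epsilon\circ\Phi^E_{-t}|_{E_{\phi_t(x)}}$ of $E^*_{\phi_t(x)}$.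
   Context: All manifolds and vector bundles are smooth and real; flows are maximal flows on their maximal flow domains. A linear derivation of a vector bundle $q_G\colon G\to M$ with symbol $X\in\mathfrak{X}(M)$ is an $\mathbb{R}$-linear map $D\colon\Gamma(G)\to\Gamma(G)$ with $D(fg)=X(f)g+fD(g)$ for all $f\in C^\infty(M)$, $g\in\Gamma(G)$. Its dual derivation $D^*\colon\Gamma(G^* )\to\Gamma(G^* )$, which again has symbol $X$, is defined by $\langle D^*\gamma,g\rangle=X\langle\gamma,g\rangle-\langle\gamma,Dg\rangle$. For $\gamma\in\Gamma(G^* )$, $\ell_\gamma\colon G\to\mathbb{R}$ is the fibrewise linear function $g_x\mapsto\langle\gamma(x),g_x\rangle$. A vector field $\chi\colon G\to TG$ is linear over $X$ if it is a morphism of vector bundles from $q_G\colon G\to M$ to $Tq_G\colon TG\to TM$ over $X\colon M\to TM$, where $Tq_G\colon TG\to TM$ carries the vector bundle structure whose addition and scalar multiplications are the tangent maps of those of $G$; $\mathfrak{X}^l(G)$ is the set of these. The linear vector field $\widehat D\in\mathfrak{X}^l(G)$ over $X$ associated with a derivation $D$ of $G$ is the unique vector field on $G$ with $\widehat D(\ell_\gamma)=\ell_{D^*\gamma}$ and $\widehat D(q_G^*f)=q_G^*(X(f))$ for all $\gamma\in\Gamma(G^* )$ and $f\in C^\infty(M)$. The flow of $\widehat D$ on $G$ has flow domain $\{(t,g)\in\mathbb{R}\times G\mid(t,q_G(g))\in\Omega\}$ and at each time $t$ it restricts to linear isomorphisms $G_x\to G_{\phi_t(x)}$ for all $x$ with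 $(t,x)\in\Omega$. *)

theory Defs
  imports "HOL-Analysis.Analysis"
begin

text \<open>Model spaces. Unlike \<^class>\<open>euclidean_space\<close>, this class admits the zero space, so that
  zero-dimensional manifolds and vector bundles of rank zero are not excluded.\<close>

class finite_dim_inner = real_inner +
  assumes finite_spanning: "\<exists>B. finite B \<and> (\<forall>x. \<exists>c. x = (\<Sum>b\<in>B. c b *\<^sub>R b))"

lemma finite_dim: "\<exists>B :: 'a::finite_dim_inner set. finite B \<and> span B = UNIV"
proof -
  obtain B :: "'a set" where B: "finite B" "\<And>x. \<exists>c. x = (\<Sum>b\<in>B. c b *\<^sub>R b)"
    using finite_spanning by blast
  have "x \<in> span B" for x
  proof -
    obtain c where "x = (\<Sum>b\<in>B. c b *\<^sub>R b)"
      using B(2) by blast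
    then show ?thesis
      by (simp add: span_sum span_scale span_base)
  qed
  then show ?thesis
    using B by blast
qed

lemma finite_spanningI:
  assumes "finite B" "span B = (UNIV :: 'a::real_inner set)"
  shows "\<exists>B. finite B \<and> (\<forall>x::'a. \<exists>c. x = (\<Sum>b\<in>B. c b *\<^sub>R b))"
proof (intro exI[of _ B] conjI allI)
  fix x :: 'a
  have "x \<in> range (\<lambda>c. \<Sum>b\<in>B. c b *\<^sub>R b)"
    using span_finite[OF assms(1)] assms(2) by blast
  then show "\<exists>c. x = (\<Sum>b\<in>B. c b *\<^sub>R b)"
    by blast
qed (rule assms(1))

instance euclidean_space \<subseteq> finite_dim_inner
  by standard (rule finite_spanningI[OF finite_Basis span_Basis])

instance prod :: (finite_dim_inner, finite_dim_inner) finite_dim_inner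
proof
  obtain B :: "'a set" where B: "finite B" "span B = UNIV"
    using finite_dim by blast
  obtain C :: "'b set" where C: "finite C" "span C = UNIV"
    using finite_dim by blast
  have "p \<in> span (B \<times> {0} \<union> {0} \<times> C)" for p :: "'a \<times> 'b"
  proof -
    have l: "linear (\<lambda>a :: 'a. (a, 0 :: 'b))" "linear (\<lambda>c :: 'b. (0 :: 'a, c))"
      by (rule linearI; simp)+
    have "range (\<lambda>a. (a, 0)) = span ((\<lambda>a. (a, 0 :: 'b)) ` B)"
      using linear_span_image[OF l(1), of B] B(2) by simp
    moreover have "range (\<lambda>c. (0, c)) = span ((\<lambda>c. (0 :: 'a, c)) ` C)"
      using linear_span_image[OF l(2), of C] C(2) by simp
    moreover have "(\<lambda>a. (a, 0 :: 'b)) ` B = B \<times> {0}" "(\<lambda>c. (0 :: 'a, c)) ` C = {0} \<times> C"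
      by auto
    ultimately have "(fst p, 0) \<in> span (B \<times> {0 :: 'b})" "(0, snd p) \<in> span ({0 :: 'a} \<times> C)"
      by (metis rangeI)+
    then have "(fst p, 0) \<in> span (B \<times> {0} \<union> {0} \<times> C)" "(0, snd p) \<in> span (B \<times> {0} \<union> {0} \<times> C)"
      by (meson span_mono Un_upper1 Un_upper2 subsetD)+
    from span_add[OF this] show ?thesis
      by simp
  qed
  then have "span (B \<times> {0} \<union> {0} \<times> C) = (UNIV :: ('a \<times> 'b) set)"
    by blast
  then show "\<exists>B. finite B \<and> (\<forall>x :: 'a \<times> 'b. \<exists>c. x = (\<Sum>b\<in>B. c b *\<^sub>R b))"
    by (rule finite_spanningI[rotated]) (simp add: B C)
qed


section \<open>Smooth manifolds\<close>

text \<open>Only meaningful for open \<open>S\<close>. On finite-dimensional spaces, \<open>Ck_on k\<close> is the usual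
  class of \<open>k\<close> times continuously differentiable maps.\<close>

primrec Ck_on :: "nat \<Rightarrow> 'a::real_normed_vector set \<Rightarrow> ('a \<Rightarrow> 'b::real_normed_vector) \<Rightarrow> bool" where
  "Ck_on 0 S f \<longleftrightarrow> continuous_on S f"
| "Ck_on (Suc k) S f \<longleftrightarrow>
     (\<forall>x\<in>S. f differentiable (at x)) \<and> (\<forall>v. Ck_on k S (\<lambda>x. frechet_derivative f (at x) v))"

definition smooth_on :: "'a::real_normed_vector set \<Rightarrow> ('a \<Rightarrow> 'b::real_normed_vector) \<Rightarrow> bool" where
  "smooth_on S f \<longleftrightarrow> (\<forall>k. Ck_on k S f)"

text \<open>A manifold is given by an atlas: a set of charts \<open>(U, \<phi>)\<close>, where only the values of \<open>\<phi>\<close>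
  on \<open>U\<close> matter. Its underlying set and its topology are derived from the atlas.\<close>

type_synonym ('m, 'b) atlas = "('m set \<times> ('m \<Rightarrow> 'b)) set"

definition points :: "('m, 'b) atlas \<Rightarrow> 'm set" where
  "points A = (\<Union>(U, \<phi>)\<in>A. U)"

definition atlas_topology :: "('m, 'b::finite_dim_inner) atlas \<Rightarrow> 'm topology" where
  "atlas_topology A =
     topology (\<lambda>W. W \<subseteq> points A \<and> (\<forall>(U, \<phi>)\<in>A. open (\<phi> ` (U \<inter> W))))"

definition smooth_atlas :: "('m, 'b::finite_dim_inner) atlas \<Rightarrow> bool" where
  "smooth_atlas A \<longleftrightarrow>
     (\<forall>(U, \<phi>)\<in>A. inj_on \<phi> U \<and> open (\<phi> ` U)) \<and>
     (\<forall>(U, \<phi>)\<in>A. \<forall>(V, \<psi>)\<in>A.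
        open (\<phi> ` (U \<inter> V)) \<and> smooth_on (\<phi> ` (U \<inter> V)) (\<psi> \<circ> inv_into U \<phi>))"

definition manifold :: "('m, 'b::finite_dim_inner) atlas \<Rightarrow> bool" where
  "manifold A \<longleftrightarrow> smooth_atlas A \<and>
     Hausdorff_space (atlas_topology A) \<and> second_countable (atlas_topology A)"

text \<open>The openness condition says that \<open>F\<close> is continuous.\<close>

definition smooth_map ::
    "('m, 'b::finite_dim_inner) atlas \<Rightarrow> ('n, 'c::finite_dim_inner) atlas \<Rightarrow> ('m \<Rightarrow> 'n) \<Rightarrow> bool" where
  "smooth_map A B F \<longleftrightarrow> F ` points A \<subseteq> points B \<and>
     (\<forall>(U, \<phi>)\<in>A. \<forall>(V, \<psi>)\<in>B.
        open (\<phi> ` {x \<in> U. F x \<in> V}) \<and>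
        smooth_on (\<phi> ` {x \<in> U. F x \<in> V}) (\<psi> \<circ> F \<circ> inv_into U \<phi>))"

text \<open>Functions, sections and tangent vectors are extensional (they take the value
  \<^const>\<open>undefined\<close> outside their domain), so that equality of HOL functions is equality of the
  mathematical objects.\<close>

definition smooth_functions :: "('m, 'b::finite_dim_inner) atlas \<Rightarrow> ('m \<Rightarrow> real) set" where
  "smooth_functions A =
     {f \<in> extensional (points A). \<forall>(U, \<phi>)\<in>A. smooth_on (\<phi> ` U) (f \<circ> inv_into U \<phi>)}"

text \<open>Tangent vectors at \<open>p\<close> are the derivations of the algebra of smooth functions at \<open>p\<close>.\<close>

definition tangent_space ::
    "('m, 'b::finite_dim_inner) atlas \<Rightarrow> 'm \<Rightarrow> (('m \<Rightarrow> real) \<Rightarrow> real) set" where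
  "tangent_space A p = {v \<in> extensional (smooth_functions A).
     \<forall>f\<in>smooth_functions A. \<forall>g\<in>smooth_functions A.
       (\<forall>a b. v (\<lambda>x\<in>points A. a * f x + b * g x) = a * v f + b * v g) \<and>
       v (\<lambda>x\<in>points A. f x * g x) = f p * v g + g p * v f}"

definition tangent_map ::
    "('m, 'b::finite_dim_inner) atlas \<Rightarrow> ('n, 'c::finite_dim_inner) atlas \<Rightarrow> ('m \<Rightarrow> 'n)
      \<Rightarrow> (('m \<Rightarrow> real) \<Rightarrow> real) \<Rightarrow> (('n \<Rightarrow> real) \<Rightarrow> real)" where
  "tangent_map A B F v = (\<lambda>f\<in>smooth_functions B. v (\<lambda>x\<in>points A. f (F x)))"

type_synonym 'm vfield = "'m \<Rightarrow> ('m \<Rightarrow> real) \<Rightarrow> real"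

definition vf_apply :: "('m, 'b::finite_dim_inner) atlas \<Rightarrow> 'm vfield \<Rightarrow> ('m \<Rightarrow> real) \<Rightarrow> ('m \<Rightarrow> real)" where
  "vf_apply A X f = (\<lambda>x\<in>points A. X x f)"

definition vector_field :: "('m, 'b::finite_dim_inner) atlas \<Rightarrow> 'm vfield \<Rightarrow> bool" where
  "vector_field A X \<longleftrightarrow> (\<forall>p\<in>points A. X p \<in> tangent_space A p) \<and>
     (\<forall>f\<in>smooth_functions A. vf_apply A X f \<in> smooth_functions A)"


section \<open>Flows\<close>

text \<open>The velocity of a curve \<open>c\<close> at time \<open>t\<close> is the derivation sending \<open>f\<close> to the derivative of
  \<open>f \<circ> c\<close> at \<open>t\<close>; differentiability of all \<open>f \<circ> c\<close> amounts to differentiability of \<open>c\<close> in charts.\<close>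

definition integral_curve ::
    "('m, 'b::finite_dim_inner) atlas \<Rightarrow> 'm vfield \<Rightarrow> real set \<Rightarrow> (real \<Rightarrow> 'm) \<Rightarrow> bool" where
  "integral_curve A X J c \<longleftrightarrow> c ` J \<subseteq> points A \<and>
     (\<forall>t\<in>J. \<forall>f\<in>smooth_functions A. ((\<lambda>s. f (c s)) has_real_derivative X (c t) f) (at t))"

definition maximal_flow ::
    "('m, 'b::finite_dim_inner) atlas \<Rightarrow> 'm vfield \<Rightarrow> (real \<times> 'm) set \<Rightarrow> (real \<Rightarrow> 'm \<Rightarrow> 'm) \<Rightarrow> bool" where
  "maximal_flow A X \<Omega> \<phi> \<longleftrightarrow> \<Omega> \<subseteq> UNIV \<times> points A \<and>
     (\<forall>x\<in>points A. let J = {t. (t, x) \<in> \<Omega>} in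
        open J \<and> is_interval J \<and> 0 \<in> J \<and> integral_curve A X J (\<lambda>t. \<phi> t x) \<and> \<phi> 0 x = x \<and>
        (\<forall>I c. open I \<and> is_interval I \<and> 0 \<in> I \<and> integral_curve A X I c \<and> c 0 = x
           \<longrightarrow> I \<subseteq> J \<and> (\<forall>t\<in>I. c t = \<phi> t x)))"


section \<open>Vector bundles\<close>

text \<open>A local trivialisation is recorded as \<open>(W, \<psi>)\<close>, where \<open>W\<close> is an open set of the base and
  \<open>\<psi>\<close> is the fibre component of the trivialisation \<open>g \<mapsto> (q g, \<psi> g)\<close> of the restriction to \<open>W\<close>.\<close>

record ('m, 'b, 'e, 'f) vbundle =
  base :: "('m, 'b) atlas"
  total :: "'e set"
  proj :: "'e \<Rightarrow> 'm"
  vadd :: "'e \<Rightarrow> 'e \<Rightarrow> 'e"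
  vscale :: "real \<Rightarrow> 'e \<Rightarrow> 'e"
  trivs :: "('m set \<times> ('e \<Rightarrow> 'f)) set"

definition fibre :: "('m, 'b, 'e, 'f) vbundle \<Rightarrow> 'm \<Rightarrow> 'e set" where
  "fibre G x = {g \<in> total G. proj G g = x}"

definition total_atlas :: "('m, 'b, 'e, 'f) vbundle \<Rightarrow> ('e, 'b \<times> 'f) atlas" where
  "total_atlas G =
     {({g \<in> total G. proj G g \<in> U \<inter> W}, \<lambda>g. (\<phi> (proj G g), \<psi> g)) | U \<phi> W \<psi>.
        (U, \<phi>) \<in> base G \<and> (W, \<psi>) \<in> trivs G}"

text \<open>The vector space axioms for the fibres need not be stated: they are transported from the
  model fibre along the bijections \<open>\<psi>\<close>. That \<^const>\<open>total_atlas\<close> is a smooth atlas contains the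
  smoothness of the transition functions.\<close>

definition vector_bundle ::
    "('m, 'b::finite_dim_inner, 'e, 'f::finite_dim_inner) vbundle \<Rightarrow> bool" where
  "vector_bundle G \<longleftrightarrow>
     manifold (base G) \<and> manifold (total_atlas G) \<and>
     proj G ` total G \<subseteq> points (base G) \<and>
     (\<forall>x\<in>points (base G). \<forall>g\<in>fibre G x.
        (\<forall>h\<in>fibre G x. vadd G g h \<in> fibre G x) \<and> (\<forall>r. vscale G r g \<in> fibre G x)) \<and>
     (\<Union>(W, \<psi>)\<in>trivs G. W) = points (base G) \<and>
     (\<forall>(W, \<psi>)\<in>trivs G. openin (atlas_topology (base G)) W \<and>
        (\<forall>x\<in>W. bij_betw \<psi> (fibre G x) UNIV \<and>
           (\<forall>g\<in>fibre G x. (\<forall>h\<in>fibre G x. \<psi> (vadd G g h) = \<psi> g + \<psi> h) \<and>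
              (\<forall>r. \<psi> (vscale G r g) = r *\<^sub>R \<psi> g))))"

definition sections ::
    "('m, 'b::finite_dim_inner, 'e, 'f::finite_dim_inner) vbundle \<Rightarrow> ('m \<Rightarrow> 'e) set" where
  "sections G = {s \<in> extensional (points (base G)).
     smooth_map (base G) (total_atlas G) s \<and> (\<forall>x\<in>points (base G). proj G (s x) = x)}"

definition section_add ::
    "('m, 'b, 'e, 'f) vbundle \<Rightarrow> ('m \<Rightarrow> 'e) \<Rightarrow> ('m \<Rightarrow> 'e) \<Rightarrow> ('m \<Rightarrow> 'e)" where
  "section_add G s s' = (\<lambda>x\<in>points (base G). vadd G (s x) (s' x))"

definition section_scale ::
    "('m, 'b, 'e, 'f) vbundle \<Rightarrow> ('m \<Rightarrow> real) \<Rightarrow> ('m \<Rightarrow> 'e) \<Rightarrow> ('m \<Rightarrow> 'e)" where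
  "section_scale G f s = (\<lambda>x\<in>points (base G). vscale G (f x) (s x))"

text \<open>Elements of the dual bundle are pairs of a base point \<open>x\<close> and a linear form on the fibre over
  \<open>x\<close>. The dual of a trivialisation takes values in the dual of the model fibre, which is
  identified with the model fibre by means of the inner product.\<close>

definition dual_bundle ::
    "('m, 'b, 'e, 'f::finite_dim_inner) vbundle \<Rightarrow> ('m, 'b, 'm \<times> ('e \<Rightarrow> real), 'f) vbundle" where
  "dual_bundle G =
     \<lparr>base = base G,
      total = {(x, \<epsilon>). x \<in> points (base G) \<and> \<epsilon> \<in> extensional (fibre G x) \<and>
        (\<forall>g\<in>fibre G x. (\<forall>h\<in>fibre G x. \<epsilon> (vadd G g h) = \<epsilon> g + \<epsilon> h) \<and>
           (\<forall>r. \<epsilon> (vscale G r g) = r * \<epsilon> g))},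
      proj = fst,
      vadd = (\<lambda>(x, \<epsilon>) (x', \<epsilon>'). (x, \<lambda>g\<in>fibre G x. \<epsilon> g + \<epsilon>' g)),
      vscale = (\<lambda>r (x, \<epsilon>). (x, \<lambda>g\<in>fibre G x. r * \<epsilon> g)),
      trivs = {(W, \<lambda>(x, \<epsilon>). THE w. \<forall>g\<in>fibre G x. \<epsilon> g = w \<bullet> \<psi> g) | W \<psi>. (W, \<psi>) \<in> trivs G}\<rparr>"

definition pairing ::
    "('m, 'b, 'e, 'f) vbundle \<Rightarrow> ('m \<Rightarrow> 'm \<times> ('e \<Rightarrow> real)) \<Rightarrow> ('m \<Rightarrow> 'e) \<Rightarrow> ('m \<Rightarrow> real)" where
  "pairing G \<gamma> s = (\<lambda>x\<in>points (base G). snd (\<gamma> x) (s x))"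

text \<open>The fibrewise linear function \<open>\<ell>\<^sub>\<gamma>\<close> and the pullback of functions along the projection.\<close>

definition fibre_linear ::
    "('m, 'b, 'e, 'f) vbundle \<Rightarrow> ('m \<Rightarrow> 'm \<times> ('e \<Rightarrow> real)) \<Rightarrow> ('e \<Rightarrow> real)" where
  "fibre_linear G \<gamma> = (\<lambda>g\<in>total G. snd (\<gamma> (proj G g)) g)"

definition proj_pullback :: "('m, 'b, 'e, 'f) vbundle \<Rightarrow> ('m \<Rightarrow> real) \<Rightarrow> ('e \<Rightarrow> real)" where
  "proj_pullback G f = (\<lambda>g\<in>total G. f (proj G g))"


section \<open>Linear derivations and linear vector fields\<close>

definition linear_derivation ::
    "('m, 'b::finite_dim_inner, 'e, 'f::finite_dim_inner) vbundle \<Rightarrow> 'm vfield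
      \<Rightarrow> (('m \<Rightarrow> 'e) \<Rightarrow> ('m \<Rightarrow> 'e)) \<Rightarrow> bool" where
  "linear_derivation G X D \<longleftrightarrow> vector_field (base G) X \<and> D \<in> sections G \<rightarrow> sections G \<and>
     (\<forall>s\<in>sections G. \<forall>s'\<in>sections G. D (section_add G s s') = section_add G (D s) (D s')) \<and>
     (\<forall>r. \<forall>s\<in>sections G. D (section_scale G (\<lambda>_. r) s) = section_scale G (\<lambda>_. r) (D s)) \<and>
     (\<forall>f\<in>smooth_functions (base G). \<forall>s\<in>sections G.
        D (section_scale G f s) =
          section_add G (section_scale G (vf_apply (base G) X f) s) (section_scale G f (D s)))"

text \<open>\<open>D'\<close> is the dual derivation of \<open>D\<close>; it is determined on sections by these conditions.\<close>

definition dual_derivation ::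
    "('m, 'b::finite_dim_inner, 'e, 'f::finite_dim_inner) vbundle \<Rightarrow> 'm vfield
      \<Rightarrow> (('m \<Rightarrow> 'e) \<Rightarrow> ('m \<Rightarrow> 'e))
      \<Rightarrow> (('m \<Rightarrow> 'm \<times> ('e \<Rightarrow> real)) \<Rightarrow> ('m \<Rightarrow> 'm \<times> ('e \<Rightarrow> real))) \<Rightarrow> bool" where
  "dual_derivation G X D D' \<longleftrightarrow>
     D' \<in> sections (dual_bundle G) \<rightarrow> sections (dual_bundle G) \<and>
     (\<forall>\<gamma>\<in>sections (dual_bundle G). \<forall>s\<in>sections G. \<forall>x\<in>points (base G).
        pairing G (D' \<gamma>) s x = X x (pairing G \<gamma> s) - pairing G \<gamma> (D s) x)"

text \<open>The fibre product of the total space with itself over the base, on which the fibrewise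
  addition is defined.\<close>

definition whitney_square ::
    "('m, 'b, 'e, 'f) vbundle \<Rightarrow> ('m, 'b, 'e \<times> 'e, 'f \<times> 'f) vbundle" where
  "whitney_square G =
     \<lparr>base = base G,
      total = {(g, h). g \<in> total G \<and> h \<in> total G \<and> proj G g = proj G h},
      proj = (\<lambda>(g, h). proj G g),
      vadd = (\<lambda>(g, h) (g', h'). (vadd G g g', vadd G h h')),
      vscale = (\<lambda>r (g, h). (vscale G r g, vscale G r h)),
      trivs = {(W, \<lambda>(g, h). (\<psi> g, \<psi> h)) | W \<psi>. (W, \<psi>) \<in> trivs G}\<rparr>"

text \<open>Linear vector fields over \<open>X\<close>: vector bundle morphisms over \<open>X\<close> into the tangent prolongation,
  whose operations are the tangent maps of those of \<open>G\<close>. The sum of \<open>u\<close> and \<open>v\<close> there is the image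
  under the tangent map of the addition of the unique \<open>w\<close> tangent to the fibre product and with
  components \<open>u\<close> and \<open>v\<close>.\<close>

definition linear_vector_field ::
    "('m, 'b::finite_dim_inner, 'e, 'f::finite_dim_inner) vbundle \<Rightarrow> 'm vfield \<Rightarrow> 'e vfield \<Rightarrow> bool" where
  "linear_vector_field G X V \<longleftrightarrow>
     vector_field (base G) X \<and> vector_field (total_atlas G) V \<and>
     (\<forall>g\<in>total G. tangent_map (total_atlas G) (base G) (proj G) (V g) = X (proj G g)) \<and>
     (\<forall>g\<in>total G. \<forall>h\<in>total G. proj G g = proj G h \<longrightarrow>
        (\<exists>w\<in>tangent_space (total_atlas (whitney_square G)) (g, h).
           tangent_map (total_atlas (whitney_square G)) (total_atlas G) fst w = V g \<and>
           tangent_map (total_atlas (whitney_square G)) (total_atlas G) snd w = V h \<and>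
           tangent_map (total_atlas (whitney_square G)) (total_atlas G) (\<lambda>(a, b). vadd G a b) w
             = V (vadd G g h))) \<and>
     (\<forall>r. \<forall>g\<in>total G.
        tangent_map (total_atlas G) (total_atlas G) (vscale G r) (V g) = V (vscale G r g))"

text \<open>\<open>V\<close> is the linear vector field over \<open>X\<close> associated with the derivation \<open>D\<close>; it is determined
  on the total space by these conditions.\<close>

definition associated_vector_field ::
    "('m, 'b::finite_dim_inner, 'e, 'f::finite_dim_inner) vbundle \<Rightarrow> 'm vfield
      \<Rightarrow> (('m \<Rightarrow> 'e) \<Rightarrow> ('m \<Rightarrow> 'e)) \<Rightarrow> 'e vfield \<Rightarrow> bool" where
  "associated_vector_field G X D V \<longleftrightarrow> linear_vector_field G X V \<and>
     (\<exists>D'. dual_derivation G X D D' \<and>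
        (\<forall>\<gamma>\<in>sections (dual_bundle G).
           vf_apply (total_atlas G) V (fibre_linear G \<gamma>) = fibre_linear G (D' \<gamma>))) \<and>
     (\<forall>f\<in>smooth_functions (base G).
        vf_apply (total_atlas G) V (proj_pullback G f) = proj_pullback G (vf_apply (base G) X f))"

end

theory Submission
  imports Defs
begin

text \<open>A curve \<open>c\<close> in a vector bundle is an integral curve of the linear vector field of a derivation
  with dual derivation \<open>D'\<close> as soon as its projection is an integral curve of \<open>X\<close> and
  \<open>\<ell>\<^sub>\<gamma> \<circ> c\<close> has derivative \<open>\<ell>\<close> of \<open>D' \<gamma>\<close> along \<open>c\<close> for all \<open>\<gamma>\<close>; this is Hadamard's lemma. Hence fibrewise
  linear combinations of integral curves over the same base curve are integral curves. So the flow of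
  the vector field is linear, its lifetime is bounded below uniformly on each fibre, and, an injective
  linear map between fibres being surjective, every integral curve lives as long as its projection.
  No existence theorem for linear differential equations is needed.

  On the dual side, \<open>\<epsilon> \<circ> \<Phi>\<close> at time \<open>- t\<close> is an integral curve because the derivative of the transported
  section \<open>\<Phi> (- t) (s (\<phi> t x))\<close> is the transport of \<open>D s\<close>. It is the only one with initial value \<open>\<epsilon>\<close>
  because the pairing of an integral curve in the dual with an integral curve over the same base
  curve is constant.\<close>


text \<open>Tangent vectors are derivations of globally defined smooth functions, and an integral
  curve is tested against all such functions. Every local argument must therefore be carried by
  global data. These come from cut-off functions on the base; nothing is cut off along the fibres,
  where the coordinates of a trivialisation are defined everywhere. The transported section is the
  delicate point, because \<open>maximal_flow\<close> says nothing about dependence on the initial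
  value. The derivative of \<open>\<Phi> t e\<close> in \<open>t\<close> is at hand only for a fixed
  \<open>e\<close>, whereas in \<open>\<Phi> (- t) (s (\<phi> t x))\<close> the argument moves with
  \<open>t\<close>. The transported section is therefore recovered as the solution of a linear
  system whose coefficients are pairings with curves of fixed initial value, and which is the
  identity at the time of interest. The same difficulty appears in the pairing of two integral
  curves. There the two curves are separated by a local frame and its dual frame, and the product
  rule applies to their coordinates.\<close>

section \<open>Orthonormal bases and the topology of the model spaces\<close>

text \<open>Gram-Schmidt gives an orthogonal spanning set that may contain 0, so 0 is removed before
  normalising. In the zero space this leaves the empty basis.\<close>

lemma orthonormal_basis_exists:
  "\<exists>B :: 'a::finite_dim_inner set. finite B \<and> (\<forall>i\<in>B. \<forall>j\<in>B. i \<bullet> j = (if i = j then 1 else 0)) \<and>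
     span B = UNIV"
proof -
  obtain B0 :: "'a set" where B0: "finite B0" "span B0 = UNIV"
    using finite_dim by blast
  obtain C where C: "finite C" "span C = (UNIV :: 'a set)" "pairwise orthogonal C"
    using basis_orthogonal[OF B0(1)] B0(2) by metis
  define B where "B = (\<lambda>x. inverse (norm x) *\<^sub>R x) ` (C - {0})"
  have "finite B" using C by (simp add: B_def)
  moreover have "i \<bullet> j = (if i = j then 1 else 0)" if ij: "i \<in> B" "j \<in> B" for i j
  proof -
    obtain x y where xy: "x \<in> C" "x \<noteq> 0" "i = inverse (norm x) *\<^sub>R x"
      "y \<in> C" "y \<noteq> 0" "j = inverse (norm y) *\<^sub>R y"
      using ij by (auto simp: B_def)
    show ?thesis
    proof (cases "x = y")
      case True
      then show ?thesis using xy
        by (simp add: power2_norm_eq_inner[symmetric] power2_eq_square)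
    next
      case False
      then have o: "x \<bullet> y = 0" using C(3) xy unfolding pairwise_def orthogonal_def by blast
      then have "i \<bullet> j = 0" by (simp add: xy)
      moreover have "i \<bullet> i \<noteq> 0" using xy by simp
      ultimately show ?thesis by auto
    qed
  qed
  moreover have "C \<subseteq> span B"
  proof
    fix x assume x: "x \<in> C"
    show "x \<in> span B"
    proof (cases "x = 0")
      case False
      then have "inverse (norm x) *\<^sub>R x \<in> B" using x by (auto simp: B_def)
      then have "norm x *\<^sub>R (inverse (norm x) *\<^sub>R x) \<in> span B" by (intro span_scale span_base)
      then show ?thesis using False by simp
    qed (simp add: span_zero)
  qed
  then have "span B = UNIV" using C(2) by (metis span_mono span_span top.extremum_unique)
  ultimately show ?thesis by blast
qed

text \<open>Plays the part that \<open>Basis\<close> has in \<open>euclidean_space\<close>: a fixed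
  index set for coordinates and for finite sums of partial derivatives.\<close>

definition ONB :: "'a::finite_dim_inner set" where
  "ONB = (SOME B. finite B \<and> (\<forall>i\<in>B. \<forall>j\<in>B. i \<bullet> j = (if i = j then 1 else 0)) \<and> span B = UNIV)"

lemma ONB:
  shows finite_ONB [simp]: "finite (ONB :: 'a::finite_dim_inner set)"
    and inner_ONB: "i \<in> ONB \<Longrightarrow> j \<in> ONB \<Longrightarrow> i \<bullet> (j :: 'a) = (if i = j then 1 else 0)"
    and span_ONB [simp]: "span ONB = (UNIV :: 'a set)"
proof -
  have *: "finite (ONB :: 'a set) \<and>
      (\<forall>i\<in>ONB. \<forall>j\<in>ONB. i \<bullet> (j :: 'a) = (if i = j then 1 else 0)) \<and> span ONB = (UNIV :: 'a set)"
    unfolding ONB_def by (rule someI_ex[OF orthonormal_basis_exists])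
  then show "finite (ONB :: 'a set)" "span ONB = (UNIV :: 'a set)" by simp_all
  show "i \<in> ONB \<Longrightarrow> j \<in> ONB \<Longrightarrow> i \<bullet> (j :: 'a) = (if i = j then 1 else 0)"
    using * by metis
qed

lemma ONB_sum_inner: "i \<in> ONB \<Longrightarrow> (\<Sum>b\<in>ONB. c b *\<^sub>R b) \<bullet> (i :: 'a::finite_dim_inner) = c i"
  by (simp add: inner_sum_left inner_ONB if_distrib[of "(*) _"] cong: if_cong sum.cong)

lemma ONB_expansion: "(\<Sum>b\<in>ONB. (x \<bullet> b) *\<^sub>R b) = (x :: 'a::finite_dim_inner)"
proof -
  have "x \<in> span ONB" by simp
  then obtain c where x: "x = (\<Sum>b\<in>ONB. c b *\<^sub>R b)"
    unfolding span_finite[OF finite_ONB] by blast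
  have "(\<Sum>b\<in>ONB. (x \<bullet> b) *\<^sub>R b) = (\<Sum>b\<in>ONB. c b *\<^sub>R b)"
    by (rule sum.cong) (simp_all add: x ONB_sum_inner)
  then show ?thesis using x by simp
qed

lemma norm_ONB: "b \<in> ONB \<Longrightarrow> norm (b :: 'a::finite_dim_inner) = 1"
  by (simp add: norm_eq_sqrt_inner inner_ONB)

lemma linear_ONB:
  fixes f :: "'a::finite_dim_inner \<Rightarrow> 'b::real_vector"
  assumes "linear f"
  shows "f x = (\<Sum>b\<in>ONB. (x \<bullet> b) *\<^sub>R f b)"
  by (subst ONB_expansion[of x, symmetric])
    (simp only: linear_sum[OF assms] linear_cmul[OF assms])

text \<open>The coordinate expansion writes \<open>f\<close> as a finite sum of bounded linear
  maps.\<close>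

lemma linear_bounded_linear:
  fixes f :: "'a::finite_dim_inner \<Rightarrow> 'b::real_normed_vector"
  assumes "linear f"
  shows "bounded_linear f"
proof -
  have "bounded_linear (\<lambda>x. \<Sum>b\<in>ONB. (x \<bullet> b) *\<^sub>R f b)"
    by (intro bounded_linear_sum bounded_linear_scaleR_const bounded_linear_inner_left)
  moreover have "(\<lambda>x. \<Sum>b\<in>ONB. (x \<bullet> b) *\<^sub>R f b) = f"
    by (rule ext) (rule linear_ONB[OF assms, symmetric])
  ultimately show ?thesis by (rule back_subst)
qed

text \<open>Bolzano-Weierstrass, coordinate by coordinate. Compactness of closed balls makes the
  supports in \<open>cutoff_exists\<close> compact, and completeness, which follows, is what
  differentiation under the integral sign asks of the domain.\<close>

instance finite_dim_inner \<subseteq> heine_borel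
proof
  fix f :: "nat \<Rightarrow> 'a"
  assume f: "bounded (range f)"
  have "\<forall>\<delta>\<subseteq>ONB. \<exists>l::'a. \<exists>r::nat\<Rightarrow>nat. strict_mono r \<and>
      (\<forall>\<epsilon>>0. eventually (\<lambda>n. \<forall>i\<in>\<delta>. dist (f (r n) \<bullet> i) (l \<bullet> i) < \<epsilon>) sequentially)"
    by (rule compact_lemma_general[where unproj="\<lambda>e. \<Sum>i\<in>ONB. e i *\<^sub>R i"])
      (auto intro!: f bounded_linear_inner_left bounded_linear_image simp: ONB_expansion ONB_sum_inner)
  then obtain l :: 'a and r where r: "strict_mono r"
    and l: "\<And>e. e > 0 \<Longrightarrow> \<forall>\<^sub>F n in sequentially. \<forall>i\<in>ONB. dist (f (r n) \<bullet> i) (l \<bullet> i) < e"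
    by (meson order_refl)
  have "(\<lambda>n. f (r n) \<bullet> i) \<longlonglongrightarrow> l \<bullet> i" if "i \<in> ONB" for i
  proof (rule tendstoI)
    fix e :: real assume "e > 0"
    from l[OF this] show "\<forall>\<^sub>F n in sequentially. dist (f (r n) \<bullet> i) (l \<bullet> i) < e"
      by (rule eventually_mono) (use that in blast)
  qed
  then have "(\<lambda>n. \<Sum>i\<in>ONB. (f (r n) \<bullet> i) *\<^sub>R i) \<longlonglongrightarrow> (\<Sum>i\<in>ONB. (l \<bullet> i) *\<^sub>R i)"
    by (intro tendsto_sum tendsto_scaleR tendsto_const)
  then have "(f \<circ> r) \<longlonglongrightarrow> l" by (simp add: ONB_expansion o_def)
  then show "\<exists>l r. strict_mono r \<and> (f \<circ> r) \<longlonglongrightarrow> l" using r by blast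
qed

instance finite_dim_inner \<subseteq> banach ..

section \<open>Smooth maps between open sets\<close>

lemma Ck_on_subset: "Ck_on k S f \<Longrightarrow> T \<subseteq> S \<Longrightarrow> Ck_on k T f"
  by (induction k arbitrary: f) (auto intro: continuous_on_subset)

lemma Ck_on_cong:
  assumes "open S" "\<And>x. x \<in> S \<Longrightarrow> f x = g x" "Ck_on k S f"
  shows "Ck_on k S g"
  using assms(2,3)
proof (induction k arbitrary: f g)
  case 0
  then show ?case by (simp cong: continuous_on_cong)
next
  case (Suc k)
  have D: "(g has_derivative frechet_derivative f (at x)) (at x)" if "x \<in> S" for x
  proof -
    have "(f has_derivative frechet_derivative f (at x)) (at x)"
      using Suc.prems(2) that by (intro iffD1[OF frechet_derivative_works]) simp
    then show ?thesis
      by (rule has_derivative_transform_within_open[OF _ assms(1) that]) (use Suc.prems in auto)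
  qed
  have "frechet_derivative f (at x) v = frechet_derivative g (at x) v" if "x \<in> S" for x v
    by (rule fun_cong[OF frechet_derivative_at[OF D[OF that]]])
  then have "Ck_on k S (\<lambda>x. frechet_derivative g (at x) v)" for v
    by (rule Suc.IH[of "\<lambda>x. frechet_derivative f (at x) v"]) (use Suc.prems(2) in auto)
  moreover have "\<forall>x\<in>S. g differentiable (at x)" using D unfolding differentiable_def by blast
  ultimately show ?case by simp
qed

text \<open>Replaces the derivative chosen by \<open>frechet_derivative\<close> by any explicit
  formula \<open>f'\<close>. The closure properties below are inductions through this rule.\<close>

lemma Ck_on_SucI:
  assumes "open S" "\<And>x. x \<in> S \<Longrightarrow> (f has_derivative f' x) (at x)"
    and "\<And>v. Ck_on k S (\<lambda>x. f' x v)"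
  shows "Ck_on (Suc k) S f"
proof -
  have "f' x v = frechet_derivative f (at x) v" if "x \<in> S" for x v
    using frechet_derivative_at[OF assms(2)[OF that]] by simp
  then have "Ck_on k S (\<lambda>x. frechet_derivative f (at x) v)" for v
    by (rule Ck_on_cong[OF assms(1) _ assms(3)])
  moreover have "\<forall>x\<in>S. f differentiable (at x)" using assms(2) unfolding differentiable_def by blast
  ultimately show ?thesis by simp
qed

lemma Ck_on_SucD:
  assumes "Ck_on (Suc k) S f"
  shows "x \<in> S \<Longrightarrow> (f has_derivative frechet_derivative f (at x)) (at x)"
    and "Ck_on k S (\<lambda>x. frechet_derivative f (at x) v)"
  using assms by (auto intro: iffD1[OF frechet_derivative_works])

lemma Ck_on_continuous:
  assumes "Ck_on k S f"
  shows "continuous_on S f"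
proof (cases k)
  case 0
  then show ?thesis using assms by simp
next
  case (Suc j)
  then have "\<forall>x\<in>S. f differentiable (at x)" using assms by simp
  then show ?thesis
    by (meson continuous_at_imp_continuous_on differentiable_imp_continuous_within)
qed

lemma Ck_on_Suc_imp:
  assumes "open S"
  shows "Ck_on (Suc k) S f \<Longrightarrow> Ck_on k S f"
proof (induction k arbitrary: f)
  case 0
  show ?case by (simp add: Ck_on_continuous[OF "0.prems"])
next
  case (Suc k)
  show ?case
  proof (rule Ck_on_SucI[OF assms])
    show "(f has_derivative frechet_derivative f (at x)) (at x)" if "x \<in> S" for x
      by (rule Ck_on_SucD(1)[OF Suc.prems that])
    show "Ck_on k S (\<lambda>x. frechet_derivative f (at x) v)" for v
      by (rule Suc.IH[OF Ck_on_SucD(2)[OF Suc.prems]])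
  qed
qed

lemma Ck_on_const: "Ck_on k S (\<lambda>_. c)"
proof (induction k arbitrary: c)
  case (Suc k)
  have "frechet_derivative (\<lambda>_ :: 'a. c) (at x) = (\<lambda>_. 0)" for x
    by (rule frechet_derivative_at[symmetric]) simp
  then show ?case using Suc by simp
qed simp

lemma Ck_on_local:
  assumes "\<And>x. x \<in> S \<Longrightarrow> \<exists>T. open T \<and> x \<in> T \<and> Ck_on k T f"
  shows "Ck_on k S f"
  using assms
proof (induction k arbitrary: f)
  case 0
  have "isCont f x" if "x \<in> S" for x
    using 0[OF that] continuous_on_eq_continuous_at by auto
  then show ?case by (simp add: continuous_at_imp_continuous_on)
next
  case (Suc k)
  have "f differentiable (at x)" if "x \<in> S" for x
    using Suc.prems[OF that] by auto
  moreover have "Ck_on k S (\<lambda>x. frechet_derivative f (at x) v)" for v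
  proof (rule Suc.IH)
    fix x assume "x \<in> S"
    from Suc.prems[OF this] obtain T where "open T" "x \<in> T" "Ck_on (Suc k) T f" by blast
    then show "\<exists>T. open T \<and> x \<in> T \<and> Ck_on k T (\<lambda>x. frechet_derivative f (at x) v)"
      using Ck_on_SucD(2) by (intro exI[of _ T] conjI)
  qed
  ultimately show ?case by simp
qed

lemma Ck_on_bounded_linear:
  assumes "bounded_linear L" "open S"
  shows "Ck_on k S L"
proof (cases k)
  case 0
  then show ?thesis using assms by (simp add: linear_continuous_on)
next
  case (Suc j)
  show ?thesis unfolding Suc
    by (rule Ck_on_SucI[OF assms(2), where f' = "\<lambda>_. L"])
      (auto intro: bounded_linear_imp_has_derivative assms Ck_on_const)
qed

lemma Ck_on_add:
  assumes "open S" "Ck_on k S f" "Ck_on k S g"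
  shows "Ck_on k S (\<lambda>x. f x + g x)"
  using assms(2,3)
proof (induction k arbitrary: f g)
  case 0
  then show ?case by (simp add: continuous_on_add)
next
  case (Suc k)
  note D = Ck_on_SucD[OF Suc.prems(1)] Ck_on_SucD[OF Suc.prems(2)]
  show ?case
  proof (rule Ck_on_SucI[OF assms(1)])
    show "((\<lambda>x. f x + g x) has_derivative
        (\<lambda>v. frechet_derivative f (at x) v + frechet_derivative g (at x) v)) (at x)" if "x \<in> S" for x
      by (rule has_derivative_add[OF D(1)[OF that] D(3)[OF that]])
    show "Ck_on k S (\<lambda>x. frechet_derivative f (at x) v + frechet_derivative g (at x) v)" for v
      by (rule Suc.IH[OF D(2) D(4)])
  qed
qed

text \<open>In the product rule each summand contains one undifferentiated factor.
  \<open>Ck_on_Suc_imp\<close> lowers its order so that the induction hypothesis fits both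
  factors.\<close>

lemma Ck_on_bilinear:
  assumes "bounded_bilinear pr" "open S" "Ck_on k S f" "Ck_on k S g"
  shows "Ck_on k S (\<lambda>x. pr (f x) (g x))"
  using assms(3,4)
proof (induction k arbitrary: f g)
  case 0
  then show ?case using bounded_bilinear.continuous_on[OF assms(1)] by simp
next
  case (Suc k)
  note D = Ck_on_SucD[OF Suc.prems(1)] Ck_on_SucD[OF Suc.prems(2)]
  show ?case
  proof (rule Ck_on_SucI[OF assms(2)])
    show "((\<lambda>x. pr (f x) (g x)) has_derivative
        (\<lambda>v. pr (f x) (frechet_derivative g (at x) v) + pr (frechet_derivative f (at x) v) (g x))) (at x)"
      if "x \<in> S" for x
      by (rule bounded_bilinear.FDERIV[OF assms(1) D(1)[OF that] D(3)[OF that]])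
    show "Ck_on k S (\<lambda>x. pr (f x) (frechet_derivative g (at x) v) + pr (frechet_derivative f (at x) v) (g x))" for v
      by (rule Ck_on_add[OF assms(2) Suc.IH[OF Ck_on_Suc_imp[OF assms(2) Suc.prems(1)] D(4)]
            Suc.IH[OF D(2) Ck_on_Suc_imp[OF assms(2) Suc.prems(2)]]])
  qed
qed

lemma Ck_on_sum:
  assumes "open S" "\<And>i. i \<in> I \<Longrightarrow> Ck_on k S (f i)"
  shows "Ck_on k S (\<lambda>x. \<Sum>i\<in>I. f i x)"
  using assms(2)
  by (induction I rule: infinite_finite_induct) (auto intro: Ck_on_const Ck_on_add assms(1))

text \<open>In the chain rule \<open>x\<close> enters both the point at which \<open>g\<close> is
  differentiated and the direction. Expanding the direction along \<open>ONB\<close> separates the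
  two: the summands are products of a coordinate of the derivative of \<open>f\<close> with a
  partial derivative of \<open>g\<close> composed with \<open>f\<close>. The induction hypothesis
  covers the latter because \<open>g\<close> is arbitrary in it.\<close>

lemma Ck_on_compose:
  fixes f :: "'a::real_normed_vector \<Rightarrow> 'b::finite_dim_inner"
  assumes S: "open S" and T: "open T" and ST: "f ` S \<subseteq> T" and f: "Ck_on k S f" and g: "Ck_on k T g"
  shows "Ck_on k S (\<lambda>x. g (f x))"
  using f g
proof (induction k arbitrary: g)
  case 0
  then show ?case using ST by (auto intro: continuous_on_compose2)
next
  case (Suc k)
  note D = Ck_on_SucD[OF Suc.prems(1)] Ck_on_SucD[OF Suc.prems(2)]
  have fx: "f x \<in> T" if "x \<in> S" for x using ST that by auto
  have der: "((\<lambda>x. g (f x)) has_derivative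
      (\<lambda>v. \<Sum>b\<in>ONB. (frechet_derivative f (at x) v \<bullet> b) *\<^sub>R frechet_derivative g (at (f x)) b)) (at x)"
    if x: "x \<in> S" for x
  proof -
    have "linear (frechet_derivative g (at (f x)))"
      using D(3)[OF fx[OF x]] has_derivative_linear by blast
    then have "(\<lambda>v. frechet_derivative g (at (f x)) (frechet_derivative f (at x) v)) =
      (\<lambda>v. \<Sum>b\<in>ONB. (frechet_derivative f (at x) v \<bullet> b) *\<^sub>R frechet_derivative g (at (f x)) b)"
      by (intro ext linear_ONB)
    with has_derivative_compose[OF D(1)[OF x] D(3)[OF fx[OF x]]]
    show ?thesis by (rule back_subst)
  qed
  show ?case
  proof (rule Ck_on_SucI[OF S der])
    fix v
    have "Ck_on k S (\<lambda>x. frechet_derivative g (at (f x)) b)" for b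
      using Suc.IH[OF Ck_on_Suc_imp[OF S Suc.prems(1)] D(4)] .
    moreover have "Ck_on k S (\<lambda>x. frechet_derivative f (at x) v \<bullet> b)" for b
      by (intro Ck_on_bilinear[OF bounded_bilinear_inner] S D Ck_on_const)
    ultimately show "Ck_on k S (\<lambda>x. \<Sum>b\<in>ONB.
        (frechet_derivative f (at x) v \<bullet> b) *\<^sub>R frechet_derivative g (at (f x)) b)"
      by (intro Ck_on_sum S Ck_on_bilinear[OF bounded_bilinear_scaleR])
  qed
qed

lemma smooth_on_subset: "smooth_on S f \<Longrightarrow> T \<subseteq> S \<Longrightarrow> smooth_on T f"
  by (auto simp: smooth_on_def intro: Ck_on_subset)

lemma smooth_on_cong: "open S \<Longrightarrow> smooth_on S f \<Longrightarrow> (\<And>x. x \<in> S \<Longrightarrow> f x = g x) \<Longrightarrow> smooth_on S g"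
  unfolding smooth_on_def using Ck_on_cong by blast

lemma smooth_on_continuous: "smooth_on S f \<Longrightarrow> continuous_on S f"
  unfolding smooth_on_def using Ck_on_continuous by blast

lemma smooth_on_local:
  "(\<And>x. x \<in> S \<Longrightarrow> \<exists>T. open T \<and> x \<in> T \<and> smooth_on T f) \<Longrightarrow> smooth_on S f"
  unfolding smooth_on_def by (meson Ck_on_local)

lemma smooth_on_const: "smooth_on S (\<lambda>_. c)"
  by (simp add: smooth_on_def Ck_on_const)

lemma smooth_on_bounded_linear: "bounded_linear L \<Longrightarrow> open S \<Longrightarrow> smooth_on S L"
  by (simp add: smooth_on_def Ck_on_bounded_linear)

lemma smooth_on_add:
  "open S \<Longrightarrow> smooth_on S f \<Longrightarrow> smooth_on S g \<Longrightarrow> smooth_on S (\<lambda>x. f x + g x)"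
  by (simp add: smooth_on_def Ck_on_add)

lemma smooth_on_sum:
  "open S \<Longrightarrow> (\<And>i. i \<in> I \<Longrightarrow> smooth_on S (f i)) \<Longrightarrow> smooth_on S (\<lambda>x. \<Sum>i\<in>I. f i x)"
  by (simp add: smooth_on_def Ck_on_sum)

lemma smooth_on_bilinear:
  "bounded_bilinear pr \<Longrightarrow> open S \<Longrightarrow> smooth_on S f \<Longrightarrow> smooth_on S g \<Longrightarrow>
    smooth_on S (\<lambda>x. pr (f x) (g x))"
  by (simp add: smooth_on_def Ck_on_bilinear)

lemmas smooth_on_mult = smooth_on_bilinear[OF bounded_bilinear_mult]
  and smooth_on_scaleR = smooth_on_bilinear[OF bounded_bilinear_scaleR]
  and smooth_on_inner = smooth_on_bilinear[OF bounded_bilinear_inner]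

lemma smooth_on_compose:
  fixes f :: "'a::real_normed_vector \<Rightarrow> 'b::finite_dim_inner"
  shows "open S \<Longrightarrow> open T \<Longrightarrow> f ` S \<subseteq> T \<Longrightarrow> smooth_on S f \<Longrightarrow> smooth_on T g \<Longrightarrow>
    smooth_on S (\<lambda>x. g (f x))"
  by (auto simp: smooth_on_def intro: Ck_on_compose)

lemma smooth_on_linear_compose:
  fixes f :: "'a::real_normed_vector \<Rightarrow> 'b::finite_dim_inner"
  shows "bounded_linear L \<Longrightarrow> open S \<Longrightarrow> smooth_on S f \<Longrightarrow> smooth_on S (\<lambda>x. L (f x))"
  by (rule smooth_on_compose[where T = UNIV]) (auto intro: smooth_on_bounded_linear)

lemma smooth_on_Pair:
  fixes f :: "'a::real_normed_vector \<Rightarrow> 'b::finite_dim_inner" and g :: "'a \<Rightarrow> 'c::finite_dim_inner"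
  assumes "open S" "smooth_on S f" "smooth_on S g"
  shows "smooth_on S (\<lambda>x. (f x, g x))"
proof -
  have L: "bounded_linear (\<lambda>a :: 'b. (a, 0 :: 'c))" "bounded_linear (\<lambda>c :: 'c. (0 :: 'b, c))"
    by (auto intro!: linear_bounded_linear linearI)
  have "smooth_on S (\<lambda>x. (f x, 0) + (0, g x))"
    by (rule smooth_on_add[OF assms(1) smooth_on_linear_compose[OF L(1)] smooth_on_linear_compose[OF L(2)]])
      (use assms in auto)
  then show ?thesis by simp
qed

lemmas smooth_on_fst = smooth_on_linear_compose[OF bounded_linear_fst]
  and smooth_on_snd = smooth_on_linear_compose[OF bounded_linear_snd]

lemma smooth_on_ident: "open S \<Longrightarrow> smooth_on S (\<lambda>x. x)"
  by (rule smooth_on_bounded_linear[OF bounded_linear_ident])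


section \<open>Bump functions\<close>

text \<open>The derivative of \<open>inverse\<close> is a product of constants and copies of
  \<open>inverse\<close>, so each order follows from the previous one.\<close>

lemma Ck_on_inverse: "Ck_on k (- {0}) (inverse :: real \<Rightarrow> real)"
proof (induction k)
  case 0
  show ?case by (simp add: continuous_on_inverse)
next
  case (Suc k)
  have o: "open (- {0 :: real})" by (simp add: open_delete Compl_eq_Diff_UNIV)
  show ?case
  proof (rule Ck_on_SucI[OF o])
    show "((inverse :: real \<Rightarrow> real) has_derivative (\<lambda>v. - (inverse x * v * inverse x))) (at x)"
      if "x \<in> - {0}" for x
      using that by (intro has_derivative_inverse') auto
    have "Ck_on k (- {0}) (\<lambda>x :: real. (- v) * (inverse x * inverse x))" for v
      by (intro Ck_on_bilinear[OF bounded_bilinear_mult] o Ck_on_const Suc.IH)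
    then show "Ck_on k (- {0}) (\<lambda>x :: real. - (inverse x * v * inverse x))" for v
      by (rule Ck_on_cong[OF o, rotated]) simp
  qed
qed

lemma smooth_on_inverse:
  fixes f :: "'a::real_normed_vector \<Rightarrow> real"
  assumes "open S" "smooth_on S f" "\<And>x. x \<in> S \<Longrightarrow> f x \<noteq> 0"
  shows "smooth_on S (\<lambda>x. inverse (f x))"
proof -
  have o: "open (- {0 :: real})" by (simp add: open_delete Compl_eq_Diff_UNIV)
  show ?thesis
    by (rule smooth_on_compose[OF assms(1) o _ assms(2)])
      (use assms(3) in \<open>auto simp: smooth_on_def Ck_on_inverse\<close>)
qed

text \<open>The powers of \<open>inverse x\<close> are carried along so that the family is closed
  under differentiation up to linear combinations. Only \<open>flat_exp 0\<close>, the standard flat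
  function, is used in the end.\<close>

definition flat_exp :: "nat \<Rightarrow> real \<Rightarrow> real" where
  "flat_exp n x = (if x > 0 then exp (- inverse x) * inverse x ^ n else 0)"

text \<open>Substituting the inverse on the right turns this into the fact that the exponential
  outgrows every power; on the left the function is 0.\<close>

lemma flat_exp_tendsto_0: "(flat_exp n \<longlongrightarrow> 0) (at 0)"
proof -
  have "((\<lambda>x :: real. x ^ n / exp x) \<longlongrightarrow> 0) at_top"
    by (rule tendsto_power_div_exp_0)
  then have "((\<lambda>x :: real. inverse x ^ n / exp (inverse x)) \<longlongrightarrow> 0) (at_right 0)"
    by (rule filterlim_compose) (rule filterlim_inverse_at_top_right)
  moreover have "\<forall>\<^sub>F x :: real in at_right 0. inverse x ^ n / exp (inverse x) = flat_exp n x"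
    unfolding eventually_at_filter
    by (rule always_eventually) (simp add: flat_exp_def exp_minus field_simps)
  ultimately have R: "(flat_exp n \<longlongrightarrow> 0) (at_right 0)"
    by (rule Lim_transform_eventually)
  have "\<forall>\<^sub>F x :: real in at_left 0. 0 = flat_exp n x"
    unfolding eventually_at_filter by (rule always_eventually) (simp add: flat_exp_def)
  then have "(flat_exp n \<longlongrightarrow> 0) (at_left 0)"
    by (rule Lim_transform_eventually[OF tendsto_const])
  with R show ?thesis by (rule filterlim_split_at[rotated])
qed

lemma flat_exp_has_derivative:
  "(flat_exp n has_real_derivative flat_exp (n + 2) x - real n * flat_exp (n + 1) x) (at x)"
proof -
  consider "x < 0" | "x = 0" | "x > 0" by linarith
  then show ?thesis
  proof cases
    case 1
    have "(flat_exp n has_real_derivative 0) (at x)"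
      by (rule has_field_derivative_transform_within_open[OF DERIV_const[of 0], where S = "{..<0}"])
        (use 1 in \<open>auto simp: flat_exp_def\<close>)
    then show ?thesis using 1 by (simp add: flat_exp_def)
  next
    \<comment> \<open>The difference quotient at 0 is again a member of the family,
      \<open>flat_exp (Suc n)\<close>, and tends to 0.\<close>
    case 2
    have "\<forall>\<^sub>F h in at 0. flat_exp (Suc n) h = (flat_exp n (0 + h) - flat_exp n 0) / h"
      unfolding eventually_at_filter
      by (rule always_eventually) (simp add: flat_exp_def field_simps)
    then have "((\<lambda>h. (flat_exp n (0 + h) - flat_exp n 0) / h) \<longlongrightarrow> 0) (at 0)"
      by (rule Lim_transform_eventually[OF flat_exp_tendsto_0])
    then have "(flat_exp n has_real_derivative 0) (at 0)"
      unfolding DERIV_def .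
    then show ?thesis using 2 by (simp add: flat_exp_def)
  next
    case 3
    have "((\<lambda>x. exp (- inverse x) * inverse x ^ n) has_real_derivative
        exp (- inverse x) * (inverse x)\<^sup>2 * inverse x ^ n +
        exp (- inverse x) * (real n * inverse x ^ (n - 1) * (- (inverse x)\<^sup>2))) (at x)"
      using 3 by (auto intro!: derivative_eq_intros simp: power2_eq_square)
    also have "exp (- inverse x) * (inverse x)\<^sup>2 * inverse x ^ n +
        exp (- inverse x) * (real n * inverse x ^ (n - 1) * (- (inverse x)\<^sup>2)) =
        flat_exp (n + 2) x - real n * flat_exp (n + 1) x"
      using 3 by (cases n) (auto simp: flat_exp_def power2_eq_square algebra_simps)
    finally have "((\<lambda>x. exp (- inverse x) * inverse x ^ n) has_real_derivative
        flat_exp (n + 2) x - real n * flat_exp (n + 1) x) (at x)" .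
    then show ?thesis
      by (rule has_field_derivative_transform_within_open[where S = "{0<..}"])
        (use 3 in \<open>auto simp: flat_exp_def\<close>)
  qed
qed

lemma Ck_on_flat_exp: "Ck_on k UNIV (flat_exp n)"
proof (induction k arbitrary: n)
  case 0
  show ?case
    using flat_exp_has_derivative DERIV_isCont continuous_at_imp_continuous_on
    by (metis Ck_on.simps(1))
next
  case (Suc k)
  show ?case
  proof (rule Ck_on_SucI)
    show "(flat_exp n has_derivative
        (\<lambda>v. (flat_exp (n + 2) x + (- real n) * flat_exp (n + 1) x) * v)) (at x)" for x
      using flat_exp_has_derivative[of n x] by (simp add: has_field_derivative_def)
    show "Ck_on k UNIV (\<lambda>x. (flat_exp (n + 2) x + (- real n) * flat_exp (n + 1) x) * v)" for v
      by (intro Ck_on_bilinear[OF bounded_bilinear_mult] Ck_on_add open_UNIV Ck_on_const Suc.IH)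
  qed simp
qed

lemma smooth_step_exists:
  "\<exists>\<theta> :: real \<Rightarrow> real. smooth_on UNIV \<theta> \<and> (\<forall>x\<le>0. \<theta> x = 0) \<and> (\<forall>x\<ge>1. \<theta> x = 1)"
proof -
  let ?h = "flat_exp 0"
  \<comment> \<open>The standard quotient h(x) / (h(x) + h(1 - x)). The denominator is positive
    since x and 1 - x cannot both be \<le> 0.\<close>
  define \<theta> where "\<theta> x = ?h x * inverse (?h x + ?h (1 + (- 1) * x))" for x
  have h: "smooth_on UNIV ?h" by (simp add: smooth_on_def Ck_on_flat_exp)
  have pos: "?h x \<ge> 0" "x > 0 \<Longrightarrow> ?h x > 0" for x by (auto simp: flat_exp_def)
  have "?h x + ?h (1 + (- 1) * x) > 0" for x
    using pos(1)[of x] pos(1)[of "1 + (-1) * x"] pos(2)[of x] pos(2)[of "1 + (- 1) * x"]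
    by (cases "x > 0") (auto simp: add_pos_nonneg add_nonneg_pos)
  then have nz: "?h x + ?h (1 + (- 1) * x) \<noteq> 0" for x by (metis less_irrefl)
  have "smooth_on UNIV (\<lambda>x. ?h (1 + (- 1) * x))"
    by (rule smooth_on_compose[OF open_UNIV open_UNIV subset_UNIV _ h])
      (intro smooth_on_add smooth_on_const smooth_on_mult smooth_on_ident open_UNIV)
  then have "smooth_on UNIV \<theta>"
    unfolding \<theta>_def[abs_def]
    by (intro smooth_on_mult smooth_on_inverse smooth_on_add h nz open_UNIV)
  moreover have "\<theta> x = 0" if "x \<le> 0" for x using that by (simp add: \<theta>_def flat_exp_def)
  moreover have "\<theta> x = 1" if "x \<ge> 1" for x using that by (simp add: \<theta>_def flat_exp_def)
  ultimately show ?thesis by blast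
qed

lemma bump_exists:
  fixes p :: "'a::real_inner"
  assumes "r > 0"
  shows "\<exists>\<rho> :: 'a \<Rightarrow> real. smooth_on UNIV \<rho> \<and> (\<forall>y\<in>ball p (r / 2). \<rho> y = 1) \<and>
    (\<forall>y. y \<notin> ball p r \<longrightarrow> \<rho> y = 0)"
proof -
  obtain \<theta> :: "real \<Rightarrow> real" where \<theta>: "smooth_on UNIV \<theta>" "\<And>x. x \<le> 0 \<Longrightarrow> \<theta> x = 0" "\<And>x. x \<ge> 1 \<Longrightarrow> \<theta> x = 1"
    using smooth_step_exists by blast
  \<comment> \<open>The squared distance is used because it is smooth at \<open>p\<close> too. The
    constants make \<open>s\<close> equal to 1 at distance \<open>r / 2\<close> and 0 at distance
    \<open>r\<close>, the two thresholds of \<open>\<theta>\<close>.\<close>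
  define s where "s y = 4 / 3 + (- 4 / (3 * r\<^sup>2)) * ((y + - p) \<bullet> (y + - p))" for y
  have "smooth_on UNIV s"
    unfolding s_def[abs_def]
    by (intro smooth_on_add smooth_on_mult smooth_on_inner smooth_on_const smooth_on_ident open_UNIV)
  then have "smooth_on UNIV (\<lambda>y. \<theta> (s y))"
    by (intro smooth_on_compose[OF _ _ _ _ \<theta>(1)]) auto
  moreover have s: "s y = 4 / 3 * (1 - (dist p y / r)\<^sup>2)" for y
    using assms by (simp add: s_def dist_norm norm_minus_commute[of p] power2_norm_eq_inner[symmetric]
        field_simps)
  have "s y \<ge> 1" if "y \<in> ball p (r / 2)" for y
  proof -
    have "dist p y / r \<le> 1 / 2" using that assms by (simp add: field_simps)
    then have "(dist p y / r)\<^sup>2 \<le> (1 / 2)\<^sup>2" using assms by (intro power_mono) auto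
    moreover have "(1 / 2 :: real)\<^sup>2 = 1 / 4" by (simp add: power2_eq_square)
    ultimately have "(dist p y / r)\<^sup>2 \<le> 1 / 4" by simp
    then show ?thesis unfolding s by simp
  qed
  moreover have "s y \<le> 0" if "y \<notin> ball p r" for y
  proof -
    have "dist p y / r \<ge> 1" using that assms by (simp add: field_simps)
    then have "(dist p y / r)\<^sup>2 \<ge> 1" by simp
    then show ?thesis by (simp add: s)
  qed
  ultimately show ?thesis using \<theta> by (intro exI[of _ "\<lambda>y. \<theta> (s y)"]) auto
qed

section \<open>Hadamard's lemma\<close>

lemma segment_mem:
  fixes S :: "'a::real_vector set"
  assumes "convex S" "p \<in> S" "x \<in> S" "0 \<le> t" "t \<le> 1"
  shows "p + t *\<^sub>R (x - p) \<in> S"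
proof -
  have "p + t *\<^sub>R (x - p) = (1 - t) *\<^sub>R p + t *\<^sub>R x" by (simp add: algebra_simps)
  then show ?thesis using convexD_alt[OF assms(1-3)] assms(4,5) by simp
qed

lemma continuous_on_segment_integrand:
  fixes H :: "'a::real_normed_vector \<Rightarrow> real"
  assumes "convex S" "p \<in> S" "continuous_on S H"
  shows "continuous_on (S \<times> {0..1}) (\<lambda>(x, t). t ^ n * H (p + t *\<^sub>R (x - p)))"
proof -
  have "continuous_on (S \<times> {0..1}) (\<lambda>z. H (p + snd z *\<^sub>R (fst z - p)))"
    by (rule continuous_on_compose2[OF assms(3)])
      (auto intro!: continuous_intros segment_mem assms)
  then show ?thesis by (auto simp: case_prod_unfold intro!: continuous_intros)
qed

text \<open>Differentiating under the integral sign replaces \<open>H\<close> by a partial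
  derivative and produces one more factor \<open>t\<close>. The induction therefore runs over all
  weights \<open>t ^ n\<close> and all smooth \<open>H\<close> at once.\<close>

lemma Ck_on_segment_integral:
  fixes H :: "'a::finite_dim_inner \<Rightarrow> real"
  assumes S: "open S" "convex S" "p \<in> S"
  shows "smooth_on S H \<Longrightarrow> Ck_on k S (\<lambda>x. integral (cbox 0 1) (\<lambda>t. t ^ n * H (p + t *\<^sub>R (x - p))))"
proof (induction k arbitrary: n H)
  case 0
  have "continuous_on S (\<lambda>x. integral (cbox 0 1) (\<lambda>t. t ^ n * H (p + t *\<^sub>R (x - p))))"
    by (rule integral_continuous_on_param)
      (use continuous_on_segment_integrand[OF S(2,3) smooth_on_continuous[OF 0]] in simp)
  then show ?case by simp
next
  case (Suc k)
  have H1: "Ck_on (Suc m) S H" for m using Suc.prems by (simp add: smooth_on_def del: Ck_on.simps)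
  let ?H' = "\<lambda>x. frechet_derivative H (at x)"
  have D: "(H has_derivative ?H' x) (at x)" if "x \<in> S" for x
    using Ck_on_SucD(1)[OF H1 that] .
  have sm: "smooth_on S (\<lambda>x. ?H' x v)" for v
    unfolding smooth_on_def using Ck_on_SucD(2)[OF H1] by blast
  \<comment> \<open>\<open>leibniz_rule\<close> wants the derivative as a continuous family of
    bounded linear maps. Assembling it from partial derivatives along \<open>ONB\<close> reduces its
    continuity to that of scalar functions.\<close>
  define fx :: "'a \<Rightarrow> real \<Rightarrow> 'a \<Rightarrow>\<^sub>L real" where
    "fx x t = (\<Sum>b\<in>ONB. (t ^ Suc n * ?H' (p + t *\<^sub>R (x - p)) b) *\<^sub>R blinfun_inner_left b)" for x t
  have fx: "blinfun_apply (fx x t) v = t ^ Suc n * ?H' (p + t *\<^sub>R (x - p)) v"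
    if "x \<in> S" "t \<in> cbox 0 1" for x t v
  proof -
    have "linear (?H' (p + t *\<^sub>R (x - p)))"
      using that by (intro has_derivative_linear[OF D] segment_mem S) auto
    from linear_ONB[OF this, of v] show ?thesis
      by (simp add: fx_def blinfun.sum_left blinfun.scaleR_left sum_distrib_left ac_simps)
  qed
  have cfx: "continuous_on (S \<times> cbox 0 1) (\<lambda>(x, t). fx x t)"
  proof -
    have c: "continuous_on (S \<times> cbox 0 1) (\<lambda>z. snd z ^ Suc n * ?H' (p + snd z *\<^sub>R (fst z - p)) b)" for b
      using continuous_on_segment_integrand[OF S(2,3) smooth_on_continuous[OF sm], of "Suc n" b]
      by (simp add: case_prod_unfold)
    show ?thesis
      unfolding fx_def case_prod_unfold
      by (intro continuous_on_sum continuous_on_scaleR continuous_on_const c)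
  qed
  have int: "(\<lambda>t. t ^ m * G (p + t *\<^sub>R (x - p))) integrable_on cbox 0 1"
    if "x \<in> S" "smooth_on S G" for x m and G :: "'a \<Rightarrow> real"
  proof (rule integrable_continuous)
    have "continuous_on (cbox 0 1) (\<lambda>t. (x, t))" by (intro continuous_intros)
    then have "continuous_on (cbox 0 1) (\<lambda>t. (\<lambda>(x, t). t ^ m * G (p + t *\<^sub>R (x - p))) (x, t))"
      by (rule continuous_on_compose2[OF
            continuous_on_segment_integrand[OF S(2,3) smooth_on_continuous[OF that(2)]]])
        (use that in auto)
    then show "continuous_on (cbox 0 1) (\<lambda>t. t ^ m * G (p + t *\<^sub>R (x - p)))" by simp
  qed
  have der: "((\<lambda>x. integral (cbox 0 1) (\<lambda>t. t ^ n * H (p + t *\<^sub>R (x - p)))) has_derivative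
      blinfun_apply (integral (cbox 0 1) (fx x0))) (at x0)" if x0: "x0 \<in> S" for x0
  proof -
    have "((\<lambda>x. integral (cbox 0 1) (\<lambda>t. t ^ n * H (p + t *\<^sub>R (x - p)))) has_derivative
      blinfun_apply (integral (cbox 0 1) (fx x0))) (at x0 within S)"
    proof (rule leibniz_rule[OF _ _ cfx x0 S(2)])
      fix x t assume xt: "x \<in> S" "t \<in> cbox (0 :: real) 1"
      have m: "p + t *\<^sub>R (x - p) \<in> S" using xt by (intro segment_mem S) auto
      have lin: "linear (?H' (p + t *\<^sub>R (x - p)))" by (rule has_derivative_linear[OF D[OF m]])
      have "((\<lambda>x. p + t *\<^sub>R (x - p)) has_derivative (\<lambda>v. t *\<^sub>R v)) (at x)"
        by (auto intro!: derivative_eq_intros)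
      from has_derivative_compose[OF this D[OF m]]
      have "((\<lambda>x. t ^ n * H (p + t *\<^sub>R (x - p))) has_derivative
          (\<lambda>v. t ^ n * ?H' (p + t *\<^sub>R (x - p)) (t *\<^sub>R v))) (at x)"
        by (rule has_derivative_mult_right)
      moreover have "(\<lambda>v. t ^ n * ?H' (p + t *\<^sub>R (x - p)) (t *\<^sub>R v)) = blinfun_apply (fx x t)"
        by (rule ext) (simp add: fx[OF xt] linear_cmul[OF lin])
      ultimately have "((\<lambda>x. t ^ n * H (p + t *\<^sub>R (x - p))) has_derivative blinfun_apply (fx x t)) (at x)"
        by (simp only:)
      then show "((\<lambda>x. t ^ n * H (p + t *\<^sub>R (x - p))) has_derivative blinfun_apply (fx x t)) (at x within S)"
        by (rule has_derivative_at_withinI)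
    qed (rule int[OF _ Suc.prems])
    then show ?thesis by (simp add: at_within_open[OF x0 S(1)])
  qed
  show ?case
  proof (rule Ck_on_SucI[OF S(1) der])
    fix v
    show "Ck_on k S (\<lambda>x. blinfun_apply (integral (cbox 0 1) (fx x)) v)"
    proof (rule Ck_on_cong[OF S(1) _ Suc.IH[OF sm[of v], of "Suc n"]])
      fix x assume x: "x \<in> S"
      have "continuous_on (cbox 0 1) (fx x)"
        using continuous_on_compose2[OF cfx continuous_on_Pair[OF continuous_on_const[of _ x] continuous_on_id],
            of "cbox 0 1"] x
        by (simp add: image_subset_iff)
      then have "fx x integrable_on cbox 0 1" by (rule integrable_continuous)
      from blinfun_apply_integral[OF this, of v]
      have "blinfun_apply (integral (cbox 0 1) (fx x)) v = integral (cbox 0 1) (\<lambda>t. blinfun_apply (fx x t) v)" .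
      also have "\<dots> = integral (cbox 0 1) (\<lambda>t. t ^ Suc n * ?H' (p + t *\<^sub>R (x - p)) v)"
        by (rule integral_cong) (rule fx[OF x])
      finally show "integral (cbox 0 1) (\<lambda>t. t ^ Suc n * ?H' (p + t *\<^sub>R (x - p)) v) =
        blinfun_apply (integral (cbox 0 1) (fx x)) v" ..
    qed
  qed
qed

text \<open>Integrate the derivative of \<open>F\<close> along the segment from \<open>p\<close> to
  \<open>x\<close> and expand the direction \<open>x - p\<close> along \<open>ONB\<close>;
  \<open>G b\<close> is the mean of the partial derivative along the segment. Convexity of
  \<open>S\<close> keeps the segment inside.\<close>

lemma hadamard:
  fixes F :: "'a::finite_dim_inner \<Rightarrow> real"
  assumes S: "open S" "convex S" "p \<in> S" and F: "smooth_on S F"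
  shows "\<exists>G. (\<forall>b. smooth_on S (G b)) \<and> (\<forall>x\<in>S. F x = F p + (\<Sum>b\<in>ONB. ((x - p) \<bullet> b) * G b x))"
proof -
  have F1: "Ck_on (Suc m) S F" for m using F by (simp add: smooth_on_def del: Ck_on.simps)
  let ?F' = "\<lambda>x. frechet_derivative F (at x)"
  have D: "(F has_derivative ?F' x) (at x)" if "x \<in> S" for x
    using Ck_on_SucD(1)[OF F1 that] .
  have sm: "smooth_on S (\<lambda>x. ?F' x v)" for v
    unfolding smooth_on_def using Ck_on_SucD(2)[OF F1] by blast
  \<comment> \<open>The factor \<open>t ^ 0\<close> only puts the integrand into the form of
    \<open>Ck_on_segment_integral\<close>.\<close>
  define G where "G b x = integral (cbox 0 1) (\<lambda>t. t ^ 0 * ?F' (p + t *\<^sub>R (x - p)) b)" for b x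
  have "smooth_on S (G b)" for b
    unfolding smooth_on_def G_def[abs_def]
    by (intro allI Ck_on_segment_integral[OF S sm])
  moreover have "F x = F p + (\<Sum>b\<in>ONB. ((x - p) \<bullet> b) * G b x)" if x: "x \<in> S" for x
  proof -
    let ?g = "\<lambda>t. p + t *\<^sub>R (x - p)"
    have m: "?g t \<in> S" if "t \<in> {0..1}" for t using that x by (intro segment_mem S) auto
    have "((\<lambda>t. ?F' (?g t) (x - p)) has_integral (F (?g 1) - F (?g 0))) {0..1}"
    proof (rule fundamental_theorem_of_calculus)
      fix t :: real assume t: "t \<in> {0..1}"
      have "(?g has_vector_derivative (x - p)) (at t within {0..1})"
        by (auto intro!: derivative_eq_intros simp: has_vector_derivative_def)
      from vector_derivative_diff_chain_within[OF this has_derivative_at_withinI[OF D[OF m[OF t]]]]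
      show "((\<lambda>t. F (?g t)) has_vector_derivative ?F' (?g t) (x - p)) (at t within {0..1})"
        by (simp add: o_def)
    qed simp
    then have 1: "integral {0..1} (\<lambda>t. ?F' (?g t) (x - p)) = F x - F p"
      by (simp add: integral_unique)
    have cont: "continuous_on {0..1} (\<lambda>t. ?F' (?g t) b)" for b
      by (rule continuous_on_compose2[OF smooth_on_continuous[OF sm]])
        (auto intro!: continuous_intros segment_mem S x)
    have "integral {0..1} (\<lambda>t. ?F' (?g t) (x - p)) =
        integral {0..1} (\<lambda>t. \<Sum>b\<in>ONB. ((x - p) \<bullet> b) * ?F' (?g t) b)"
    proof (rule integral_cong)
      fix t :: real assume t: "t \<in> {0..1}"
      show "?F' (?g t) (x - p) = (\<Sum>b\<in>ONB. ((x - p) \<bullet> b) * ?F' (?g t) b)"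
        using linear_ONB[OF has_derivative_linear[OF D[OF m[OF t]]], of "x - p"] by simp
    qed
    also have "\<dots> = (\<Sum>b\<in>ONB. integral {0..1} (\<lambda>t. ((x - p) \<bullet> b) * ?F' (?g t) b))"
      by (rule integral_sum) (auto intro!: integrable_continuous_interval continuous_intros cont)
    also have "\<dots> = (\<Sum>b\<in>ONB. ((x - p) \<bullet> b) * G b x)"
      by (simp add: G_def)
    finally show ?thesis using 1 by simp
  qed
  ultimately show ?thesis by blast
qed


section \<open>Atlases\<close>

lemma chart_inj_on: "smooth_atlas A \<Longrightarrow> (U, \<phi>) \<in> A \<Longrightarrow> inj_on \<phi> U"
  unfolding smooth_atlas_def by blast

lemma chart_inv: "smooth_atlas A \<Longrightarrow> (U, \<phi>) \<in> A \<Longrightarrow> x \<in> U \<Longrightarrow> inv_into U \<phi> (\<phi> x) = x"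
  by (rule inv_into_f_f[OF chart_inj_on])

lemma chart_image_open: "smooth_atlas A \<Longrightarrow> (U, \<phi>) \<in> A \<Longrightarrow> open (\<phi> ` U)"
  unfolding smooth_atlas_def by blast

lemma chart_overlap:
  assumes "smooth_atlas A" "(U, \<phi>) \<in> A" "(V, \<psi>) \<in> A"
  shows "open (\<phi> ` (U \<inter> V))" "smooth_on (\<phi> ` (U \<inter> V)) (\<lambda>y. \<psi> (inv_into U \<phi> y))"
  using assms unfolding smooth_atlas_def o_def by blast+

lemma chart_subset_points: "(U, \<phi>) \<in> A \<Longrightarrow> U \<subseteq> points A"
  unfolding points_def by blast

lemma points_chartE:
  assumes "x \<in> points A"
  obtains U \<phi> where "(U, \<phi>) \<in> A" "x \<in> U"
  using assms unfolding points_def by blast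

text \<open>\<open>topology\<close> returns the given predicate only once this is known to be a
  topology. Stability under intersection rests on the injectivity of the charts, which makes images
  commute with intersections.\<close>

lemma openin_atlas_topology:
  assumes A: "smooth_atlas A"
  shows "openin (atlas_topology A) W \<longleftrightarrow> W \<subseteq> points A \<and> (\<forall>(U, \<phi>)\<in>A. open (\<phi> ` (U \<inter> W)))"
proof -
  let ?P = "\<lambda>W. W \<subseteq> points A \<and> (\<forall>(U, \<phi>)\<in>A. open (\<phi> ` (U \<inter> W)))"
  have "istopology ?P"
    unfolding istopology_def
  proof (intro conjI allI impI)
    fix S T assume S: "?P S" and T: "?P T"
    have "open (\<phi> ` (U \<inter> (S \<inter> T)))" if c: "(U, \<phi>) \<in> A" for U \<phi>
    proof -
      have "\<phi> ` (U \<inter> (S \<inter> T)) = \<phi> ` ((U \<inter> S) \<inter> (U \<inter> T))" by (simp add: Int_ac)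
      also have "\<dots> = \<phi> ` (U \<inter> S) \<inter> \<phi> ` (U \<inter> T)"
        by (rule inj_on_image_Int[OF chart_inj_on[OF A c]]) auto
      finally show ?thesis using S T c by auto
    qed
    then show "S \<inter> T \<subseteq> points A" "\<forall>(U, \<phi>)\<in>A. open (\<phi> ` (U \<inter> (S \<inter> T)))"
      using S by auto
  next
    fix \<K> assume K: "\<forall>K\<in>\<K>. ?P K"
    have "open (\<phi> ` (U \<inter> \<Union>\<K>))" if c: "(U, \<phi>) \<in> A" for U \<phi>
    proof -
      have "\<phi> ` (U \<inter> \<Union>\<K>) = (\<Union>K\<in>\<K>. \<phi> ` (U \<inter> K))" by blast
      moreover have "open (\<phi> ` (U \<inter> K))" if "K \<in> \<K>" for K using K c that by fast
      ultimately show ?thesis by (simp add: open_UN)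
    qed
    then show "\<Union>\<K> \<subseteq> points A" "\<forall>(U, \<phi>)\<in>A. open (\<phi> ` (U \<inter> \<Union>\<K>))"
      using K by auto
  qed
  then show ?thesis by (simp add: atlas_topology_def)
qed

lemma openin_image_open:
  "smooth_atlas A \<Longrightarrow> openin (atlas_topology A) W \<Longrightarrow> (U, \<phi>) \<in> A \<Longrightarrow> open (\<phi> ` (U \<inter> W))"
  using openin_atlas_topology by blast

lemma openin_image_open':
  "smooth_atlas A \<Longrightarrow> openin (atlas_topology A) W \<Longrightarrow> (U, \<phi>) \<in> A \<Longrightarrow> W \<subseteq> U \<Longrightarrow> open (\<phi> ` W)"
  using openin_image_open by (metis Int_absorb1)

lemma topspace_atlas:
  assumes "smooth_atlas A"
  shows "topspace (atlas_topology A) = points A"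
proof -
  have "openin (atlas_topology A) (points A)"
    using chart_image_open[OF assms] chart_subset_points
    by (fastforce simp: openin_atlas_topology[OF assms] Int_absorb2)
  moreover have "topspace (atlas_topology A) \<subseteq> points A"
    using iffD1[OF openin_atlas_topology[OF assms] openin_topspace] by (rule conjunct1)
  ultimately show ?thesis using openin_subset by blast
qed

lemma openin_chart_preimage:
  assumes A: "smooth_atlas A" and c: "(U, \<phi>) \<in> A" and "open N"
  shows "openin (atlas_topology A) {x \<in> U. \<phi> x \<in> N}"
  unfolding openin_atlas_topology[OF A]
proof (intro conjI ballI)
  show "{x \<in> U. \<phi> x \<in> N} \<subseteq> points A" using chart_subset_points[OF c] by blast
next
  fix z assume "z \<in> A"
  then obtain V \<psi> where z: "z = (V, \<psi>)" "(V, \<psi>) \<in> A" by (cases z) auto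
  note ov = chart_overlap[OF A z(2) c]
  have i: "inv_into V \<psi> (\<psi> x) = x" if "x \<in> V" for x by (rule chart_inv[OF A z(2) that])
  have "open ((\<lambda>y. \<phi> (inv_into V \<psi> y)) -` N \<inter> \<psi> ` (V \<inter> U))"
    using continuous_open_preimage[OF smooth_on_continuous[OF ov(2)] ov(1) assms(3)]
    by (simp add: Int_commute)
  moreover have "(\<lambda>y. \<phi> (inv_into V \<psi> y)) -` N \<inter> \<psi> ` (V \<inter> U) = \<psi> ` (V \<inter> {x \<in> U. \<phi> x \<in> N})"
    using i by auto
  ultimately show "case z of (V, \<psi>) \<Rightarrow> open (\<psi> ` (V \<inter> {x \<in> U. \<phi> x \<in> N}))" by (simp add: z)
qed

lemma openin_chart: "smooth_atlas A \<Longrightarrow> (U, \<phi>) \<in> A \<Longrightarrow> openin (atlas_topology A) U"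
  using openin_chart_preimage[of A U \<phi> UNIV] by simp

lemma smooth_functionsD:
  "f \<in> smooth_functions A \<Longrightarrow> (U, \<phi>) \<in> A \<Longrightarrow> smooth_on (\<phi> ` U) (\<lambda>y. f (inv_into U \<phi> y))"
  unfolding smooth_functions_def o_def by blast

text \<open>Smoothness in one chart near each point is enough, because changing to any other chart
  composes with a smooth transition map. The local representative \<open>g\<close> may be chosen
  point by point.\<close>

lemma smooth_functions_localI:
  assumes A: "smooth_atlas A" and ext: "f \<in> extensional (points A)"
    and loc: "\<And>x. x \<in> points A \<Longrightarrow> \<exists>U \<phi> S g. (U, \<phi>) \<in> A \<and> openin (atlas_topology A) S \<and> S \<subseteq> U \<and>
      x \<in> S \<and> smooth_on (\<phi> ` S) g \<and> (\<forall>x'\<in>S. f x' = g (\<phi> x'))"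
  shows "f \<in> smooth_functions A"
proof -
  have "smooth_on (\<psi> ` V) (f \<circ> inv_into V \<psi>)" if V: "(V, \<psi>) \<in> A" for V \<psi>
  proof (rule smooth_on_local)
    fix z assume "z \<in> \<psi> ` V"
    then obtain x where x: "x \<in> V" "z = \<psi> x" by blast
    obtain U \<phi> S g where c: "(U, \<phi>) \<in> A" "openin (atlas_topology A) S" "S \<subseteq> U" "x \<in> S"
      "smooth_on (\<phi> ` S) g" "\<forall>x'\<in>S. f x' = g (\<phi> x')"
      using loc[of x] chart_subset_points[OF V] x by blast
    have i: "inv_into V \<psi> (\<psi> x) = x" if "x \<in> V" for x by (rule chart_inv[OF A V that])
    have o: "open (\<psi> ` (V \<inter> S))" by (rule openin_image_open[OF A c(2) V])
    have "smooth_on (\<psi> ` (V \<inter> S)) (\<lambda>z. g (\<phi> (inv_into V \<psi> z)))"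
    proof (rule smooth_on_compose[OF o openin_image_open'[OF A c(2,1,3)] _ _ c(5)])
      show "(\<lambda>z. \<phi> (inv_into V \<psi> z)) ` \<psi> ` (V \<inter> S) \<subseteq> \<phi> ` S" using i by auto
      show "smooth_on (\<psi> ` (V \<inter> S)) (\<lambda>z. \<phi> (inv_into V \<psi> z))"
        by (rule smooth_on_subset[OF chart_overlap(2)[OF A V c(1)]]) (use c(3) in auto)
    qed
    then have "smooth_on (\<psi> ` (V \<inter> S)) (f \<circ> inv_into V \<psi>)"
      by (rule smooth_on_cong[OF o]) (use i c(6) in auto)
    then show "\<exists>T. open T \<and> z \<in> T \<and> smooth_on T (f \<circ> inv_into V \<psi>)"
      using o x c(4) by blast
  qed
  then show ?thesis using ext unfolding smooth_functions_def by blast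
qed

text \<open>The support is compact, and closed because the manifold is Hausdorff.\<close>

lemma cutoff_exists:
  assumes M: "manifold A" and W: "openin (atlas_topology A) W" "x0 \<in> W"
  shows "\<exists>\<rho>\<in>smooth_functions A. \<exists>N K. openin (atlas_topology A) N \<and> x0 \<in> N \<and>
    closedin (atlas_topology A) K \<and> N \<subseteq> K \<and> K \<subseteq> W \<and> (\<forall>x\<in>N. \<rho> x = 1) \<and>
    (\<forall>x\<in>points A - K. \<rho> x = 0)"
proof -
  have A: "smooth_atlas A" and H: "Hausdorff_space (atlas_topology A)"
    using M by (auto simp: manifold_def)
  have "x0 \<in> points A" using W openin_subset topspace_atlas[OF A] by blast
  then obtain U \<phi> where c: "(U, \<phi>) \<in> A" "x0 \<in> U" by (rule points_chartE)
  note inj = chart_inj_on[OF A c(1)]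
  have i: "inv_into U \<phi> (\<phi> x) = x" if "x \<in> U" for x using inj that by simp
  have "open (\<phi> ` (U \<inter> W))" by (rule openin_image_open[OF A W(1) c(1)])
  moreover have "\<phi> x0 \<in> \<phi> ` (U \<inter> W)" using c W by blast
  \<comment> \<open>A closed ball, so that the set \<open>K\<close> below is compact; the open ball
    of half the radius becomes the set \<open>N\<close> on which the bump function is 1.\<close>
  ultimately obtain r where r: "r > 0" "cball (\<phi> x0) r \<subseteq> \<phi> ` (U \<inter> W)"
    using open_contains_cball by blast
  obtain \<rho>0 :: "_ \<Rightarrow> real" where \<rho>0: "smooth_on UNIV \<rho>0" "\<And>y. y \<in> ball (\<phi> x0) (r / 2) \<Longrightarrow> \<rho>0 y = 1"
    "\<And>y. y \<notin> ball (\<phi> x0) r \<Longrightarrow> \<rho>0 y = 0"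
    using bump_exists[OF r(1), of "\<phi> x0"] by blast
  define N where "N = {x \<in> U. \<phi> x \<in> ball (\<phi> x0) (r / 2)}"
  define K where "K = {x \<in> U. \<phi> x \<in> cball (\<phi> x0) r}"
  define \<rho> where "\<rho> = (\<lambda>x\<in>points A. if x \<in> K then \<rho>0 (\<phi> x) else 0)"
  have N: "openin (atlas_topology A) N" unfolding N_def by (rule openin_chart_preimage[OF A c(1)]) simp
  have KW: "K \<subseteq> W"
  proof
    fix x assume x: "x \<in> K"
    then have "\<phi> x \<in> \<phi> ` (U \<inter> W)" using r by (auto simp: K_def)
    then obtain x' where "x' \<in> U \<inter> W" "\<phi> x = \<phi> x'" by blast
    then show "x \<in> W" using x inj by (auto simp: K_def inj_on_def)
  qed
  have "K = inv_into U \<phi> ` cball (\<phi> x0) r"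
  proof (intro set_eqI iffI)
    fix x assume "x \<in> K"
    then show "x \<in> inv_into U \<phi> ` cball (\<phi> x0) r" by (intro image_eqI[of _ _ "\<phi> x"]) (auto simp: K_def i)
  next
    fix x assume "x \<in> inv_into U \<phi> ` cball (\<phi> x0) r"
    then obtain y where y: "y \<in> cball (\<phi> x0) r" "x = inv_into U \<phi> y" by blast
    then obtain x' where "x' \<in> U" "y = \<phi> x'" using r by blast
    then show "x \<in> K" using y i by (simp add: K_def)
  qed
  moreover have "compactin (atlas_topology A) (inv_into U \<phi> ` cball (\<phi> x0) r)"
  proof (rule image_compactin)
    show "compactin (top_of_set (\<phi> ` U)) (cball (\<phi> x0) r)"
      using r(2) by (auto simp: compactin_subtopology)
    show "continuous_map (top_of_set (\<phi> ` U)) (atlas_topology A) (inv_into U \<phi>)"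
      unfolding continuous_map
    proof (intro conjI image_subsetI allI impI)
      show "inv_into U \<phi> x \<in> topspace (atlas_topology A)" if "x \<in> topspace (top_of_set (\<phi> ` U))" for x
        using that chart_subset_points[OF c(1)] i by (auto simp: topspace_atlas[OF A])
      fix V assume V: "openin (atlas_topology A) V"
      have "{x \<in> topspace (top_of_set (\<phi> ` U)). inv_into U \<phi> x \<in> V} = \<phi> ` (U \<inter> V)"
        using i by auto
      then show "openin (top_of_set (\<phi> ` U)) {x \<in> topspace (top_of_set (\<phi> ` U)). inv_into U \<phi> x \<in> V}"
        using openin_image_open[OF A V c(1)] by (simp add: open_subset image_mono)
    qed
  qed
  ultimately have K: "closedin (atlas_topology A) K"
    using compactin_imp_closedin[OF H] by simp
  have "\<rho> \<in> smooth_functions A"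
  proof (rule smooth_functions_localI[OF A])
    show "\<rho> \<in> extensional (points A)" by (simp add: \<rho>_def)
    fix x assume x: "x \<in> points A"
    show "\<exists>U \<phi> S g. (U, \<phi>) \<in> A \<and> openin (atlas_topology A) S \<and> S \<subseteq> U \<and>
      x \<in> S \<and> smooth_on (\<phi> ` S) g \<and> (\<forall>x'\<in>S. \<rho> x' = g (\<phi> x'))"
    proof (cases "x \<in> K")
      case True
      then have "x \<in> U" by (simp add: K_def)
      moreover have "\<rho> x' = \<rho>0 (\<phi> x')" if "x' \<in> U" for x'
        using that chart_subset_points[OF c(1)] \<rho>0(3)[of "\<phi> x'"] by (auto simp: \<rho>_def K_def)
      moreover have "smooth_on (\<phi> ` U) \<rho>0" using smooth_on_subset[OF \<rho>0(1)] by blast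
      ultimately show ?thesis using c(1) openin_chart[OF A c(1)] by blast
    next
      case False
      obtain V \<psi> where V: "(V, \<psi>) \<in> A" "x \<in> V" using x by (rule points_chartE)
      have "openin (atlas_topology A) (V - K)"
        using openin_diff[OF openin_chart[OF A V(1)] K] .
      moreover have "\<rho> x' = 0" if "x' \<in> V - K" for x'
        using that chart_subset_points[OF V(1)] by (auto simp: \<rho>_def)
      moreover have "smooth_on (\<psi> ` (V - K)) (\<lambda>_. 0 :: real)" by (rule smooth_on_const)
      ultimately show ?thesis using V False
        by (intro exI[of _ V] exI[of _ \<psi>] exI[of _ "V - K"] exI[of _ "\<lambda>_. 0"]) auto
    qed
  qed
  moreover have "x0 \<in> N" using c r by (simp add: N_def)
  moreover have "N \<subseteq> K" using r(1) by (auto simp: N_def K_def)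
  moreover have "\<rho> x = 1" if "x \<in> N" for x
    using that \<open>N \<subseteq> K\<close> chart_subset_points[OF c(1)] \<rho>0(2) by (auto simp: \<rho>_def N_def)
  moreover have "\<rho> x = 0" if "x \<in> points A - K" for x using that by (simp add: \<rho>_def)
  ultimately show ?thesis using N K KW by blast
qed


section \<open>Vector bundles\<close>

text \<open>The inverse of the trivialisation on a single fibre. It serves for the constant local
  frames as well as for the charts of the total space.\<close>

definition lift :: "('m, 'b, 'e, 'f) vbundle \<Rightarrow> ('e \<Rightarrow> 'f) \<Rightarrow> 'm \<Rightarrow> 'f \<Rightarrow> 'e" where
  "lift B \<psi> x w = inv_into (fibre B x) \<psi> w"

text \<open>A vector bundle whose total space need not be known to be Hausdorff or second countable. This
  notion is stable under dualisation, which is much easier to see than for \<^const>\<open>vector_bundle\<close>.\<close>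

locale prebundle_algebra =
  fixes B :: "('m, 'b::finite_dim_inner, 'e, 'f::finite_dim_inner) vbundle"
  assumes manifold_base: "manifold (base B)"
    and proj_points: "g \<in> total B \<Longrightarrow> proj B g \<in> points (base B)"
    and vadd_fibre: "g \<in> fibre B x \<Longrightarrow> h \<in> fibre B x \<Longrightarrow> vadd B g h \<in> fibre B x"
    and vscale_fibre: "g \<in> fibre B x \<Longrightarrow> vscale B r g \<in> fibre B x"
    and trivs_cover: "x \<in> points (base B) \<Longrightarrow> \<exists>W \<psi>. (W, \<psi>) \<in> trivs B \<and> x \<in> W"
    and triv_open: "(W, \<psi>) \<in> trivs B \<Longrightarrow> openin (atlas_topology (base B)) W"
    and triv_bij: "(W, \<psi>) \<in> trivs B \<Longrightarrow> x \<in> W \<Longrightarrow> bij_betw \<psi> (fibre B x) UNIV"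
    and triv_add: "(W, \<psi>) \<in> trivs B \<Longrightarrow> x \<in> W \<Longrightarrow> g \<in> fibre B x \<Longrightarrow> h \<in> fibre B x \<Longrightarrow>
      \<psi> (vadd B g h) = \<psi> g + \<psi> h"
    and triv_scale: "(W, \<psi>) \<in> trivs B \<Longrightarrow> x \<in> W \<Longrightarrow> g \<in> fibre B x \<Longrightarrow>
      \<psi> (vscale B r g) = r *\<^sub>R \<psi> g"
begin

lemma smooth_base: "smooth_atlas (base B)"
  using manifold_base by (simp add: manifold_def)

lemma triv_points: "(W, \<psi>) \<in> trivs B \<Longrightarrow> x \<in> W \<Longrightarrow> x \<in> points (base B)"
  using triv_open openin_subset topspace_atlas[OF smooth_base] by blast

lemma fibreD: "g \<in> fibre B x \<Longrightarrow> g \<in> total B" "g \<in> fibre B x \<Longrightarrow> proj B g = x"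
  by (auto simp: fibre_def)

lemma fibreI: "g \<in> total B \<Longrightarrow> g \<in> fibre B (proj B g)"
  by (simp add: fibre_def)

lemma fibre_points: "g \<in> fibre B x \<Longrightarrow> x \<in> points (base B)"
  using proj_points fibreD by blast

lemma lift_fibre: "(W, \<psi>) \<in> trivs B \<Longrightarrow> x \<in> W \<Longrightarrow> lift B \<psi> x w \<in> fibre B x"
  unfolding lift_def using triv_bij[of W \<psi> x] by (metis bij_betw_def inv_into_into UNIV_I)

lemma triv_lift: "(W, \<psi>) \<in> trivs B \<Longrightarrow> x \<in> W \<Longrightarrow> \<psi> (lift B \<psi> x w) = w"
  unfolding lift_def using triv_bij[of W \<psi> x] by (metis bij_betw_def f_inv_into_f UNIV_I)

lemma lift_triv: "(W, \<psi>) \<in> trivs B \<Longrightarrow> x \<in> W \<Longrightarrow> g \<in> fibre B x \<Longrightarrow> lift B \<psi> x (\<psi> g) = g"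
  unfolding lift_def using triv_bij[of W \<psi> x] by (metis bij_betw_def inv_into_f_f)

lemma triv_inject:
  "(W, \<psi>) \<in> trivs B \<Longrightarrow> x \<in> W \<Longrightarrow> g \<in> fibre B x \<Longrightarrow> h \<in> fibre B x \<Longrightarrow> \<psi> g = \<psi> h \<Longrightarrow> g = h"
  by (metis lift_triv)

lemma lift_add: "(W, \<psi>) \<in> trivs B \<Longrightarrow> x \<in> W \<Longrightarrow>
    lift B \<psi> x (v + w) = vadd B (lift B \<psi> x v) (lift B \<psi> x w)"
  by (rule triv_inject[of W \<psi> x])
    (auto simp: triv_lift[of W \<psi> x] triv_add[of W \<psi> x] lift_fibre[of W \<psi> x] vadd_fibre)

lemma lift_scale: "(W, \<psi>) \<in> trivs B \<Longrightarrow> x \<in> W \<Longrightarrow>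
    lift B \<psi> x (r *\<^sub>R v) = vscale B r (lift B \<psi> x v)"
  by (rule triv_inject[of W \<psi> x])
    (auto simp: triv_lift[of W \<psi> x] triv_scale[of W \<psi> x] lift_fibre[of W \<psi> x] vscale_fibre)

lemma chart_triv_exists:
  assumes "x \<in> points (base B)"
  obtains U \<phi> W \<psi> where "(U, \<phi>) \<in> base B" "(W, \<psi>) \<in> trivs B" "x \<in> U" "x \<in> W"
  using trivs_cover[OF assms] points_chartE[OF assms] by metis

lemma openin_chart_triv:
  "(U, \<phi>) \<in> base B \<Longrightarrow> (W, \<psi>) \<in> trivs B \<Longrightarrow> openin (atlas_topology (base B)) (U \<inter> W)"
  by (intro openin_Int openin_chart[OF smooth_base] triv_open)

lemma total_atlas_mem:
  "(U, \<phi>) \<in> base B \<Longrightarrow> (W, \<psi>) \<in> trivs B \<Longrightarrow>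
    ({g \<in> total B. proj B g \<in> U \<inter> W}, \<lambda>g. (\<phi> (proj B g), \<psi> g)) \<in> total_atlas B"
  unfolding total_atlas_def by blast

lemma total_atlas_memE:
  assumes "c \<in> total_atlas B"
  obtains U \<phi> W \<psi> where "(U, \<phi>) \<in> base B" "(W, \<psi>) \<in> trivs B"
    "c = ({g \<in> total B. proj B g \<in> U \<inter> W}, \<lambda>g. (\<phi> (proj B g), \<psi> g))"
  using assms unfolding total_atlas_def by blast

lemma points_total: "points (total_atlas B) = total B"
proof
  show "points (total_atlas B) \<subseteq> total B"
    unfolding points_def by (auto elim!: total_atlas_memE)
  show "total B \<subseteq> points (total_atlas B)"
  proof
    fix g assume g: "g \<in> total B"
    obtain U \<phi> W \<psi> where "(U, \<phi>) \<in> base B" "(W, \<psi>) \<in> trivs B" "proj B g \<in> U" "proj B g \<in> W"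
      by (rule chart_triv_exists[OF proj_points[OF g]])
    then show "g \<in> points (total_atlas B)"
      using total_atlas_mem[THEN chart_subset_points] g by blast
  qed
qed

lemma total_chart_image:
  assumes "(W, \<psi>) \<in> trivs B" "S \<subseteq> W"
  shows "(\<lambda>g. (\<phi> (proj B g), \<psi> g)) ` {g \<in> total B. proj B g \<in> S} = \<phi> ` S \<times> UNIV"
proof (intro equalityI subsetI)
  fix z assume "z \<in> \<phi> ` S \<times> (UNIV :: 'f set)"
  then obtain x w where z: "z = (\<phi> x, w)" "x \<in> S" by auto
  then have x: "x \<in> W" using assms by blast
  show "z \<in> (\<lambda>g. (\<phi> (proj B g), \<psi> g)) ` {g \<in> total B. proj B g \<in> S}"
    using z fibreD[OF lift_fibre[OF assms(1) x, of w]] triv_lift[OF assms(1) x, of w]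
    by (intro image_eqI[of _ _ "lift B \<psi> x w"]) auto
qed auto

lemma total_chart_inj:
  assumes "(U, \<phi>) \<in> base B" "(W, \<psi>) \<in> trivs B"
  shows "inj_on (\<lambda>g. (\<phi> (proj B g), \<psi> g)) {g \<in> total B. proj B g \<in> U \<inter> W}"
proof (rule inj_onI)
  fix g h assume gh: "g \<in> {g \<in> total B. proj B g \<in> U \<inter> W}" "h \<in> {g \<in> total B. proj B g \<in> U \<inter> W}"
    "(\<phi> (proj B g), \<psi> g) = (\<phi> (proj B h), \<psi> h)"
  then have "proj B g = proj B h"
    using chart_inj_on[OF smooth_base assms(1)] by (auto simp: inj_on_def)
  then show "g = h" using gh fibreI[of g] fibreI[of h]
    by (intro triv_inject[OF assms(2), of "proj B g"]) auto
qed

lemma total_chart_inv: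
  assumes "(U, \<phi>) \<in> base B" "(W, \<psi>) \<in> trivs B" "y \<in> \<phi> ` (U \<inter> W)"
  shows "inv_into {g \<in> total B. proj B g \<in> U \<inter> W} (\<lambda>g. (\<phi> (proj B g), \<psi> g)) (y, w) =
    lift B \<psi> (inv_into U \<phi> y) w"
proof -
  obtain x where x: "x \<in> U" "x \<in> W" "y = \<phi> x" using assms by blast
  have i: "inv_into U \<phi> y = x" using chart_inj_on[OF smooth_base assms(1)] x by simp
  show ?thesis
    unfolding i using x fibreD[OF lift_fibre[OF assms(2) x(2), of w]] triv_lift[OF assms(2) x(2), of w]
    by (intro inv_into_f_eq[OF total_chart_inj[OF assms(1,2)]]) auto
qed

text \<open>A chart change of the total space has two components: a chart change of the base, which
  is smooth already, and the change of fibre coordinate. Only the latter has to be supplied.\<close>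

lemma smooth_totalI:
  assumes tr: "\<And>U \<phi> W \<psi> W' \<psi>'. (U, \<phi>) \<in> base B \<Longrightarrow> (W, \<psi>) \<in> trivs B \<Longrightarrow> (W', \<psi>') \<in> trivs B \<Longrightarrow>
    smooth_on (\<phi> ` (U \<inter> W \<inter> W') \<times> UNIV) (\<lambda>z. \<psi>' (lift B \<psi> (inv_into U \<phi> (fst z)) (snd z)))"
  shows "smooth_atlas (total_atlas B)"
proof -
  have 1: "inj_on \<theta> V \<and> open (\<theta> ` V)" if c: "(V, \<theta>) \<in> total_atlas B" for V \<theta>
  proof -
    obtain U \<phi> W \<psi> where *: "(U, \<phi>) \<in> base B" "(W, \<psi>) \<in> trivs B"
      "(V, \<theta>) = ({g \<in> total B. proj B g \<in> U \<inter> W}, \<lambda>g. (\<phi> (proj B g), \<psi> g))"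
      by (rule total_atlas_memE[OF c])
    have "open (\<phi> ` (U \<inter> W) \<times> (UNIV :: 'f set))"
      by (intro open_Times openin_image_open[OF smooth_base] triv_open[OF *(2)] *(1) open_UNIV)
    then show ?thesis using total_chart_inj[OF *(1,2)] total_chart_image[OF *(2), of "U \<inter> W" \<phi>] *(3) by simp
  qed
  have 2: "open (\<theta> ` (V \<inter> V')) \<and> smooth_on (\<theta> ` (V \<inter> V')) (\<theta>' \<circ> inv_into V \<theta>)"
    if c: "(V, \<theta>) \<in> total_atlas B" and c': "(V', \<theta>') \<in> total_atlas B" for V \<theta> V' \<theta>'
  proof -
    obtain U \<phi> W \<psi> where *: "(U, \<phi>) \<in> base B" "(W, \<psi>) \<in> trivs B"
      "(V, \<theta>) = ({g \<in> total B. proj B g \<in> U \<inter> W}, \<lambda>g. (\<phi> (proj B g), \<psi> g))"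
      by (rule total_atlas_memE[OF c])
    obtain U' \<phi>' W' \<psi>' where d: "(U', \<phi>') \<in> base B" "(W', \<psi>') \<in> trivs B"
      "(V', \<theta>') = ({g \<in> total B. proj B g \<in> U' \<inter> W'}, \<lambda>g. (\<phi>' (proj B g), \<psi>' g))"
      by (rule total_atlas_memE[OF c'])
    let ?S = "U \<inter> W \<inter> U' \<inter> W'"
    have "V \<inter> V' = {g \<in> total B. proj B g \<in> ?S}" using * d by auto
    then have im: "\<theta> ` (V \<inter> V') = \<phi> ` ?S \<times> UNIV"
      using total_chart_image[OF *(2), of ?S \<phi>] *(3) by auto
    have "openin (atlas_topology (base B)) ?S"
      using openin_Int[OF openin_chart_triv[OF *(1,2)] openin_chart_triv[OF d(1,2)]] by (simp add: Int_ac)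
    then have oS: "open (\<phi> ` ?S)" by (rule openin_image_open'[OF smooth_base _ *(1)]) auto
    then have o: "open (\<phi> ` ?S \<times> (UNIV :: 'f set))" by (intro open_Times open_UNIV)
    have "smooth_on (\<phi> ` ?S \<times> (UNIV :: 'f set)) (\<lambda>z. \<phi>' (inv_into U \<phi> (fst z)))"
      by (rule smooth_on_compose[OF o oS _ smooth_on_fst[OF o smooth_on_ident[OF o]]
            smooth_on_subset[OF chart_overlap(2)[OF smooth_base *(1) d(1)]]]) auto
    moreover have "smooth_on (\<phi> ` ?S \<times> UNIV) (\<lambda>z. \<psi>' (lift B \<psi> (inv_into U \<phi> (fst z)) (snd z)))"
      by (rule smooth_on_subset[OF tr[OF *(1,2) d(2)]]) auto
    ultimately have "smooth_on (\<phi> ` ?S \<times> UNIV)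
        (\<lambda>z. (\<phi>' (inv_into U \<phi> (fst z)), \<psi>' (lift B \<psi> (inv_into U \<phi> (fst z)) (snd z))))"
      by (rule smooth_on_Pair[OF o])
    then have "smooth_on (\<phi> ` ?S \<times> UNIV) (\<theta>' \<circ> inv_into V \<theta>)"
    proof (rule smooth_on_cong[OF o])
      fix z assume "z \<in> \<phi> ` ?S \<times> (UNIV :: 'f set)"
      then obtain x w where z: "z = (\<phi> x, w)" "x \<in> ?S" by auto
      have i: "inv_into U \<phi> (\<phi> x) = x" using chart_inj_on[OF smooth_base *(1)] z by simp
      have "inv_into V \<theta> z = lift B \<psi> x w"
        using total_chart_inv[OF *(1,2), of "\<phi> x" w] z * i by auto
      moreover have "proj B (lift B \<psi> x w) = x"
        using lift_fibre[OF *(2), of x w] z fibreD by auto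
      ultimately show "(\<phi>' (inv_into U \<phi> (fst z)), \<psi>' (lift B \<psi> (inv_into U \<phi> (fst z)) (snd z))) =
          (\<theta>' \<circ> inv_into V \<theta>) z"
        using d(3) i z by simp
    qed
    then show ?thesis using o im by simp
  qed
  show ?thesis
    unfolding smooth_atlas_def
    by (intro conjI ballI; clarify; intro conjI) (simp_all add: 1 2)
qed

end

text \<open>Kept apart from \<open>prebundle_algebra\<close> so that smoothness of the total atlas
  of the dual can itself be derived, from its algebraic structure and
  \<open>smooth_totalI\<close>.\<close>

locale prebundle = prebundle_algebra B
  for B :: "('m, 'b::finite_dim_inner, 'e, 'f::finite_dim_inner) vbundle" +
  assumes smooth_total: "smooth_atlas (total_atlas B)"
begin

text \<open>Converse of \<open>smooth_totalI\<close>: the second component of a chart change over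
  one common base chart.\<close>

lemma transition_smooth:
  assumes c: "(U, \<phi>) \<in> base B" "(W, \<psi>) \<in> trivs B" "(W', \<psi>') \<in> trivs B"
  shows "smooth_on (\<phi> ` (U \<inter> W \<inter> W') \<times> UNIV) (\<lambda>z. \<psi>' (lift B \<psi> (inv_into U \<phi> (fst z)) (snd z)))"
proof -
  let ?S = "U \<inter> W \<inter> W'"
  let ?V = "{g \<in> total B. proj B g \<in> U \<inter> W}" and ?V' = "{g \<in> total B. proj B g \<in> U \<inter> W'}"
  let ?\<theta> = "\<lambda>g. (\<phi> (proj B g), \<psi> g)" and ?\<theta>' = "\<lambda>g. (\<phi> (proj B g), \<psi>' g)"
  have eq: "?V \<inter> ?V' = {g \<in> total B. proj B g \<in> ?S}" by auto
  have im: "?\<theta> ` (?V \<inter> ?V') = \<phi> ` ?S \<times> UNIV"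
    unfolding eq by (rule total_chart_image[OF c(2)]) auto
  note ov = chart_overlap[OF smooth_total total_atlas_mem[OF c(1,2)] total_atlas_mem[OF c(1,3)],
      unfolded im]
  from smooth_on_snd[OF ov] show ?thesis
  proof (rule smooth_on_cong[OF ov(1)])
    fix z assume "z \<in> \<phi> ` ?S \<times> (UNIV :: 'f set)"
    then obtain x w where z: "z = (\<phi> x, w)" "x \<in> ?S" by auto
    then show "snd (\<phi> (proj B (inv_into ?V ?\<theta> z)), \<psi>' (inv_into ?V ?\<theta> z)) =
        \<psi>' (lift B \<psi> (inv_into U \<phi> (fst z)) (snd z))"
      using total_chart_inv[OF c(1,2), of "\<phi> x" w] by auto
  qed
qed

lemma openin_total:
  assumes S: "openin (atlas_topology (base B)) S"
  shows "openin (atlas_topology (total_atlas B)) {g \<in> total B. proj B g \<in> S}"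
  unfolding openin_atlas_topology[OF smooth_total] points_total
proof (intro conjI ballI)
  fix c assume "c \<in> total_atlas B"
  then obtain U \<phi> W \<psi> where *: "(U, \<phi>) \<in> base B" "(W, \<psi>) \<in> trivs B"
    "c = ({g \<in> total B. proj B g \<in> U \<inter> W}, \<lambda>g. (\<phi> (proj B g), \<psi> g))"
    by (rule total_atlas_memE)
  have "open (\<phi> ` (U \<inter> (W \<inter> S)) \<times> (UNIV :: 'f set))"
    by (intro open_Times openin_image_open[OF smooth_base] openin_Int triv_open[OF *(2)] *(1) S open_UNIV)
  moreover have "{g \<in> total B. proj B g \<in> U \<inter> W} \<inter> {g \<in> total B. proj B g \<in> S} =
      {g \<in> total B. proj B g \<in> U \<inter> (W \<inter> S)}" by auto
  moreover have "(\<lambda>g. (\<phi> (proj B g), \<psi> g)) ` {g \<in> total B. proj B g \<in> U \<inter> (W \<inter> S)} =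
      \<phi> ` (U \<inter> (W \<inter> S)) \<times> UNIV"
    by (rule total_chart_image[OF *(2)]) auto
  ultimately show "case c of (V, \<theta>) \<Rightarrow> open (\<theta> ` (V \<inter> {g \<in> total B. proj B g \<in> S}))"
    unfolding *(3) by simp
qed auto

lemma smooth_functions_totalI:
  assumes ext: "f \<in> extensional (total B)"
    and loc: "\<And>x. x \<in> points (base B) \<Longrightarrow> \<exists>U \<phi> W \<psi> S g. (U, \<phi>) \<in> base B \<and> (W, \<psi>) \<in> trivs B \<and>
      openin (atlas_topology (base B)) S \<and> S \<subseteq> U \<inter> W \<and> x \<in> S \<and> smooth_on (\<phi> ` S \<times> UNIV) g \<and>
      (\<forall>e\<in>total B. proj B e \<in> S \<longrightarrow> f e = g (\<phi> (proj B e), \<psi> e))"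
  shows "f \<in> smooth_functions (total_atlas B)"
proof (rule smooth_functions_localI[OF smooth_total])
  show "f \<in> extensional (points (total_atlas B))" using ext points_total by simp
  fix e assume "e \<in> points (total_atlas B)"
  then have e: "e \<in> total B" by (simp add: points_total)
  obtain U \<phi> W \<psi> S g where *: "(U, \<phi>) \<in> base B" "(W, \<psi>) \<in> trivs B"
    "openin (atlas_topology (base B)) S" "S \<subseteq> U \<inter> W" "proj B e \<in> S" "smooth_on (\<phi> ` S \<times> UNIV) g"
    "\<And>e. e \<in> total B \<Longrightarrow> proj B e \<in> S \<Longrightarrow> f e = g (\<phi> (proj B e), \<psi> e)"
    using loc[OF proj_points[OF e]] by blast
  show "\<exists>U \<phi> S g. (U, \<phi>) \<in> total_atlas B \<and> openin (atlas_topology (total_atlas B)) S \<and> S \<subseteq> U \<and>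
      e \<in> S \<and> smooth_on (\<phi> ` S) g \<and> (\<forall>x'\<in>S. f x' = g (\<phi> x'))"
  proof (intro exI conjI)
    show "({g \<in> total B. proj B g \<in> U \<inter> W}, \<lambda>g. (\<phi> (proj B g), \<psi> g)) \<in> total_atlas B"
      by (rule total_atlas_mem[OF *(1,2)])
    show "openin (atlas_topology (total_atlas B)) {g \<in> total B. proj B g \<in> S}"
      by (rule openin_total[OF *(3)])
    have "(\<lambda>g. (\<phi> (proj B g), \<psi> g)) ` {g \<in> total B. proj B g \<in> S} = \<phi> ` S \<times> UNIV"
      by (rule total_chart_image[OF *(2)]) (use *(4) in auto)
    then show "smooth_on ((\<lambda>g. (\<phi> (proj B g), \<psi> g)) ` {g \<in> total B. proj B g \<in> S}) g"
      using *(6) by simp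
  qed (use * e in auto)
qed

lemma sections_in_fibre: "s \<in> sections B \<Longrightarrow> x \<in> points (base B) \<Longrightarrow> s x \<in> fibre B x"
  unfolding sections_def smooth_map_def fibre_def using points_total by auto

lemma sections_smooth:
  assumes s: "s \<in> sections B" and c: "(U, \<phi>) \<in> base B" "(W, \<psi>) \<in> trivs B"
  shows "smooth_on (\<phi> ` (U \<inter> W)) (\<lambda>y. \<psi> (s (inv_into U \<phi> y)))"
proof -
  have "{x \<in> U. s x \<in> {g \<in> total B. proj B g \<in> U \<inter> W}} = U \<inter> W"
    using fibreD[OF sections_in_fibre[OF s]] chart_subset_points[OF c(1)] by auto
  then have "smooth_on (\<phi> ` (U \<inter> W)) ((\<lambda>g. (\<phi> (proj B g), \<psi> g)) \<circ> s \<circ> inv_into U \<phi>)"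
    using s c(1) total_atlas_mem[OF c] unfolding sections_def smooth_map_def by fastforce
  from smooth_on_snd[OF openin_image_open[OF smooth_base triv_open[OF c(2)] c(1)] this]
  show ?thesis by (simp add: o_def)
qed

text \<open>One trivialisation near each point suffices, by smoothness of the transition functions.
  As in \<open>smooth_functions_localI\<close>, the witness may depend on the point.\<close>

lemma sectionsI:
  assumes ext: "s \<in> extensional (points (base B))"
    and fib: "\<And>x. x \<in> points (base B) \<Longrightarrow> s x \<in> fibre B x"
    and loc: "\<And>x. x \<in> points (base B) \<Longrightarrow> \<exists>U \<phi> W \<psi> S g. (U, \<phi>) \<in> base B \<and> (W, \<psi>) \<in> trivs B \<and>
      openin (atlas_topology (base B)) S \<and> S \<subseteq> U \<inter> W \<and> x \<in> S \<and> smooth_on (\<phi> ` S) g \<and>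
      (\<forall>x'\<in>S. \<psi> (s x') = g (\<phi> x'))"
  shows "s \<in> sections B"
proof -
  have sm: "open (\<phi>1 ` {x \<in> U1. s x \<in> V}) \<and>
      smooth_on (\<phi>1 ` {x \<in> U1. s x \<in> V}) (\<theta> \<circ> s \<circ> inv_into U1 \<phi>1)"
    if c1: "(U1, \<phi>1) \<in> base B" and V: "(V, \<theta>) \<in> total_atlas B" for U1 \<phi>1 V \<theta>
  proof -
    obtain U2 \<phi>2 W2 \<psi>2 where c2: "(U2, \<phi>2) \<in> base B" "(W2, \<psi>2) \<in> trivs B"
      "(V, \<theta>) = ({g \<in> total B. proj B g \<in> U2 \<inter> W2}, \<lambda>g. (\<phi>2 (proj B g), \<psi>2 g))"
      by (rule total_atlas_memE[OF V])
    have "s x \<in> total B" "proj B (s x) = x" if "x \<in> U1" for x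
      using fibreD[OF fib[of x]] chart_subset_points[OF c1] that by auto
    then have V_eq: "{x \<in> U1. s x \<in> V} = U1 \<inter> (U2 \<inter> W2)"
      using c2(3) by auto
    have i1: "inv_into U1 \<phi>1 (\<phi>1 x) = x" if "x \<in> U1" for x by (rule chart_inv[OF smooth_base c1 that])
    have o: "open (\<phi>1 ` (U1 \<inter> (U2 \<inter> W2)))"
      by (rule openin_image_open[OF smooth_base openin_chart_triv[OF c2(1,2)] c1])
    have "smooth_on (\<phi>1 ` (U1 \<inter> (U2 \<inter> W2))) (\<theta> \<circ> s \<circ> inv_into U1 \<phi>1)"
    proof (rule smooth_on_local)
      fix z assume "z \<in> \<phi>1 ` (U1 \<inter> (U2 \<inter> W2))"
      then obtain x where x: "z = \<phi>1 x" "x \<in> U1" "x \<in> U2" "x \<in> W2" by blast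
      then have "x \<in> points (base B)" using chart_subset_points[OF c1] by blast
      obtain U \<phi> W \<psi> S g where *: "(U, \<phi>) \<in> base B" "(W, \<psi>) \<in> trivs B"
        "openin (atlas_topology (base B)) S" "S \<subseteq> U \<inter> W" "x \<in> S" "smooth_on (\<phi> ` S) g"
        "\<And>x'. x' \<in> S \<Longrightarrow> \<psi> (s x') = g (\<phi> x')"
        using loc[OF \<open>x \<in> points (base B)\<close>] by blast
      let ?S = "S \<inter> U2 \<inter> W2"
      have oS: "openin (atlas_topology (base B)) ?S"
        using openin_Int[OF *(3) openin_chart_triv[OF c2(1,2)]] by (simp add: Int_ac)
      have o1: "open (\<phi>1 ` (U1 \<inter> ?S))" by (rule openin_image_open[OF smooth_base oS c1])
      have o2: "open (\<phi> ` ?S)" by (rule openin_image_open'[OF smooth_base oS *(1)]) (use * in auto)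
      have o3: "open (\<phi> ` ?S \<times> (UNIV :: 'f set))" using o2 by (intro open_Times open_UNIV)
      have i: "inv_into U \<phi> (\<phi> x) = x" if "x \<in> U" for x by (rule chart_inv[OF smooth_base *(1) that])
      \<comment> \<open>In the trivialisation \<open>\<psi>2\<close> the section is represented by
        the graph map of \<open>g\<close> followed by the transition function; precomposing with a
        change of base chart then gives the representative in \<open>\<phi>1\<close>.\<close>
      have p: "smooth_on (\<phi> ` ?S) (\<lambda>y. (y, g y))"
        by (rule smooth_on_Pair[OF o2 smooth_on_ident[OF o2] smooth_on_subset[OF *(6)]]) auto
      have t: "smooth_on (\<phi> ` ?S \<times> UNIV) (\<lambda>z. \<psi>2 (lift B \<psi> (inv_into U \<phi> (fst z)) (snd z)))"
        by (rule smooth_on_subset[OF transition_smooth[OF *(1,2) c2(2)]]) (use *(4) in auto)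
      have pt: "(\<lambda>y. (y, g y)) ` (\<phi> ` ?S) \<subseteq> \<phi> ` ?S \<times> UNIV" by blast
      have g2: "smooth_on (\<phi> ` ?S) (\<lambda>y. \<psi>2 (lift B \<psi> (inv_into U \<phi> y) (g y)))"
        using smooth_on_compose[OF o2 o3 pt p t] by (simp only: fst_conv snd_conv)
      have h: "smooth_on (\<phi>1 ` (U1 \<inter> ?S)) (\<lambda>z. \<phi> (inv_into U1 \<phi>1 z))"
        by (rule smooth_on_subset[OF chart_overlap(2)[OF smooth_base c1 *(1)]]) (use *(4) in auto)
      have ht: "(\<lambda>z. \<phi> (inv_into U1 \<phi>1 z)) ` (\<phi>1 ` (U1 \<inter> ?S)) \<subseteq> \<phi> ` ?S" using i1 by auto
      have "smooth_on (\<phi>1 ` (U1 \<inter> ?S))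
          (\<lambda>z. \<psi>2 (lift B \<psi> (inv_into U \<phi> (\<phi> (inv_into U1 \<phi>1 z))) (g (\<phi> (inv_into U1 \<phi>1 z)))))"
        by (rule smooth_on_compose[OF o1 o2 ht h g2])
      moreover have "smooth_on (\<phi>1 ` (U1 \<inter> ?S)) (\<lambda>z. \<phi>2 (inv_into U1 \<phi>1 z))"
        by (rule smooth_on_subset[OF chart_overlap(2)[OF smooth_base c1 c2(1)]]) auto
      ultimately have "smooth_on (\<phi>1 ` (U1 \<inter> ?S)) (\<lambda>z. (\<phi>2 (inv_into U1 \<phi>1 z),
          \<psi>2 (lift B \<psi> (inv_into U \<phi> (\<phi> (inv_into U1 \<phi>1 z))) (g (\<phi> (inv_into U1 \<phi>1 z))))))"
        by (intro smooth_on_Pair[OF o1])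
      then have "smooth_on (\<phi>1 ` (U1 \<inter> ?S)) (\<theta> \<circ> s \<circ> inv_into U1 \<phi>1)"
      proof (rule smooth_on_cong[OF o1])
        fix z assume "z \<in> \<phi>1 ` (U1 \<inter> ?S)"
        then obtain x where x: "z = \<phi>1 x" "x \<in> U1" "x \<in> ?S" by blast
        then have f: "s x \<in> fibre B x" using chart_subset_points[OF c1] fib by blast
        have xx: "x \<in> U" "x \<in> W" using x * by auto
        have "lift B \<psi> x (g (\<phi> x)) = s x"
          using *(7)[of x] x lift_triv[OF *(2) xx(2) f] by simp
        then show "(\<phi>2 (inv_into U1 \<phi>1 z),
          \<psi>2 (lift B \<psi> (inv_into U \<phi> (\<phi> (inv_into U1 \<phi>1 z))) (g (\<phi> (inv_into U1 \<phi>1 z))))) =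
          (\<theta> \<circ> s \<circ> inv_into U1 \<phi>1) z"
          using x i1 i xx fibreD(2)[OF f] c2(3) by simp
      qed
      then show "\<exists>T. open T \<and> z \<in> T \<and> smooth_on T (\<theta> \<circ> s \<circ> inv_into U1 \<phi>1)"
        using o1 x *(5) by (intro exI[of _ "\<phi>1 ` (U1 \<inter> ?S)"]) auto
    qed
    then show ?thesis using o V_eq by simp
  qed
  have "smooth_map (base B) (total_atlas B) s"
    unfolding smooth_map_def points_total
  proof (intro conjI ballI; clarify)
    show "s x \<in> total B" if "x \<in> points (base B)" for x using fibreD(1)[OF fib[OF that]] .
  qed (simp_all add: sm)
  then show ?thesis
    unfolding sections_def using ext fibreD(2)[OF fib] by simp
qed

end

lemma prebundle_if_vector_bundle:
  assumes "vector_bundle E"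
  shows "prebundle E"
proof -
  note E = assms[unfolded vector_bundle_def]
  have pr: "proj E ` total E \<subseteq> points (base E)" using E by (elim conjE)
  have ops: "\<forall>x\<in>points (base E). \<forall>g\<in>fibre E x.
        (\<forall>h\<in>fibre E x. vadd E g h \<in> fibre E x) \<and> (\<forall>r. vscale E r g \<in> fibre E x)"
    using E by (elim conjE)
  have cov: "(\<Union>(W, \<psi>)\<in>trivs E. W) = points (base E)" using E by (elim conjE)
  have p: "x \<in> points (base E)" if "g \<in> fibre E x" for g x
    using that pr by (auto simp: fibre_def)
  show ?thesis
  proof
    show "manifold (base E)" using E by (elim conjE)
    show "smooth_atlas (total_atlas E)" using E unfolding manifold_def by (elim conjE)
    show "proj E g \<in> points (base E)" if "g \<in> total E" for g using pr that by blast
    show "vadd E g h \<in> fibre E x" if "g \<in> fibre E x" "h \<in> fibre E x" for g h x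
      using ops that p[OF that(1)] by blast
    show "vscale E r g \<in> fibre E x" if "g \<in> fibre E x" for g r x
      using ops that p[OF that(1)] by blast
    show "\<exists>W \<psi>. (W, \<psi>) \<in> trivs E \<and> x \<in> W" if "x \<in> points (base E)" for x
      using that unfolding cov[symmetric] by blast
    fix W \<psi> assume W: "(W, \<psi>) \<in> trivs E"
    have "\<forall>(W, \<psi>)\<in>trivs E. openin (atlas_topology (base E)) W \<and>
        (\<forall>x\<in>W. bij_betw \<psi> (fibre E x) UNIV \<and>
           (\<forall>g\<in>fibre E x. (\<forall>h\<in>fibre E x. \<psi> (vadd E g h) = \<psi> g + \<psi> h) \<and>
              (\<forall>r. \<psi> (vscale E r g) = r *\<^sub>R \<psi> g)))"
      using E by (elim conjE)
    with W have *: "openin (atlas_topology (base E)) W \<and>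
        (\<forall>x\<in>W. bij_betw \<psi> (fibre E x) UNIV \<and>
           (\<forall>g\<in>fibre E x. (\<forall>h\<in>fibre E x. \<psi> (vadd E g h) = \<psi> g + \<psi> h) \<and>
              (\<forall>r. \<psi> (vscale E r g) = r *\<^sub>R \<psi> g)))"
      by blast
    then show "openin (atlas_topology (base E)) W" by blast
    fix x assume "x \<in> W"
    with * show "bij_betw \<psi> (fibre E x) UNIV"
      "g \<in> fibre E x \<Longrightarrow> h \<in> fibre E x \<Longrightarrow> \<psi> (vadd E g h) = \<psi> g + \<psi> h"
      "g \<in> fibre E x \<Longrightarrow> \<psi> (vscale E r g) = r *\<^sub>R \<psi> g" for g h r
      by blast+
  qed
qed


section \<open>The dual bundle\<close>

lemma riesz_representation:
  fixes f :: "'a::finite_dim_inner \<Rightarrow> real"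
  assumes "linear f"
  shows "f v = (\<Sum>b\<in>ONB. f b *\<^sub>R b) \<bullet> v"
proof -
  have "f v = (\<Sum>b\<in>ONB. (v \<bullet> b) *\<^sub>R f b)" by (rule linear_ONB[OF assms])
  also have "\<dots> = (\<Sum>b\<in>ONB. f b *\<^sub>R b) \<bullet> v"
    unfolding inner_sum_left by (rule sum.cong) (auto simp: inner_commute mult.commute)
  finally show ?thesis .
qed

definition dual_triv :: "('m, 'b, 'e, 'f::finite_dim_inner) vbundle \<Rightarrow> ('e \<Rightarrow> 'f) \<Rightarrow> 'm \<times> ('e \<Rightarrow> real) \<Rightarrow> 'f" where
  "dual_triv B \<psi> = (\<lambda>(x, \<epsilon>). THE w. \<forall>g\<in>fibre B x. \<epsilon> g = w \<bullet> \<psi> g)"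

text \<open>An explicit inverse of \<open>dual_triv\<close> on the fibre over \<open>x\<close>;
  \<open>lift_dual\<close> shows that it is the \<open>lift\<close> of the dual bundle.\<close>

definition dual_lift :: "('m, 'b, 'e, 'f::finite_dim_inner) vbundle \<Rightarrow> ('e \<Rightarrow> 'f) \<Rightarrow> 'm \<Rightarrow> 'f \<Rightarrow> 'm \<times> ('e \<Rightarrow> real)" where
  "dual_lift B \<psi> x w = (x, \<lambda>g\<in>fibre B x. w \<bullet> \<psi> g)"

lemma base_dual [simp]: "base (dual_bundle B) = base B"
  and proj_dual [simp]: "proj (dual_bundle B) = fst"
  by (simp_all add: dual_bundle_def)

lemma trivs_dual: "trivs (dual_bundle B) = {(W, dual_triv B \<psi>) | W \<psi>. (W, \<psi>) \<in> trivs B}"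
  by (simp add: dual_bundle_def dual_triv_def)

lemma trivs_dualI: "(W, \<psi>) \<in> trivs B \<Longrightarrow> (W, dual_triv B \<psi>) \<in> trivs (dual_bundle B)"
  by (auto simp: trivs_dual)

lemma total_dual: "total (dual_bundle B) = {(x, \<epsilon>). x \<in> points (base B) \<and>
    \<epsilon> \<in> extensional (fibre B x) \<and> (\<forall>g\<in>fibre B x.
      (\<forall>h\<in>fibre B x. \<epsilon> (vadd B g h) = \<epsilon> g + \<epsilon> h) \<and> (\<forall>r. \<epsilon> (vscale B r g) = r * \<epsilon> g))}"
  by (simp add: dual_bundle_def)

lemma fibre_dual:
  "e \<in> fibre (dual_bundle B) x \<longleftrightarrow> x \<in> points (base B) \<and> fst e = x \<and> snd e \<in> extensional (fibre B x) \<and>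
    (\<forall>g\<in>fibre B x. (\<forall>h\<in>fibre B x. snd e (vadd B g h) = snd e g + snd e h) \<and>
      (\<forall>r. snd e (vscale B r g) = r * snd e g))"
  by (cases e) (auto simp: fibre_def[of "dual_bundle B"] total_dual)

lemma fibre_dualD:
  assumes "e \<in> fibre (dual_bundle B) x"
  shows "fst e = x" "snd e \<in> extensional (fibre B x)"
    and "g \<in> fibre B x \<Longrightarrow> h \<in> fibre B x \<Longrightarrow> snd e (vadd B g h) = snd e g + snd e h"
    and "g \<in> fibre B x \<Longrightarrow> snd e (vscale B r g) = r * snd e g"
  using assms unfolding fibre_dual by auto

lemma vadd_dual:
  assumes "e \<in> fibre (dual_bundle B) x"
  shows "vadd (dual_bundle B) e e' = (x, \<lambda>g\<in>fibre B x. snd e g + snd e' g)"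
proof -
  have "vadd (dual_bundle B) e e' = (fst e, \<lambda>g\<in>fibre B (fst e). snd e g + snd e' g)"
    by (simp add: dual_bundle_def case_prod_beta)
  then show ?thesis by (simp add: fibre_dualD(1)[OF assms])
qed

lemma vscale_dual:
  assumes "e \<in> fibre (dual_bundle B) x"
  shows "vscale (dual_bundle B) r e = (x, \<lambda>g\<in>fibre B x. r * snd e g)"
proof -
  have "vscale (dual_bundle B) r e = (fst e, \<lambda>g\<in>fibre B (fst e). r * snd e g)"
    by (simp add: dual_bundle_def case_prod_beta)
  then show ?thesis by (simp add: fibre_dualD(1)[OF assms])
qed

context prebundle_algebra
begin

text \<open>Because \<open>\<psi>\<close> maps the fibre onto the model fibre, a representing vector
  is determined by its inner products with all vectors. This gives meaning to the description
  operator in the dual trivialisation.\<close>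

lemma dual_triv_unique:
  assumes W: "(W, \<psi>) \<in> trivs B" "x \<in> W" and "fst e = x" "\<And>g. g \<in> fibre B x \<Longrightarrow> snd e g = w \<bullet> \<psi> g"
  shows "dual_triv B \<psi> e = w"
proof -
  have "w' = w" if "\<forall>g\<in>fibre B x. snd e g = w' \<bullet> \<psi> g" for w'
  proof -
    have "w' \<bullet> v = w \<bullet> v" for v
      using that[rule_format, OF lift_fibre[OF W, of v]] assms(4)[OF lift_fibre[OF W, of v]]
      by (simp add: triv_lift[OF W])
    then have "(w' - w) \<bullet> (w' - w) = 0" by (simp add: inner_diff_left)
    then show ?thesis by simp
  qed
  then have "(THE w. \<forall>g\<in>fibre B x. snd e g = w \<bullet> \<psi> g) = w"
    using assms(4) by (intro the_equality) auto
  then show ?thesis using assms(3) by (simp add: dual_triv_def case_prod_beta)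
qed

lemma dual_triv_eq:
  assumes W: "(W, \<psi>) \<in> trivs B" "x \<in> W" and e: "e \<in> fibre (dual_bundle B) x"
  shows "g \<in> fibre B x \<Longrightarrow> snd e g = dual_triv B \<psi> e \<bullet> \<psi> g"
    and "dual_triv B \<psi> e = (\<Sum>b\<in>ONB. snd e (lift B \<psi> x b) *\<^sub>R b)"
proof -
  have lin: "linear (\<lambda>w. snd e (lift B \<psi> x w))"
    by (rule linearI) (simp_all add: lift_add[OF W] lift_scale[OF W] fibre_dualD[OF e] lift_fibre[OF W])
  let ?w = "\<Sum>b\<in>ONB. snd e (lift B \<psi> x b) *\<^sub>R b"
  have *: "snd e g = ?w \<bullet> \<psi> g" if "g \<in> fibre B x" for g
    using riesz_representation[OF lin, of "\<psi> g"] by (simp add: lift_triv[OF W that])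
  show 2: "dual_triv B \<psi> e = ?w"
    by (rule dual_triv_unique[OF W fibre_dualD(1)[OF e] *])
  show "g \<in> fibre B x \<Longrightarrow> snd e g = dual_triv B \<psi> e \<bullet> \<psi> g"
    using * 2 by simp
qed

lemma dual_lift_fibre:
  assumes W: "(W, \<psi>) \<in> trivs B" "x \<in> W"
  shows "dual_lift B \<psi> x w \<in> fibre (dual_bundle B) x"
  unfolding fibre_dual dual_lift_def
  by (simp add: vadd_fibre vscale_fibre triv_points[OF W] triv_add[OF W] triv_scale[OF W] inner_add_right)

lemma dual_triv_dual_lift:
  assumes W: "(W, \<psi>) \<in> trivs B" "x \<in> W"
  shows "dual_triv B \<psi> (dual_lift B \<psi> x w) = w"
  by (rule dual_triv_unique[OF W]) (auto simp: dual_lift_def)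

lemma fibre_dual_eqI:
  assumes "e \<in> fibre (dual_bundle B) x" "e' \<in> fibre (dual_bundle B) x"
    and "\<And>g. g \<in> fibre B x \<Longrightarrow> snd e g = snd e' g"
  shows "e = e'"
  using fibre_dualD(1,2)[OF assms(1)] fibre_dualD(1,2)[OF assms(2)] assms(3)
  by (intro prod_eqI extensionalityI[of _ "fibre B x"]) auto

lemma prebundle_algebra_dual: "prebundle_algebra (dual_bundle B)"
proof
  show "manifold (base (dual_bundle B))" using manifold_base by simp
  show "proj (dual_bundle B) g \<in> points (base (dual_bundle B))" if "g \<in> total (dual_bundle B)" for g
    using that by (auto simp: total_dual)
  show "vadd (dual_bundle B) g h \<in> fibre (dual_bundle B) x"
    if "g \<in> fibre (dual_bundle B) x" "h \<in> fibre (dual_bundle B) x" for g h x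
    using that unfolding vadd_dual[OF that(1)] fibre_dual
    by (auto simp: vadd_fibre vscale_fibre algebra_simps)
  show "vscale (dual_bundle B) r g \<in> fibre (dual_bundle B) x"
    if "g \<in> fibre (dual_bundle B) x" for g r x
    using that unfolding vscale_dual[OF that] fibre_dual
    by (auto simp: vadd_fibre vscale_fibre algebra_simps)
  show "\<exists>W \<psi>. (W, \<psi>) \<in> trivs (dual_bundle B) \<and> x \<in> W" if "x \<in> points (base (dual_bundle B))" for x
    using trivs_cover[of x] that trivs_dualI by (metis base_dual)
  fix W \<theta> assume "(W, \<theta>) \<in> trivs (dual_bundle B)"
  then obtain \<psi> where W: "(W, \<psi>) \<in> trivs B" and \<theta>: "\<theta> = dual_triv B \<psi>" by (auto simp: trivs_dual)
  show "openin (atlas_topology (base (dual_bundle B))) W" using triv_open[OF W] by simp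
  fix x assume x: "x \<in> W"
  show "bij_betw \<theta> (fibre (dual_bundle B) x) UNIV"
  proof (rule bij_betw_byWitness[where f' = "dual_lift B \<psi> x"])
    show "\<forall>e\<in>fibre (dual_bundle B) x. dual_lift B \<psi> x (\<theta> e) = e"
    proof
      fix e assume e: "e \<in> fibre (dual_bundle B) x"
      show "dual_lift B \<psi> x (\<theta> e) = e"
        by (rule fibre_dual_eqI[OF dual_lift_fibre[OF W x] e])
          (simp add: dual_lift_def \<theta> dual_triv_eq(1)[OF W x e])
    qed
    show "\<forall>w\<in>UNIV. \<theta> (dual_lift B \<psi> x w) = w" using dual_triv_dual_lift[OF W x] \<theta> by simp
    show "dual_lift B \<psi> x ` UNIV \<subseteq> fibre (dual_bundle B) x" using dual_lift_fibre[OF W x] by blast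
  qed simp
  fix e assume e: "e \<in> fibre (dual_bundle B) x"
  show "\<theta> (vadd (dual_bundle B) e e') = \<theta> e + \<theta> e'" if e': "e' \<in> fibre (dual_bundle B) x" for e'
    unfolding \<theta> vadd_dual[OF e]
    by (rule dual_triv_unique[OF W x])
      (auto simp: inner_add_left dual_triv_eq(1)[OF W x e] dual_triv_eq(1)[OF W x e'])
  show "\<theta> (vscale (dual_bundle B) r e) = r *\<^sub>R \<theta> e" for r
    unfolding \<theta> vscale_dual[OF e]
    by (rule dual_triv_unique[OF W x]) (auto simp: dual_triv_eq(1)[OF W x e])
qed

lemma lift_dual:
  assumes W: "(W, \<psi>) \<in> trivs B" "x \<in> W"
  shows "lift (dual_bundle B) (dual_triv B \<psi>) x w = dual_lift B \<psi> x w"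
proof -
  interpret d: prebundle_algebra "dual_bundle B" by (rule prebundle_algebra_dual)
  show ?thesis
    by (rule d.triv_inject[OF trivs_dualI[OF W(1)] W(2) d.lift_fibre[OF trivs_dualI[OF W(1)] W(2)]
          dual_lift_fibre[OF W]])
      (simp add: d.triv_lift[OF trivs_dualI[OF W(1)] W(2)] dual_triv_dual_lift[OF W])
qed

end

context prebundle
begin

lemma prebundle_dual: "prebundle (dual_bundle B)"
proof -
  interpret d: prebundle_algebra "dual_bundle B" by (rule prebundle_algebra_dual)
  show ?thesis
  proof
    show "smooth_atlas (total_atlas (dual_bundle B))"
    proof (rule d.smooth_totalI)
      fix U \<phi> W \<theta> W' \<theta>'
      assume c: "(U, \<phi>) \<in> base (dual_bundle B)" and "(W, \<theta>) \<in> trivs (dual_bundle B)"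
        "(W', \<theta>') \<in> trivs (dual_bundle B)"
      then obtain \<psi> \<psi>' where W: "(W, \<psi>) \<in> trivs B" "\<theta> = dual_triv B \<psi>"
        and W': "(W', \<psi>') \<in> trivs B" "\<theta>' = dual_triv B \<psi>'" by (auto simp: trivs_dual)
      have c: "(U, \<phi>) \<in> base B" using c by simp
      let ?S = "U \<inter> W \<inter> W'"
      have oS: "open (\<phi> ` ?S)"
        using openin_image_open[OF smooth_base openin_Int[OF triv_open[OF W(1)] triv_open[OF W'(1)]] c]
        by (simp add: Int_assoc)
      have o: "open (\<phi> ` ?S \<times> (UNIV :: 'f set))" by (rule open_Times[OF oS open_UNIV])
      \<comment> \<open>The dual transition from \<open>\<psi>\<close> to \<open>\<psi>'\<close> is
        the transpose of the transition in the opposite direction, from \<open>\<psi>'\<close> to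
        \<open>\<psi>\<close>, written out in the orthonormal basis. The opposite transition is
        smooth by \<open>transition_smooth\<close>, so no matrix has to be inverted.\<close>
      let ?h = "\<lambda>z. \<Sum>b\<in>ONB. (snd z \<bullet> \<psi> (lift B \<psi>' (inv_into U \<phi> (fst z)) b)) *\<^sub>R b"
      have "smooth_on (\<phi> ` ?S \<times> (UNIV :: 'f set)) (\<lambda>z. \<psi> (lift B \<psi>' (inv_into U \<phi> (fst z)) b))" for b
      proof -
        have t: "smooth_on (\<phi> ` ?S \<times> UNIV) (\<lambda>z. \<psi> (lift B \<psi>' (inv_into U \<phi> (fst z)) (snd z)))"
          by (rule smooth_on_subset[OF transition_smooth[OF c W'(1) W(1)]]) auto
        have p: "smooth_on (\<phi> ` ?S \<times> (UNIV :: 'f set)) (\<lambda>z. (fst z, b))"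
          by (rule smooth_on_Pair[OF o smooth_on_fst[OF o smooth_on_ident[OF o]] smooth_on_const])
        have m: "(\<lambda>z. (fst z, b)) ` (\<phi> ` ?S \<times> (UNIV :: 'f set)) \<subseteq> \<phi> ` ?S \<times> UNIV" by auto
        show ?thesis using smooth_on_compose[OF o o m p t] by (simp only: fst_conv snd_conv)
      qed
      then have "smooth_on (\<phi> ` ?S \<times> UNIV) ?h"
        by (intro smooth_on_sum[OF o] smooth_on_scaleR[OF o] smooth_on_inner[OF o] smooth_on_const
            smooth_on_snd[OF o] smooth_on_ident[OF o])
      then show "smooth_on (\<phi> ` ?S \<times> UNIV)
          (\<lambda>z. \<theta>' (lift (dual_bundle B) \<theta> (inv_into U \<phi> (fst z)) (snd z)))"
      proof (rule smooth_on_cong[OF o])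
        fix z assume "z \<in> \<phi> ` ?S \<times> (UNIV :: 'f set)"
        then obtain x w where z: "z = (\<phi> x, w)" "x \<in> U" "x \<in> W" "x \<in> W'" by auto
        have i: "inv_into U \<phi> (\<phi> x) = x" using chart_inj_on[OF smooth_base c] z by simp
        show "?h z = \<theta>' (lift (dual_bundle B) \<theta> (inv_into U \<phi> (fst z)) (snd z))"
          unfolding W(2) W'(2) z(1) fst_conv snd_conv i lift_dual[OF W(1) z(3)]
            dual_triv_eq(2)[OF W'(1) z(4) dual_lift_fibre[OF W(1) z(3)]]
          by (simp add: dual_lift_def lift_fibre[OF W'(1) z(4)])
      qed
    qed
  qed
qed

section \<open>Smooth functions and sections of a vector bundle\<close>

lemma proj_pullback_smooth:
  assumes f: "f \<in> smooth_functions (base B)"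
  shows "proj_pullback B f \<in> smooth_functions (total_atlas B)"
proof (rule smooth_functions_totalI)
  show "proj_pullback B f \<in> extensional (total B)" by (simp add: proj_pullback_def)
  fix x assume x: "x \<in> points (base B)"
  obtain U \<phi> W \<psi> where c: "(U, \<phi>) \<in> base B" "(W, \<psi>) \<in> trivs B" "x \<in> U" "x \<in> W"
    by (rule chart_triv_exists[OF x])
  have oS: "open (\<phi> ` (U \<inter> W))" by (rule openin_image_open[OF smooth_base triv_open[OF c(2)] c(1)])
  have o: "open (\<phi> ` (U \<inter> W) \<times> (UNIV :: 'f set))" by (rule open_Times[OF oS open_UNIV])
  have "smooth_on (\<phi> ` (U \<inter> W) \<times> (UNIV :: 'f set)) (\<lambda>z. f (inv_into U \<phi> (fst z)))"
    by (rule smooth_on_compose[OF o oS _ smooth_on_fst[OF o smooth_on_ident[OF o]]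
          smooth_on_subset[OF smooth_functionsD[OF f c(1)]]]) auto
  moreover have "inv_into U \<phi> (\<phi> x) = x" if "x \<in> U" for x by (rule chart_inv[OF smooth_base c(1) that])
  ultimately show "\<exists>U \<phi> W \<psi> S g. (U, \<phi>) \<in> base B \<and> (W, \<psi>) \<in> trivs B \<and>
      openin (atlas_topology (base B)) S \<and> S \<subseteq> U \<inter> W \<and> x \<in> S \<and> smooth_on (\<phi> ` S \<times> UNIV) g \<and>
      (\<forall>e\<in>total B. proj B e \<in> S \<longrightarrow> proj_pullback B f e = g (\<phi> (proj B e), \<psi> e))"
    using c openin_chart_triv[OF c(1,2)]
    by (intro exI[of _ U] exI[of _ \<phi>] exI[of _ W] exI[of _ \<psi>] exI[of _ "U \<inter> W"]
        exI[of _ "\<lambda>z. f (inv_into U \<phi> (fst z))"]) (auto simp: proj_pullback_def)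
qed

lemma fibre_linear_smooth:
  assumes \<gamma>: "\<gamma> \<in> sections (dual_bundle B)"
  shows "fibre_linear B \<gamma> \<in> smooth_functions (total_atlas B)"
proof (rule smooth_functions_totalI)
  interpret d: prebundle "dual_bundle B" by (rule prebundle_dual)
  show "fibre_linear B \<gamma> \<in> extensional (total B)" by (simp add: fibre_linear_def)
  fix x assume x: "x \<in> points (base B)"
  obtain U \<phi> W \<psi> where c: "(U, \<phi>) \<in> base B" "(W, \<psi>) \<in> trivs B" "x \<in> U" "x \<in> W"
    by (rule chart_triv_exists[OF x])
  have oS: "open (\<phi> ` (U \<inter> W))" by (rule openin_image_open[OF smooth_base triv_open[OF c(2)] c(1)])
  have o: "open (\<phi> ` (U \<inter> W) \<times> (UNIV :: 'f set))" by (rule open_Times[OF oS open_UNIV])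
  let ?g = "\<lambda>z. dual_triv B \<psi> (\<gamma> (inv_into U \<phi> (fst z))) \<bullet> snd z"
  have "smooth_on (\<phi> ` (U \<inter> W)) (\<lambda>y. dual_triv B \<psi> (\<gamma> (inv_into U \<phi> y)))"
    using d.sections_smooth[OF \<gamma> _ trivs_dualI[OF c(2)]] c(1) by simp
  then have "smooth_on (\<phi> ` (U \<inter> W) \<times> (UNIV :: 'f set)) (\<lambda>z. dual_triv B \<psi> (\<gamma> (inv_into U \<phi> (fst z))))"
    by (intro smooth_on_compose[OF o oS _ smooth_on_fst[OF o smooth_on_ident[OF o]]]) auto
  then have "smooth_on (\<phi> ` (U \<inter> W) \<times> UNIV) ?g"
    by (rule smooth_on_inner[OF o _ smooth_on_snd[OF o smooth_on_ident[OF o]]])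
  moreover have "fibre_linear B \<gamma> e = ?g (\<phi> (proj B e), \<psi> e)" if e: "e \<in> total B" "proj B e \<in> U \<inter> W" for e
  proof -
    have "inv_into U \<phi> (\<phi> (proj B e)) = proj B e"
      using chart_inj_on[OF smooth_base c(1)] e by simp
    moreover have "\<gamma> (proj B e) \<in> fibre (dual_bundle B) (proj B e)"
      using d.sections_in_fibre[OF \<gamma>] proj_points[OF e(1)] by simp
    ultimately show ?thesis
      using e dual_triv_eq(1)[OF c(2) _ _ fibreI[OF e(1)]] by (simp add: fibre_linear_def)
  qed
  ultimately show "\<exists>U \<phi> W \<psi> S g. (U, \<phi>) \<in> base B \<and> (W, \<psi>) \<in> trivs B \<and>
      openin (atlas_topology (base B)) S \<and> S \<subseteq> U \<inter> W \<and> x \<in> S \<and> smooth_on (\<phi> ` S \<times> UNIV) g \<and>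
      (\<forall>e\<in>total B. proj B e \<in> S \<longrightarrow> fibre_linear B \<gamma> e = g (\<phi> (proj B e), \<psi> e))"
    using c openin_chart_triv[OF c(1,2)]
    by (intro exI[of _ U] exI[of _ \<phi>] exI[of _ W] exI[of _ \<psi>] exI[of _ "U \<inter> W"]
        exI[of _ ?g] conjI) auto
qed

lemma pairing_smooth:
  assumes \<gamma>: "\<gamma> \<in> sections (dual_bundle B)" and s: "s \<in> sections B"
  shows "pairing B \<gamma> s \<in> smooth_functions (base B)"
proof (rule smooth_functions_localI[OF smooth_base])
  interpret d: prebundle "dual_bundle B" by (rule prebundle_dual)
  show "pairing B \<gamma> s \<in> extensional (points (base B))" by (simp add: pairing_def)
  fix x assume x: "x \<in> points (base B)"
  obtain U \<phi> W \<psi> where c: "(U, \<phi>) \<in> base B" "(W, \<psi>) \<in> trivs B" "x \<in> U" "x \<in> W"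
    by (rule chart_triv_exists[OF x])
  have oS: "open (\<phi> ` (U \<inter> W))" by (rule openin_image_open[OF smooth_base triv_open[OF c(2)] c(1)])
  let ?g = "\<lambda>y. dual_triv B \<psi> (\<gamma> (inv_into U \<phi> y)) \<bullet> \<psi> (s (inv_into U \<phi> y))"
  have "smooth_on (\<phi> ` (U \<inter> W)) (\<lambda>y. dual_triv B \<psi> (\<gamma> (inv_into U \<phi> y)))"
    using d.sections_smooth[OF \<gamma> _ trivs_dualI[OF c(2)]] c(1) by simp
  then have "smooth_on (\<phi> ` (U \<inter> W)) ?g"
    by (rule smooth_on_inner[OF oS _ sections_smooth[OF s c(1,2)]])
  moreover have "pairing B \<gamma> s x = ?g (\<phi> x)" if x: "x \<in> U \<inter> W" for x
  proof -
    have p: "x \<in> points (base B)" using chart_subset_points[OF c(1)] x by blast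
    have "inv_into U \<phi> (\<phi> x) = x" using chart_inj_on[OF smooth_base c(1)] x by simp
    then show ?thesis
      using dual_triv_eq(1)[OF c(2) _ _ sections_in_fibre[OF s p], of "\<gamma> x"]
        d.sections_in_fibre[OF \<gamma>, of x] p x by (simp add: pairing_def)
  qed
  ultimately show "\<exists>U \<phi> S g. (U, \<phi>) \<in> base B \<and> openin (atlas_topology (base B)) S \<and> S \<subseteq> U \<and>
      x \<in> S \<and> smooth_on (\<phi> ` S) g \<and> (\<forall>x'\<in>S. pairing B \<gamma> s x' = g (\<phi> x'))"
    using c openin_chart_triv[OF c(1,2)]
    by (intro exI[of _ U] exI[of _ \<phi>] exI[of _ "U \<inter> W"] exI[of _ ?g] conjI) auto
qed

text \<open>Reflexivity of the fibres, with smooth dependence on the base point: applying the dual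
  trivialisation twice to \<open>\<gamma>\<close> gives the fibre coordinate of the section. It lets
  test sections of the bidual be replaced by sections of \<open>B\<close>.\<close>

lemma section_of_bidual:
  assumes \<gamma>: "\<gamma> \<in> sections (dual_bundle (dual_bundle B))"
  shows "\<exists>s\<in>sections B. \<forall>x\<in>points (base B). \<forall>\<epsilon>\<in>fibre (dual_bundle B) x. snd (\<gamma> x) \<epsilon> = snd \<epsilon> (s x)"
proof -
  interpret d: prebundle "dual_bundle B" by (rule prebundle_dual)
  interpret dd: prebundle "dual_bundle (dual_bundle B)" by (rule d.prebundle_dual)
  let ?P = "\<lambda>x g. g \<in> fibre B x \<and> (\<forall>\<epsilon>\<in>fibre (dual_bundle B) x. snd (\<gamma> x) \<epsilon> = snd \<epsilon> g)"
  let ?u = "\<lambda>\<psi> x. dual_triv (dual_bundle B) (dual_triv B \<psi>) (\<gamma> x)"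
  have \<gamma>u: "snd (\<gamma> x) \<epsilon> = ?u \<psi> x \<bullet> dual_triv B \<psi> \<epsilon>"
    if W: "(W, \<psi>) \<in> trivs B" "x \<in> W" and \<epsilon>: "\<epsilon> \<in> fibre (dual_bundle B) x" for W \<psi> x \<epsilon>
    using dd.sections_in_fibre[OF \<gamma>, of x] triv_points[OF W]
    by (intro d.dual_triv_eq(1)[OF trivs_dualI[OF W(1)] W(2) _ \<epsilon>]) simp
  have ex: "\<exists>g. ?P x g" if x: "x \<in> points (base B)" for x
  proof -
    obtain W \<psi> where W: "(W, \<psi>) \<in> trivs B" "x \<in> W" using trivs_cover[OF x] by blast
    have "?P x (lift B \<psi> x (?u \<psi> x))"
      using \<gamma>u[OF W] dual_triv_eq(1)[OF W _ lift_fibre[OF W]] lift_fibre[OF W]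
      by (auto simp: triv_lift[OF W] inner_commute)
    then show ?thesis by blast
  qed
  have "\<forall>x\<in>points (base B). \<exists>g. ?P x g" using ex by blast
  then obtain s0 where s0: "\<And>x. x \<in> points (base B) \<Longrightarrow> ?P x (s0 x)"
    unfolding bchoice_iff by blast
  define s where "s = (\<lambda>x\<in>points (base B). s0 x)"
  have s: "?P x (s x)" if "x \<in> points (base B)" for x
    using s0[OF that] that unfolding s_def restrict_def by simp
  have u: "\<psi> (s x) = ?u \<psi> x" if W: "(W, \<psi>) \<in> trivs B" "x \<in> W" for W \<psi> x
  proof -
    note sx = s[OF triv_points[OF W]]
    \<comment> \<open>The difference of the two coordinate vectors is tested against the form that
      it represents itself, so its norm is 0.\<close>
    let ?w = "\<psi> (s x) - ?u \<psi> x"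
    have "snd (dual_lift B \<psi> x ?w) (s x) = ?u \<psi> x \<bullet> ?w"
      using sx \<gamma>u[OF W dual_lift_fibre[OF W, of ?w]] dual_lift_fibre[OF W, of ?w]
      by (simp add: dual_triv_dual_lift[OF W])
    then have "?w \<bullet> ?w = 0"
      using sx by (simp add: dual_lift_def inner_diff_left inner_diff_right inner_commute)
    then show ?thesis by simp
  qed
  have "s \<in> sections B"
  proof (rule sectionsI)
    show "s \<in> extensional (points (base B))" by (simp add: s_def)
    fix x assume x: "x \<in> points (base B)"
    show "s x \<in> fibre B x" using s[OF x] by blast
    obtain U \<phi> W \<psi> where c: "(U, \<phi>) \<in> base B" "(W, \<psi>) \<in> trivs B" "x \<in> U" "x \<in> W"
      by (rule chart_triv_exists[OF x])
    have "smooth_on (\<phi> ` (U \<inter> W)) (\<lambda>y. ?u \<psi> (inv_into U \<phi> y))"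
      using dd.sections_smooth[OF \<gamma> _ trivs_dualI[OF trivs_dualI[OF c(2)]]] c(1) by simp
    moreover have "inv_into U \<phi> (\<phi> x) = x" if "x \<in> U" for x by (rule chart_inv[OF smooth_base c(1) that])
    ultimately show "\<exists>U \<phi> W \<psi> S g. (U, \<phi>) \<in> base B \<and> (W, \<psi>) \<in> trivs B \<and>
      openin (atlas_topology (base B)) S \<and> S \<subseteq> U \<inter> W \<and> x \<in> S \<and> smooth_on (\<phi> ` S) g \<and>
      (\<forall>x'\<in>S. \<psi> (s x') = g (\<phi> x'))"
      using c openin_chart_triv[OF c(1,2)] u[OF c(2)]
      by (intro exI[of _ U] exI[of _ \<phi>] exI[of _ W] exI[of _ \<psi>] exI[of _ "U \<inter> W"]
          exI[of _ "\<lambda>y. ?u \<psi> (inv_into U \<phi> y)"] conjI) auto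
  qed
  then show ?thesis using s by blast
qed

end


section \<open>Extension of local data by cut-off functions\<close>

text \<open>On \<open>S\<close> the product is smooth in the chart; off \<open>S\<close> a
  neighbourhood is obtained by removing the closed set \<open>K\<close>, and there the function is
  0.\<close>

lemma local_function:
  assumes A: "smooth_atlas A" and c: "(U, \<phi>) \<in> A" and S: "openin (atlas_topology A) S" "S \<subseteq> U"
    and K: "closedin (atlas_topology A) K" "K \<subseteq> S"
    and \<rho>: "\<rho> \<in> smooth_functions A" "\<And>x. x \<in> points A - K \<Longrightarrow> \<rho> x = 0"
    and g: "smooth_on (\<phi> ` S) g"
  shows "(\<lambda>x\<in>points A. if x \<in> S then \<rho> x * g (\<phi> x) else 0) \<in> smooth_functions A" (is "?f \<in> _")
proof (rule smooth_functions_localI[OF A])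
  show "?f \<in> extensional (points A)" by simp
  fix x assume x: "x \<in> points A"
  show "\<exists>U \<phi> S g. (U, \<phi>) \<in> A \<and> openin (atlas_topology A) S \<and> S \<subseteq> U \<and>
      x \<in> S \<and> smooth_on (\<phi> ` S) g \<and> (\<forall>x'\<in>S. ?f x' = g (\<phi> x'))"
  proof (cases "x \<in> S")
    case True
    have i: "inv_into U \<phi> (\<phi> x) = x" if "x \<in> U" for x by (rule chart_inv[OF A c that])
    have "smooth_on (\<phi> ` S) (\<lambda>y. \<rho> (inv_into U \<phi> y) * g y)"
      by (rule smooth_on_mult[OF openin_image_open'[OF A S(1) c S(2)]
            smooth_on_subset[OF smooth_functionsD[OF \<rho>(1) c]] g]) (use S in auto)
    moreover have "\<forall>x'\<in>S. ?f x' = \<rho> (inv_into U \<phi> (\<phi> x')) * g (\<phi> x')"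
    proof
      fix x' assume x': "x' \<in> S"
      then have "x' \<in> U" "x' \<in> points A" using S(2) chart_subset_points[OF c] by auto
      then show "?f x' = \<rho> (inv_into U \<phi> (\<phi> x')) * g (\<phi> x')" using x' i by simp
    qed
    ultimately show ?thesis using c S True
      by (intro exI[of _ U] exI[of _ \<phi>] exI[of _ S] exI[of _ "\<lambda>y. \<rho> (inv_into U \<phi> y) * g y"] conjI)
  next
    case False
    obtain V \<psi> where V: "(V, \<psi>) \<in> A" "x \<in> V" using x by (rule points_chartE)
    have "openin (atlas_topology A) (V - K)" by (rule openin_diff[OF openin_chart[OF A V(1)] K(1)])
    moreover have "\<forall>x'\<in>V - K. ?f x' = 0"
    proof
      fix x' assume "x' \<in> V - K"
      then have "x' \<in> points A - K" using chart_subset_points[OF V(1)] by auto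
      then show "?f x' = 0" using \<rho>(2) by simp
    qed
    moreover have "smooth_on (\<psi> ` (V - K)) (\<lambda>_. 0 :: real)" by (rule smooth_on_const)
    moreover have "V - K \<subseteq> V" "x \<in> V - K" using V False K(2) by auto
    ultimately show ?thesis using V(1)
      by (intro exI[of _ V] exI[of _ \<psi>] exI[of _ "V - K"] exI[of _ "\<lambda>_. 0"] conjI)
  qed
qed

context prebundle
begin

lemma local_section:
  assumes c: "(U, \<phi>) \<in> base B" "(W, \<psi>) \<in> trivs B"
    and S: "openin (atlas_topology (base B)) S" "S \<subseteq> U \<inter> W"
    and K: "closedin (atlas_topology (base B)) K" "K \<subseteq> S"
    and \<rho>: "\<rho> \<in> smooth_functions (base B)" "\<And>x. x \<in> points (base B) - K \<Longrightarrow> \<rho> x = 0"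
  shows "\<exists>s\<in>sections B. \<forall>x\<in>S. s x = lift B \<psi> x (\<rho> x *\<^sub>R w)"
proof -
  have "\<forall>x\<in>points (base B). \<exists>g. g \<in> fibre B x"
    using trivs_cover lift_fibre by blast
  then obtain z where z: "\<And>x. x \<in> points (base B) \<Longrightarrow> z x \<in> fibre B x"
    unfolding bchoice_iff by blast
  \<comment> \<open>The record has no zero vector, so 0 times an arbitrary element of the fibre
    serves as the value outside \<open>S\<close>.\<close>
  define s where "s = (\<lambda>x\<in>points (base B). if x \<in> S then lift B \<psi> x (\<rho> x *\<^sub>R w) else vscale B 0 (z x))"
  have SP: "S \<subseteq> points (base B)" using S(2) chart_subset_points[OF c(1)] by blast
  have "s \<in> sections B"
  proof (rule sectionsI)
    show "s \<in> extensional (points (base B))" by (simp add: s_def)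
    fix x assume x: "x \<in> points (base B)"
    show fib: "s x \<in> fibre B x"
      using x S(2) lift_fibre[OF c(2)] vscale_fibre[OF z[OF x]] by (auto simp: s_def)
    show "\<exists>U \<phi> W \<psi> S g. (U, \<phi>) \<in> base B \<and> (W, \<psi>) \<in> trivs B \<and>
      openin (atlas_topology (base B)) S \<and> S \<subseteq> U \<inter> W \<and> x \<in> S \<and> smooth_on (\<phi> ` S) g \<and>
      (\<forall>x'\<in>S. \<psi> (s x') = g (\<phi> x'))"
    proof (cases "x \<in> S")
      case True
      have i: "inv_into U \<phi> (\<phi> x) = x" if "x \<in> U" for x by (rule chart_inv[OF smooth_base c(1) that])
      have o: "open (\<phi> ` S)" by (rule openin_image_open'[OF smooth_base S(1) c(1)]) (use S in auto)
      have "smooth_on (\<phi> ` S) (\<lambda>y. \<rho> (inv_into U \<phi> y) *\<^sub>R w)"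
        by (rule smooth_on_scaleR[OF o smooth_on_subset[OF smooth_functionsD[OF \<rho>(1) c(1)]] smooth_on_const])
          (use S in auto)
      moreover have "\<forall>x'\<in>S. \<psi> (s x') = \<rho> (inv_into U \<phi> (\<phi> x')) *\<^sub>R w"
      proof
        fix x' assume x': "x' \<in> S"
        then have "x' \<in> points (base B)" "x' \<in> U" "x' \<in> W" using SP S(2) by auto
        then show "\<psi> (s x') = \<rho> (inv_into U \<phi> (\<phi> x')) *\<^sub>R w"
          using x' i triv_lift[OF c(2)] by (simp add: s_def)
      qed
      ultimately show ?thesis using c S True
        by (intro exI[of _ U] exI[of _ \<phi>] exI[of _ W] exI[of _ \<psi>] exI[of _ S]
            exI[of _ "\<lambda>y. \<rho> (inv_into U \<phi> y) *\<^sub>R w"] conjI)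
    next
      case False
      obtain U' \<phi>' W' \<psi>' where d: "(U', \<phi>') \<in> base B" "(W', \<psi>') \<in> trivs B" "x \<in> U'" "x \<in> W'"
        by (rule chart_triv_exists[OF x])
      have "openin (atlas_topology (base B)) (U' \<inter> W' - K)"
        by (rule openin_diff[OF openin_chart_triv[OF d(1,2)] K(1)])
      moreover have "\<forall>x'\<in>U' \<inter> W' - K. \<psi>' (s x') = 0"
      proof
        fix x' assume x': "x' \<in> U' \<inter> W' - K"
        have p: "x' \<in> points (base B)" using x' chart_subset_points[OF d(1)] by blast
        have *: "\<psi>' (vscale B 0 g) = 0" if "g \<in> fibre B x'" for g
          using triv_scale[OF d(2) _ that, of 0] x' by simp
        \<comment> \<open>On \<open>S - K\<close> the factor \<open>\<rho> x'\<close> is 0, so in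
          either branch the value is 0 times some element of the fibre.\<close>
        have "s x' = vscale B 0 (z x') \<or> x' \<in> W \<and> s x' = vscale B 0 (lift B \<psi> x' w)"
        proof (cases "x' \<in> S")
          case True
          then have "x' \<in> W" using S(2) by blast
          then show ?thesis
            using lift_scale[OF c(2), of x' 0 w] \<rho>(2)[of x'] p x' True by (simp add: s_def)
        qed (simp add: s_def p)
        then show "\<psi>' (s x') = 0" using * z[OF p] lift_fibre[OF c(2)] by auto
      qed
      moreover have "smooth_on (\<phi>' ` (U' \<inter> W' - K)) (\<lambda>_. 0 :: 'f)" by (rule smooth_on_const)
      moreover have "U' \<inter> W' - K \<subseteq> U' \<inter> W'" "x \<in> U' \<inter> W' - K" using d False K(2) by auto
      ultimately show ?thesis using d(1,2)
        by (intro exI[of _ U'] exI[of _ \<phi>'] exI[of _ W'] exI[of _ \<psi>'] exI[of _ "U' \<inter> W' - K"]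
            exI[of _ "\<lambda>_. 0"] conjI)
    qed
  qed
  moreover have "s x = lift B \<psi> x (\<rho> x *\<^sub>R w)" if "x \<in> S" for x using that SP by (auto simp: s_def)
  ultimately show ?thesis by blast
qed

text \<open>The cut-off depends on the base point alone, so the function \<open>g\<close> survives
  along whole fibres over the region where \<open>\<rho>\<close> is 1.\<close>

lemma local_total_function:
  assumes c: "(U, \<phi>) \<in> base B" "(W, \<psi>) \<in> trivs B"
    and S: "openin (atlas_topology (base B)) S" "S \<subseteq> U \<inter> W"
    and K: "closedin (atlas_topology (base B)) K" "K \<subseteq> S"
    and \<rho>: "\<rho> \<in> smooth_functions (base B)" "\<And>x. x \<in> points (base B) - K \<Longrightarrow> \<rho> x = 0"
    and g: "smooth_on (\<phi> ` S \<times> UNIV) g"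
  shows "(\<lambda>e\<in>total B. if proj B e \<in> S then \<rho> (proj B e) * g (\<phi> (proj B e), \<psi> e) else 0)
    \<in> smooth_functions (total_atlas B)" (is "?f \<in> _")
proof (rule smooth_functions_totalI)
  show "?f \<in> extensional (total B)" by simp
  fix x assume x: "x \<in> points (base B)"
  show "\<exists>U \<phi> W \<psi> S g. (U, \<phi>) \<in> base B \<and> (W, \<psi>) \<in> trivs B \<and>
      openin (atlas_topology (base B)) S \<and> S \<subseteq> U \<inter> W \<and> x \<in> S \<and> smooth_on (\<phi> ` S \<times> UNIV) g \<and>
      (\<forall>e\<in>total B. proj B e \<in> S \<longrightarrow> ?f e = g (\<phi> (proj B e), \<psi> e))"
  proof (cases "x \<in> S")
    case True
    have i: "inv_into U \<phi> (\<phi> x) = x" if "x \<in> S" for x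
      using chart_inj_on[OF smooth_base c(1)] that S(2) by (intro inv_into_f_f) auto
    have oS: "open (\<phi> ` S)" by (rule openin_image_open'[OF smooth_base S(1) c(1)]) (use S in auto)
    have o: "open (\<phi> ` S \<times> (UNIV :: 'f set))" by (rule open_Times[OF oS open_UNIV])
    have r: "smooth_on (\<phi> ` S) (\<lambda>y. \<rho> (inv_into U \<phi> y))"
      by (rule smooth_on_subset[OF smooth_functionsD[OF \<rho>(1) c(1)]]) (use S in auto)
    have "smooth_on (\<phi> ` S \<times> (UNIV :: 'f set)) (\<lambda>z. \<rho> (inv_into U \<phi> (fst z)))"
      by (rule smooth_on_compose[OF o oS _ smooth_on_fst[OF o smooth_on_ident[OF o]] r]) auto
    from smooth_on_mult[OF o this g]
    have "smooth_on (\<phi> ` S \<times> UNIV) (\<lambda>z. \<rho> (inv_into U \<phi> (fst z)) * g z)" .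
    moreover have "\<forall>e\<in>total B. proj B e \<in> S \<longrightarrow> ?f e =
        \<rho> (inv_into U \<phi> (fst (\<phi> (proj B e), \<psi> e))) * g (\<phi> (proj B e), \<psi> e)"
      using i by simp
    ultimately show ?thesis using c S True
      by (intro exI[of _ U] exI[of _ \<phi>] exI[of _ W] exI[of _ \<psi>] exI[of _ S]
          exI[of _ "\<lambda>z. \<rho> (inv_into U \<phi> (fst z)) * g z"] conjI)
  next
    case False
    obtain U' \<phi>' W' \<psi>' where d: "(U', \<phi>') \<in> base B" "(W', \<psi>') \<in> trivs B" "x \<in> U'" "x \<in> W'"
      by (rule chart_triv_exists[OF x])
    have "openin (atlas_topology (base B)) (U' \<inter> W' - K)"
      by (rule openin_diff[OF openin_chart_triv[OF d(1,2)] K(1)])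
    moreover have "smooth_on (\<phi>' ` (U' \<inter> W' - K) \<times> (UNIV :: 'f set)) (\<lambda>_. 0 :: real)"
      by (rule smooth_on_const)
    moreover have "U' \<inter> W' - K \<subseteq> U' \<inter> W'" "x \<in> U' \<inter> W' - K" using d False K(2) by auto
    moreover have "\<forall>e\<in>total B. proj B e \<in> U' \<inter> W' - K \<longrightarrow> ?f e = 0"
      using \<rho>(2) proj_points by simp
    ultimately show ?thesis using d(1,2)
      by (intro exI[of _ U'] exI[of _ \<phi>'] exI[of _ W'] exI[of _ \<psi>'] exI[of _ "U' \<inter> W' - K"]
          exI[of _ "\<lambda>_. 0"] conjI)
  qed
qed

text \<open>The toolbox for all local computations. \<open>S\<close> is a coordinate ball, as
  convexity is wanted for \<open>hadamard\<close>; \<open>N\<close> is the smaller neighbourhood on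
  which the cut-off is 1, so that the global extensions agree there exactly with functions on the
  base, the frame of \<open>\<psi>\<close>, its dual frame and functions on the total space.\<close>

lemma local_frame:
  assumes x0: "x0 \<in> points (base B)"
  obtains U \<phi> W \<psi> S N r where "(U, \<phi>) \<in> base B" "(W, \<psi>) \<in> trivs B"
    "openin (atlas_topology (base B)) N" "x0 \<in> N" "N \<subseteq> S" "S \<subseteq> U \<inter> W" "\<phi> ` S = ball (\<phi> x0) r"
    and "\<And>g. smooth_on (\<phi> ` S) g \<Longrightarrow> \<exists>f\<in>smooth_functions (base B). \<forall>x\<in>N. f x = g (\<phi> x)"
    and "\<And>w. \<exists>s\<in>sections B. \<forall>x\<in>N. s x = lift B \<psi> x w"
    and "\<And>w. \<exists>\<gamma>\<in>sections (dual_bundle B). \<forall>x\<in>N. \<forall>g\<in>fibre B x. snd (\<gamma> x) g = w \<bullet> \<psi> g"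
    and "\<And>g. smooth_on (\<phi> ` S \<times> UNIV) g \<Longrightarrow> \<exists>f\<in>smooth_functions (total_atlas B).
      \<forall>e\<in>total B. proj B e \<in> N \<longrightarrow> f e = g (\<phi> (proj B e), \<psi> e)"
proof -
  interpret d: prebundle "dual_bundle B" by (rule prebundle_dual)
  obtain U \<phi> W \<psi> where c: "(U, \<phi>) \<in> base B" "(W, \<psi>) \<in> trivs B" "x0 \<in> U" "x0 \<in> W"
    by (rule chart_triv_exists[OF x0])
  have "open (\<phi> ` (U \<inter> W))" by (rule openin_image_open[OF smooth_base triv_open[OF c(2)] c(1)])
  moreover have "\<phi> x0 \<in> \<phi> ` (U \<inter> W)" using c by blast
  ultimately obtain r where r: "r > 0" "ball (\<phi> x0) r \<subseteq> \<phi> ` (U \<inter> W)"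
    using open_contains_ball by blast
  define S where "S = {x \<in> U. \<phi> x \<in> ball (\<phi> x0) r}"
  have S: "openin (atlas_topology (base B)) S"
    unfolding S_def by (rule openin_chart_preimage[OF smooth_base c(1)]) simp
  have SU: "S \<subseteq> U \<inter> W"
  proof
    fix x assume x: "x \<in> S"
    then have "\<phi> x \<in> \<phi> ` (U \<inter> W)" using r by (auto simp: S_def)
    then obtain x' where "x' \<in> U \<inter> W" "\<phi> x = \<phi> x'" by blast
    then show "x \<in> U \<inter> W" using x chart_inj_on[OF smooth_base c(1)] by (auto simp: S_def inj_on_def)
  qed
  have im: "\<phi> ` S = ball (\<phi> x0) r"
  proof (intro equalityI subsetI)
    fix y assume y: "y \<in> ball (\<phi> x0) r"
    then obtain x where "x \<in> U \<inter> W" "y = \<phi> x" using r by blast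
    then show "y \<in> \<phi> ` S" using y by (auto simp: S_def)
  qed (auto simp: S_def)
  have "x0 \<in> S" using c r by (simp add: S_def)
  obtain \<rho> N K where \<rho>: "\<rho> \<in> smooth_functions (base B)" and N: "openin (atlas_topology (base B)) N"
    "x0 \<in> N" and K: "closedin (atlas_topology (base B)) K" "N \<subseteq> K" "K \<subseteq> S"
    and \<rho>1: "\<And>x. x \<in> N \<Longrightarrow> \<rho> x = 1" and \<rho>0: "\<And>x. x \<in> points (base B) - K \<Longrightarrow> \<rho> x = 0"
    using cutoff_exists[OF manifold_base S \<open>x0 \<in> S\<close>] by blast
  have NS: "N \<subseteq> S" using K by blast
  have NP: "x \<in> points (base B)" if "x \<in> N" for x using that NS SU chart_subset_points[OF c(1)] by blast
  show ?thesis
  proof (rule that[OF c(1,2) N NS SU im])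
    fix g :: "'b \<Rightarrow> real" assume g: "smooth_on (\<phi> ` S) g"
    have "S \<subseteq> U" using SU by blast
    from local_function[OF smooth_base c(1) S this K(1,3) \<rho> \<rho>0 g]
    show "\<exists>f\<in>smooth_functions (base B). \<forall>x\<in>N. f x = g (\<phi> x)"
      by (rule bexI[rotated]) (use NP NS \<rho>1 in auto)
  next
    fix w
    obtain s where "s \<in> sections B" "\<forall>x\<in>S. s x = lift B \<psi> x (\<rho> x *\<^sub>R w)"
      using local_section[OF c(1,2) S SU K(1,3) \<rho> \<rho>0] by blast
    then show "\<exists>s\<in>sections B. \<forall>x\<in>N. s x = lift B \<psi> x w"
      using NS \<rho>1 by (intro bexI[of _ s]) auto
  next
    fix w
    have "\<exists>s\<in>sections (dual_bundle B). \<forall>x\<in>S. s x = lift (dual_bundle B) (dual_triv B \<psi>) x (\<rho> x *\<^sub>R w)"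
      by (rule d.local_section[OF _ trivs_dualI[OF c(2)] _ SU _ K(3)])
        (use c S K \<rho> \<rho>0 in auto)
    then obtain \<gamma> where \<gamma>: "\<gamma> \<in> sections (dual_bundle B)"
      "\<forall>x\<in>S. \<gamma> x = lift (dual_bundle B) (dual_triv B \<psi>) x (\<rho> x *\<^sub>R w)" by blast
    have "snd (\<gamma> x) g = w \<bullet> \<psi> g" if x: "x \<in> N" and g: "g \<in> fibre B x" for x g
    proof -
      have "x \<in> W" "x \<in> S" using x NS SU by auto
      then show ?thesis using \<gamma>(2) lift_dual[OF c(2)] \<rho>1[OF x] g by (simp add: dual_lift_def)
    qed
    then show "\<exists>\<gamma>\<in>sections (dual_bundle B). \<forall>x\<in>N. \<forall>g\<in>fibre B x. snd (\<gamma> x) g = w \<bullet> \<psi> g"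
      using \<gamma>(1) by blast
  next
    fix g :: "'b \<times> 'f \<Rightarrow> real" assume g: "smooth_on (\<phi> ` S \<times> UNIV) g"
    from local_total_function[OF c(1,2) S SU K(1,3) \<rho> \<rho>0 g]
    show "\<exists>f\<in>smooth_functions (total_atlas B).
      \<forall>e\<in>total B. proj B e \<in> N \<longrightarrow> f e = g (\<phi> (proj B e), \<psi> e)"
      by (rule bexI[rotated]) (use NS \<rho>1 in auto)
  qed
qed

end

section \<open>Derivations and curves in coordinates\<close>

lemma smooth_functions_combine:
  assumes A: "smooth_atlas A" and fg: "f \<in> smooth_functions A" "g \<in> smooth_functions A"
    and h: "\<And>S (f :: 'b::finite_dim_inner \<Rightarrow> real) g. open S \<Longrightarrow> smooth_on S f \<Longrightarrow> smooth_on S g \<Longrightarrow> smooth_on S (\<lambda>y. h (f y) (g y))"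
  shows "(\<lambda>x\<in>points A. h (f x) (g x)) \<in> smooth_functions (A :: ('m, 'b) atlas)"
proof -
  have "smooth_on (\<phi> ` U) ((\<lambda>x\<in>points A. h (f x) (g x)) \<circ> inv_into U \<phi>)" if c: "(U, \<phi>) \<in> A" for U \<phi>
  proof -
    have o: "open (\<phi> ` U)" by (rule chart_image_open[OF A c])
    have "smooth_on (\<phi> ` U) (\<lambda>y. h (f (inv_into U \<phi> y)) (g (inv_into U \<phi> y)))"
      by (rule h[OF o smooth_functionsD[OF fg(1) c] smooth_functionsD[OF fg(2) c]])
    then show ?thesis
      by (rule smooth_on_cong[OF o])
        (use chart_inj_on[OF A c] chart_subset_points[OF c] in auto)
  qed
  then show ?thesis unfolding smooth_functions_def by auto
qed

lemma smooth_functions_linear: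
  "smooth_atlas A \<Longrightarrow> f \<in> smooth_functions A \<Longrightarrow> g \<in> smooth_functions A \<Longrightarrow>
    (\<lambda>x\<in>points A. a * f x + b * g x) \<in> smooth_functions A"
  by (rule smooth_functions_combine) (auto intro!: smooth_on_add smooth_on_mult smooth_on_const)

lemma smooth_functions_mult:
  "smooth_atlas A \<Longrightarrow> f \<in> smooth_functions A \<Longrightarrow> g \<in> smooth_functions A \<Longrightarrow>
    (\<lambda>x\<in>points A. f x * g x) \<in> smooth_functions A"
  by (rule smooth_functions_combine) (auto intro!: smooth_on_mult)

lemma smooth_functions_const:
  assumes "smooth_atlas A"
  shows "(\<lambda>x\<in>points A. c) \<in> smooth_functions A"
proof -
  have "smooth_on (\<phi> ` U) ((\<lambda>x\<in>points A. c) \<circ> inv_into U \<phi>)" if "(U, \<phi>) \<in> A" for U \<phi>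
    by (rule smooth_on_cong[OF chart_image_open[OF assms that] smooth_on_const[of _ c]])
      (use chart_inj_on[OF assms that] chart_subset_points[OF that] in auto)
  then show ?thesis unfolding smooth_functions_def by auto
qed

lemma tangent_linear:
  "v \<in> tangent_space A p \<Longrightarrow> f \<in> smooth_functions A \<Longrightarrow> g \<in> smooth_functions A \<Longrightarrow>
    v (\<lambda>x\<in>points A. a * f x + b * g x) = a * v f + b * v g"
  unfolding tangent_space_def by blast

lemma tangent_mult:
  "v \<in> tangent_space A p \<Longrightarrow> f \<in> smooth_functions A \<Longrightarrow> g \<in> smooth_functions A \<Longrightarrow>
    v (\<lambda>x\<in>points A. f x * g x) = f p * v g + g p * v f"
  unfolding tangent_space_def by blast

text \<open>The Leibniz rule for 1 = 1 * 1 gives v(1) = 2 v(1); other constants follow by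
  linearity.\<close>

lemma tangent_const:
  assumes A: "smooth_atlas A" and v: "v \<in> tangent_space A p" and p: "p \<in> points A"
  shows "v (\<lambda>x\<in>points A. c) = 0"
proof -
  let ?o = "\<lambda>x\<in>points A. 1 :: real"
  have o: "?o \<in> smooth_functions A" by (rule smooth_functions_const[OF A])
  have "(\<lambda>x\<in>points A. ?o x * ?o x) = ?o" by auto
  with tangent_mult[OF v o o] p have "v ?o = 0" by simp
  moreover have "(\<lambda>x\<in>points A. c * ?o x + 0 * ?o x) = (\<lambda>x\<in>points A. c)" by auto
  ultimately show ?thesis using tangent_linear[OF v o o, of c 0] by simp
qed

lemma tangent_sum:
  assumes A: "smooth_atlas A" and v: "v \<in> tangent_space A p" and p: "p \<in> points A"
    and "finite I" "\<And>i. i \<in> I \<Longrightarrow> F i \<in> smooth_functions A"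
  shows "(\<lambda>x\<in>points A. \<Sum>i\<in>I. F i x) \<in> smooth_functions A \<and> v (\<lambda>x\<in>points A. \<Sum>i\<in>I. F i x) = (\<Sum>i\<in>I. v (F i))"
  using assms(4,5)
proof (induction I rule: finite_induct)
  case empty
  show ?case
    unfolding sum.empty using smooth_functions_const[OF A, of 0] tangent_const[OF A v p, of 0] by blast
next
  case (insert i I)
  define s where "s = (\<lambda>x\<in>points A. \<Sum>i\<in>I. F i x)"
  have s: "s \<in> smooth_functions A" "v s = (\<Sum>i\<in>I. v (F i))" and i: "F i \<in> smooth_functions A"
    using insert.IH insert.prems unfolding s_def by blast+
  have "(\<lambda>x\<in>points A. \<Sum>i\<in>insert i I. F i x) = (\<lambda>x\<in>points A. 1 * F i x + 1 * s x)"
    by (rule restrict_ext) (use insert.hyps in \<open>simp add: s_def\<close>)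
  moreover have "v (\<lambda>x\<in>points A. 1 * F i x + 1 * s x) = 1 * v (F i) + 1 * v s"
    by (rule tangent_linear[OF v i s(1)])
  moreover have "(\<Sum>i\<in>insert i I. v (F i)) = 1 * v (F i) + 1 * v s"
    using insert.hyps by (simp add: s(2))
  ultimately show ?case
    using smooth_functions_linear[OF A i s(1), of 1 1] by (simp only: simp_thms)
qed

text \<open>The product \<open>\<rho> * (f - g)\<close> is 0, and at \<open>p\<close> the Leibniz
  rule for it leaves only the value of \<open>v\<close> on \<open>f - g\<close>, because
  \<open>\<rho> p = 1\<close> and \<open>f p = g p\<close>.\<close>

lemma tangent_local:
  assumes A: "smooth_atlas A" and v: "v \<in> tangent_space A p" and p: "p \<in> points A"
    and f: "f \<in> smooth_functions A" "g \<in> smooth_functions A"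
    and \<rho>: "\<rho> \<in> smooth_functions A" "\<rho> p = 1" "\<And>x. x \<in> points A \<Longrightarrow> \<rho> x = 0 \<or> f x = g x"
  shows "v f = v g"
proof -
  let ?h = "\<lambda>x\<in>points A. 1 * f x + (- 1) * g x"
  have h: "?h \<in> smooth_functions A" by (rule smooth_functions_linear[OF A f])
  have "(\<lambda>x\<in>points A. \<rho> x * ?h x) = (\<lambda>x\<in>points A. 0)" using \<rho>(3) by fastforce
  then have "0 = \<rho> p * v ?h + ?h p * v \<rho>"
    using tangent_mult[OF v \<rho>(1) h] tangent_const[OF A v p, of 0] by simp
  moreover have "?h p = 0" using \<rho>(2) \<rho>(3)[of p] p by auto
  ultimately have "v ?h = 0" using \<rho>(2) by simp
  moreover have "v ?h = 1 * v f + (- 1) * v g" by (rule tangent_linear[OF v f])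
  ultimately show ?thesis by simp
qed

section \<open>Curves tested by smooth functions\<close>

text \<open>Topological continuity of a curve, recovered from continuity of its compositions with
  smooth functions: a cut-off function that is 1 at \<open>c t\<close> stays positive for nearby
  times, and it vanishes outside \<open>N\<close>.\<close>

lemma eventually_curve_mem:
  fixes c :: "real \<Rightarrow> 'm" and A :: "('m, 'b::finite_dim_inner) atlas"
  assumes M: "manifold A" and N: "openin (atlas_topology A) N" "c t \<in> N"
    and ev: "\<forall>\<^sub>F s in nhds t. c s \<in> points A"
    and cont: "\<And>f. f \<in> smooth_functions A \<Longrightarrow> isCont (\<lambda>s. f (c s)) t"
  shows "\<forall>\<^sub>F s in nhds t. c s \<in> N"
proof -
  obtain \<rho> N' K where \<rho>: "\<rho> \<in> smooth_functions A" "c t \<in> N'" "K \<subseteq> N"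
     "\<forall>x\<in>N'. \<rho> x = 1" "\<forall>x\<in>points A - K. \<rho> x = 0"
    using cutoff_exists[OF M N] by blast
  have "((\<lambda>s. \<rho> (c s)) \<longlongrightarrow> \<rho> (c t)) (nhds t)"
    using cont[OF \<rho>(1)] tendsto_at_iff_tendsto_nhds[of "\<lambda>s. \<rho> (c s)" t] by (simp add: isCont_def)
  then have "\<forall>\<^sub>F s in nhds t. \<rho> (c s) > 0" by (rule order_tendstoD) (simp add: \<rho>(2,4))
  with ev show ?thesis
  proof eventually_elim
    case (elim s)
    then show ?case using \<rho>(3,5) by force
  qed
qed

text \<open>Where \<open>u\<close> vanishes, the difference quotient of the product is that of
  \<open>u\<close> times \<open>k\<close>. Hence continuity of \<open>k\<close> replaces
  differentiability.\<close>

lemma DERIV_mult_vanishing: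
  fixes u k :: "real \<Rightarrow> real"
  assumes "(u has_real_derivative u') (at t)" "u t = 0" "isCont k t"
  shows "((\<lambda>s. u s * k s) has_real_derivative u' * k t) (at t)"
proof -
  have "((\<lambda>h. (u (t + h) - u t) / h * k (t + h)) \<longlongrightarrow> u' * k t) (at 0)"
    using assms(1,3) by (intro tendsto_mult) (simp_all add: DERIV_def isCont_iff)
  then show ?thesis unfolding DERIV_def by (simp add: assms(2))
qed


context prebundle
begin

text \<open>Hadamard's lemma expresses both the derivation \<open>v\<close> and the derivative along \<open>c\<close> by their values
  on linear coordinates, which are built from pullbacks of functions and fibrewise linear functions.\<close>

lemma curve_velocity:
  fixes c :: "real \<Rightarrow> 'e"
  assumes v: "v \<in> tangent_space (total_atlas B) (c t)"
    and ev: "\<forall>\<^sub>F s in nhds t. c s \<in> total B"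
    and bas: "\<And>f. f \<in> smooth_functions (base B) \<Longrightarrow>
      ((\<lambda>s. f (proj B (c s))) has_real_derivative v (proj_pullback B f)) (at t)"
    and fib: "\<And>\<gamma>. \<gamma> \<in> sections (dual_bundle B) \<Longrightarrow>
      ((\<lambda>s. fibre_linear B \<gamma> (c s)) has_real_derivative v (fibre_linear B \<gamma>)) (at t)"
    and F: "F \<in> smooth_functions (total_atlas B)"
  shows "((\<lambda>s. F (c s)) has_real_derivative v F) (at t)"
proof -
  have p: "c t \<in> total B" using ev by (rule eventually_nhds_x_imp_x)
  let ?x = "proj B (c t)"
  note pt = proj_points[OF p]
  obtain U \<phi> W \<psi> S N r where c: "(U, \<phi>) \<in> base B" "(W, \<psi>) \<in> trivs B"
    and N: "openin (atlas_topology (base B)) N" "?x \<in> N" "N \<subseteq> S" and S: "S \<subseteq> U \<inter> W" "\<phi> ` S = ball (\<phi> ?x) r"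
    and ext_base: "\<And>g. smooth_on (\<phi> ` S) g \<Longrightarrow> \<exists>f\<in>smooth_functions (base B). \<forall>x\<in>N. f x = g (\<phi> x)"
    and ext_sec: "\<And>w. \<exists>\<gamma>\<in>sections (dual_bundle B). \<forall>x\<in>N. \<forall>g\<in>fibre B x. snd (\<gamma> x) g = w \<bullet> \<psi> g"
    and ext_tot: "\<And>g. smooth_on (\<phi> ` S \<times> UNIV) g \<Longrightarrow> \<exists>f\<in>smooth_functions (total_atlas B).
      \<forall>e\<in>total B. proj B e \<in> N \<longrightarrow> f e = g (\<phi> (proj B e), \<psi> e)"
    by (rule local_frame[OF pt]) blast
  let ?P = "points (total_atlas B)"
  let ?S = "\<phi> ` S \<times> (UNIV :: 'f set)"
  \<comment> \<open>\<open>z\<close> is the chart of the total space and \<open>F'\<close> the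
    function \<open>F\<close> read in it; \<open>hadamard\<close> is applied to \<open>F'\<close> at
    \<open>z (c t)\<close>.\<close>
  define z where "z e = (\<phi> (proj B e), \<psi> e)" for e
  define F' where "F' y = F (lift B \<psi> (inv_into U \<phi> (fst y)) (snd y))" for y
  have zS: "z e \<in> ?S" if "proj B e \<in> N" for e using that N(3) by (auto simp: z_def)
  have o: "open ?S" unfolding S(2) by (intro open_Times open_ball open_UNIV)
  have cv: "convex ?S" unfolding S(2) by (intro convex_Times convex_ball convex_UNIV)
  have F'z: "F' (z e) = F e" if "e \<in> total B" "proj B e \<in> S" for e
  proof -
    have "inv_into U \<phi> (\<phi> (proj B e)) = proj B e" "proj B e \<in> W"
      using that S chart_inj_on[OF smooth_base c(1)] by auto
    then show ?thesis using lift_triv[OF c(2) _ fibreI[OF that(1)]] by (simp add: F'_def z_def)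
  qed
  have "smooth_on ?S F'"
  proof -
    have "smooth_on ((\<lambda>g. (\<phi> (proj B g), \<psi> g)) ` {g \<in> total B. proj B g \<in> U \<inter> W})
      (\<lambda>y. F (inv_into {g \<in> total B. proj B g \<in> U \<inter> W} (\<lambda>g. (\<phi> (proj B g), \<psi> g)) y))"
      by (rule smooth_functionsD[OF F total_atlas_mem[OF c]])
    moreover have "?S \<subseteq> (\<lambda>g. (\<phi> (proj B g), \<psi> g)) ` {g \<in> total B. proj B g \<in> U \<inter> W}"
      using S(1) total_chart_image[OF c(2), of "U \<inter> W" \<phi>] by auto
    ultimately have "smooth_on ?S (\<lambda>y. F (inv_into {g \<in> total B. proj B g \<in> U \<inter> W} (\<lambda>g. (\<phi> (proj B g), \<psi> g)) y))"
      by (rule smooth_on_subset)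
    then show ?thesis
    proof (rule smooth_on_cong[OF o])
      fix y assume "y \<in> ?S"
      then have "fst y \<in> \<phi> ` (U \<inter> W)" using S(1) by auto
      from total_chart_inv[OF c this, of "snd y"]
      show "F (inv_into {g \<in> total B. proj B g \<in> U \<inter> W} (\<lambda>g. (\<phi> (proj B g), \<psi> g)) y) = F' y"
        by (simp add: F'_def)
    qed
  qed
  from hadamard[OF o cv zS[OF N(2)] this]
  obtain G where G: "\<And>b. smooth_on ?S (G b)"
    and FG: "\<And>y. y \<in> ?S \<Longrightarrow> F' y = F' (z (c t)) + (\<Sum>b\<in>ONB. ((y - z (c t)) \<bullet> b) * G b y)"
    by blast
  have "\<exists>f\<in>smooth_functions (base B). \<forall>x\<in>N. f x = \<phi> x \<bullet> fst b" for b :: "'b \<times> 'f"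
    by (rule ext_base) (use S(2) in \<open>auto intro!: smooth_on_inner smooth_on_ident smooth_on_const\<close>)
  then have "\<forall>b :: 'b \<times> 'f. \<exists>f. f \<in> smooth_functions (base B) \<and> (\<forall>x\<in>N. f x = \<phi> x \<bullet> fst b)" by blast
  then obtain f where f: "\<And>b :: 'b \<times> 'f. f b \<in> smooth_functions (base B)"
     "\<And>b x. x \<in> N \<Longrightarrow> f b x = \<phi> x \<bullet> fst b" unfolding choice_iff by blast
  have "\<forall>b :: 'b \<times> 'f. \<exists>\<gamma>. \<gamma> \<in> sections (dual_bundle B) \<and> (\<forall>x\<in>N. \<forall>g\<in>fibre B x. snd (\<gamma> x) g = snd b \<bullet> \<psi> g)"
    using ext_sec by blast
  then obtain \<gamma> where \<gamma>: "\<And>b :: 'b \<times> 'f. \<gamma> b \<in> sections (dual_bundle B)"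
     "\<And>b x g. x \<in> N \<Longrightarrow> g \<in> fibre B x \<Longrightarrow> snd (\<gamma> b x) g = snd b \<bullet> \<psi> g" unfolding choice_iff by blast
  have "\<forall>b. \<exists>h. h \<in> smooth_functions (total_atlas B) \<and>
      (\<forall>e\<in>total B. proj B e \<in> N \<longrightarrow> h e = G b (\<phi> (proj B e), \<psi> e))"
    using ext_tot[OF G] by blast
  then obtain H where H: "\<And>b. H b \<in> smooth_functions (total_atlas B)"
    "\<And>b e. e \<in> total B \<Longrightarrow> proj B e \<in> N \<Longrightarrow> H b e = G b (z e)"
    unfolding choice_iff z_def by blast
  \<comment> \<open>Over \<open>N\<close> this is the coordinate \<open>z e \<bullet> b\<close>. Its
    base part is a pullback and its fibre part is fibrewise linear, so that \<open>bas\<close> and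
    \<open>fib\<close> give its derivative along the curve.\<close>
  define X where "X b = (\<lambda>e\<in>?P. 1 * proj_pullback B (f b) e + 1 * fibre_linear B (\<gamma> b) e)" for b
  have X: "X b \<in> smooth_functions (total_atlas B)" for b
    unfolding X_def
    by (rule smooth_functions_linear[OF smooth_total proj_pullback_smooth[OF f(1)] fibre_linear_smooth[OF \<gamma>(1)]])
  have Xz: "X b e = z e \<bullet> b" if "e \<in> total B" "proj B e \<in> N" for b e
    using that f(2)[OF that(2), of b] \<gamma>(2)[OF that(2) fibreI[OF that(1)], of b]
    by (simp add: X_def points_total proj_pullback_def fibre_linear_def z_def inner_prod_def inner_commute)
  have dX: "((\<lambda>s. X b (c s)) has_real_derivative v (X b)) (at t)" for b
  proof -
    have "((\<lambda>s. f b (proj B (c s)) + fibre_linear B (\<gamma> b) (c s)) has_real_derivative v (X b)) (at t)"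
      using DERIV_add[OF bas[OF f(1)] fib[OF \<gamma>(1)], of b b]
        tangent_linear[OF v proj_pullback_smooth[OF f(1)] fibre_linear_smooth[OF \<gamma>(1)], of 1 b 1 b]
      by (simp add: X_def)
    moreover have "\<forall>\<^sub>F s in nhds t. f b (proj B (c s)) + fibre_linear B (\<gamma> b) (c s) = X b (c s)"
      using ev by eventually_elim (simp add: X_def points_total proj_pullback_def)
    ultimately show ?thesis by (subst (asm) DERIV_cong_ev[OF refl _ refl]) auto
  qed
  \<comment> \<open>Subtracting the value at \<open>c t\<close> makes the coordinate vanish there.
    In the Leibniz rule for \<open>Y b * H b\<close> the unknown \<open>v (H b)\<close> then drops
    out.\<close>
  define Y where "Y b = (\<lambda>e\<in>?P. 1 * X b e + (- (z (c t) \<bullet> b)) * (\<lambda>e\<in>?P. 1) e)" for b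
  have Y: "Y b \<in> smooth_functions (total_atlas B)" for b
    unfolding Y_def by (rule smooth_functions_linear[OF smooth_total X smooth_functions_const[OF smooth_total]])
  have vY: "v (Y b) = v (X b)" for b
    unfolding Y_def tangent_linear[OF v X smooth_functions_const[OF smooth_total]]
    using tangent_const[OF smooth_total v] p by (simp add: points_total)
  have Yz: "Y b e = (z e - z (c t)) \<bullet> b" if "e \<in> total B" "proj B e \<in> N" for b e
    using that Xz[OF that, of b] by (simp add: Y_def points_total inner_diff_left)
  have F_local: "F e = F (c t) + (\<Sum>b\<in>ONB. ((z e - z (c t)) \<bullet> b) * G b (z e))"
    if "e \<in> total B" "proj B e \<in> N" for e
  proof -
    have "F' (z e) = F e" using F'z that N(3) by blast
    moreover have "F' (z (c t)) = F (c t)" using F'z p N(2,3) by blast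
    ultimately show ?thesis using FG[OF zS[OF that(2)]] by simp
  qed
  have YH: "(\<lambda>e\<in>?P. Y b e * H b e) \<in> smooth_functions (total_atlas B)" for b
    by (rule smooth_functions_mult[OF smooth_total Y H(1)])
  let ?R = "\<lambda>e\<in>?P. \<Sum>b\<in>ONB. (\<lambda>e\<in>?P. Y b e * H b e) e"
  have pP: "c t \<in> ?P" using p by (simp add: points_total)
  have R0: "?R \<in> smooth_functions (total_atlas B) \<and> v ?R = (\<Sum>b\<in>ONB. v (\<lambda>e\<in>?P. Y b e * H b e))"
    by (rule tangent_sum[OF smooth_total v pP finite_ONB]) (rule YH)
  note R = conjunct1[OF R0] conjunct2[OF R0]
  let ?Q = "\<lambda>e\<in>?P. F (c t) * (\<lambda>e\<in>?P. 1) e + 1 * ?R e"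
  have Q: "?Q \<in> smooth_functions (total_atlas B)"
    by (rule smooth_functions_linear[OF smooth_total smooth_functions_const[OF smooth_total] R(1)])
  obtain \<rho> where \<rho>: "\<rho> \<in> smooth_functions (base B)" "\<rho> ?x = 1" "\<And>x. x \<in> points (base B) \<Longrightarrow> \<rho> x = 0 \<or> x \<in> N"
    using cutoff_exists[OF manifold_base N(1,2)] by blast
  have "v F = v ?Q"
  proof (rule tangent_local[OF smooth_total v _ F Q proj_pullback_smooth[OF \<rho>(1)]])
    show "c t \<in> ?P" by (rule pP)
    show "proj_pullback B \<rho> (c t) = 1" using p \<rho>(2) by (simp add: proj_pullback_def)
    fix e assume "e \<in> ?P"
    then have e: "e \<in> total B" by (simp add: points_total)
    have "F e = ?Q e" if "proj B e \<in> N"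
      using F_local[OF e that] Yz[OF e that] H(2)[OF e that] e by (simp add: points_total)
    then show "proj_pullback B \<rho> e = 0 \<or> F e = ?Q e"
      using \<rho>(3)[OF proj_points[OF e]] e by (auto simp: proj_pullback_def)
  qed
  also have "\<dots> = v ?R"
    unfolding tangent_linear[OF v smooth_functions_const[OF smooth_total] R(1)]
    using tangent_const[OF smooth_total v] p by (simp add: points_total)
  also have "\<dots> = (\<Sum>b\<in>ONB. G b (z (c t)) * v (X b))"
    unfolding R(2)
    by (rule sum.cong[OF refl])
      (simp add: tangent_mult[OF v Y H(1)] vY Yz[OF p N(2)] H(2)[OF p N(2)])
  finally have vF: "v F = (\<Sum>b\<in>ONB. v (X b) * G b (z (c t)))" by (simp add: mult.commute)
  have evN: "\<forall>\<^sub>F s in nhds t. proj B (c s) \<in> N"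
  proof (rule eventually_curve_mem[where c = "\<lambda>s. proj B (c s)", OF manifold_base N(1,2)])
    show "\<forall>\<^sub>F s in nhds t. proj B (c s) \<in> points (base B)"
      using ev by (rule eventually_mono) (rule proj_points)
    show "isCont (\<lambda>s. f (proj B (c s))) t" if "f \<in> smooth_functions (base B)" for f
      using bas[OF that] by (rule DERIV_isCont)
  qed
  \<comment> \<open>Equals \<open>z (c s)\<close> near \<open>t\<close>, but is built from the
    functions \<open>X b\<close>, whose continuity along the curve is already known.\<close>
  let ?k = "\<lambda>s. \<Sum>b\<in>ONB. X b (c s) *\<^sub>R b"
  have k: "isCont ?k t"
    by (intro continuous_sum continuous_scaleR continuous_const DERIV_isCont[OF dX])
  have kz: "?k s = z (c s)" if "c s \<in> total B" "proj B (c s) \<in> N" for s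
    by (simp add: Xz[OF that] ONB_expansion)
  have "isCont (\<lambda>s. G b (?k s)) t" for b
  proof (rule isCont_o2[OF k])
    show "isCont (G b) (?k t)"
      unfolding kz[OF p N(2)]
      using smooth_on_continuous[OF G] zS[OF N(2)]
      unfolding continuous_on_eq_continuous_at[OF o] by (rule bspec)
  qed
  moreover have "((\<lambda>s. X b (c s) - z (c t) \<bullet> b) has_real_derivative v (X b)) (at t)" for b
    using DERIV_diff[OF dX DERIV_const] by simp
  \<comment> \<open>The derivative of \<open>G b\<close> along the curve is as unknown as that of
    \<open>F\<close>, but its continuity suffices, as the other factor vanishes at
    \<open>t\<close>.\<close>
  ultimately have "((\<lambda>s. (X b (c s) - z (c t) \<bullet> b) * G b (?k s)) has_real_derivative v (X b) * G b (?k t)) (at t)" for b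
    by (intro DERIV_mult_vanishing) (use Xz[OF p N(2)] in auto)
  then have "((\<lambda>s. F (c t) + (\<Sum>b\<in>ONB. (X b (c s) - z (c t) \<bullet> b) * G b (?k s))) has_real_derivative
      0 + (\<Sum>b\<in>ONB. v (X b) * G b (?k t))) (at t)"
    by (intro DERIV_add DERIV_const DERIV_sum)
  then have D: "((\<lambda>s. F (c t) + (\<Sum>b\<in>ONB. (X b (c s) - z (c t) \<bullet> b) * G b (?k s))) has_real_derivative v F) (at t)"
    by (simp add: vF kz[OF p N(2)])
  have evF: "\<forall>\<^sub>F s in nhds t. F (c t) + (\<Sum>b\<in>ONB. (X b (c s) - z (c t) \<bullet> b) * G b (?k s)) = F (c s)"
    using ev evN
  proof eventually_elim
    case (elim s)
    show ?case
      unfolding kz[OF elim] F_local[OF elim] by (simp add: Xz[OF elim] inner_diff_left)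
  qed
  from D show ?thesis by (subst (asm) DERIV_cong_ev[OF refl evF refl])
qed

end


section \<open>Flows\<close>

lemma integral_curve_shift:
  assumes "integral_curve A X J c"
  shows "integral_curve A X {s. s + t \<in> J} (\<lambda>s. c (s + t))"
proof -
  have "((\<lambda>s. f (c (s + t))) has_real_derivative X (c (s0 + t)) f) (at s0)"
    if "s0 + t \<in> J" "f \<in> smooth_functions A" for s0 f
    using assms that unfolding integral_curve_def by (subst DERIV_shift[symmetric]) blast
  then show ?thesis using assms unfolding integral_curve_def by blast
qed

context
  fixes A :: "('m, 'b::finite_dim_inner) atlas" and X :: "'m vfield" and \<Omega> :: "(real \<times> 'm) set"
    and \<phi> :: "real \<Rightarrow> 'm \<Rightarrow> 'm"
  assumes mf: "maximal_flow A X \<Omega> \<phi>"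
begin

lemma flow_domain_points: "(t, x) \<in> \<Omega> \<Longrightarrow> x \<in> points A"
  using mf unfolding maximal_flow_def by blast

lemma
  assumes "x \<in> points A"
  shows flow_domain_open: "open {t. (t, x) \<in> \<Omega>}"
    and flow_domain_interval: "is_interval {t. (t, x) \<in> \<Omega>}"
    and flow_domain_zero: "(0, x) \<in> \<Omega>"
    and flow_integral_curve: "integral_curve A X {t. (t, x) \<in> \<Omega>} (\<lambda>t. \<phi> t x)"
    and flow_zero: "\<phi> 0 x = x"
proof -
  have *: "let J = {t. (t, x) \<in> \<Omega>} in
        open J \<and> is_interval J \<and> 0 \<in> J \<and> integral_curve A X J (\<lambda>t. \<phi> t x) \<and> \<phi> 0 x = x \<and>
        (\<forall>I c. open I \<and> is_interval I \<and> 0 \<in> I \<and> integral_curve A X I c \<and> c 0 = x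
           \<longrightarrow> I \<subseteq> J \<and> (\<forall>t\<in>I. c t = \<phi> t x))"
    using mf assms unfolding maximal_flow_def by blast
  show "open {t. (t, x) \<in> \<Omega>}" "is_interval {t. (t, x) \<in> \<Omega>}" "(0, x) \<in> \<Omega>"
    "integral_curve A X {t. (t, x) \<in> \<Omega>} (\<lambda>t. \<phi> t x)" "\<phi> 0 x = x"
    using * unfolding Let_def by simp_all
qed

text \<open>The maximality clause with the initial point written as \<open>c 0\<close>. Every group
  property of the flow, and every comparison of two curves, is reduced to it.\<close>

lemma flow_unique:
  assumes "open I" "is_interval I" "0 \<in> I" "integral_curve A X I c" "t \<in> I"
  shows "(t, c 0) \<in> \<Omega> \<and> \<phi> t (c 0) = c t"
proof -
  have "c 0 \<in> points A" using assms unfolding integral_curve_def by blast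
  then have "\<forall>I d. open I \<and> is_interval I \<and> 0 \<in> I \<and> integral_curve A X I d \<and> d 0 = c 0
           \<longrightarrow> I \<subseteq> {t. (t, c 0) \<in> \<Omega>} \<and> (\<forall>t\<in>I. d t = \<phi> t (c 0))"
    using mf unfolding maximal_flow_def Let_def by blast
  then have "I \<subseteq> {t. (t, c 0) \<in> \<Omega>} \<and> (\<forall>t\<in>I. c t = \<phi> t (c 0))"
    using assms by blast
  then show ?thesis using assms(5) by force
qed

lemma flow_points: "(t, x) \<in> \<Omega> \<Longrightarrow> \<phi> t x \<in> points A"
  using flow_integral_curve[OF flow_domain_points] unfolding integral_curve_def by blast

lemma is_interval_shift: "is_interval J \<Longrightarrow> is_interval {s. s + t \<in> (J :: real set)}"
proof (unfold is_interval_1, intro ballI allI impI)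
  fix a b x
  assume J: "\<forall>a\<in>J. \<forall>b\<in>J. \<forall>x. a \<le> x \<and> x \<le> b \<longrightarrow> x \<in> J"
    and ab: "a \<in> {s. s + t \<in> J}" "b \<in> {s. s + t \<in> J}" "a \<le> x \<and> x \<le> b"
  have "x + t \<in> J" by (rule J[rule_format, of "a + t" "b + t"]) (use ab in auto)
  then show "x \<in> {s. s + t \<in> J}" by simp
qed

lemma open_shift: "open J \<Longrightarrow> open {s. s + t \<in> (J :: real set)}"
  using open_vimage[of J "\<lambda>s. s + t"] by (simp add: vimage_def continuous_intros)

text \<open>The shifted curve \<open>\<phi> (s + t) x\<close> is an integral curve in
  \<open>s\<close> that starts at \<open>\<phi> t x\<close>, so it is a piece of the flow line of
  that point.\<close>

lemma flow_split:
  assumes "(t, x) \<in> \<Omega>" "(s + t, x) \<in> \<Omega>"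
  shows "(s, \<phi> t x) \<in> \<Omega> \<and> \<phi> s (\<phi> t x) = \<phi> (s + t) x"
proof -
  note x = flow_domain_points[OF assms(1)]
  let ?J = "{s. s + t \<in> {t. (t, x) \<in> \<Omega>}}"
  show ?thesis
    using flow_unique[OF open_shift[OF flow_domain_open[OF x]]
        is_interval_shift[OF flow_domain_interval[OF x]] _
        integral_curve_shift[OF flow_integral_curve[OF x]], of t s] assms
    by simp
qed

lemma flow_inverse:
  assumes "(t, x) \<in> \<Omega>"
  shows "(- t, \<phi> t x) \<in> \<Omega>" "\<phi> (- t) (\<phi> t x) = x"
proof -
  note x = flow_domain_points[OF assms]
  have "(- t + t, x) \<in> \<Omega>" using flow_domain_zero[OF x] by simp
  from flow_split[OF assms this] show "(- t, \<phi> t x) \<in> \<Omega>" "\<phi> (- t) (\<phi> t x) = x"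
    using flow_zero[OF x] by simp_all
qed

text \<open>Obtained from \<open>flow_split\<close> based at \<open>\<phi> t x\<close> with time
  \<open>- t\<close>, which returns to \<open>x\<close>. Together the two lemmas transfer domain
  membership in both directions.\<close>

lemma flow_join:
  assumes "(t, x) \<in> \<Omega>" "(s, \<phi> t x) \<in> \<Omega>"
  shows "(s + t, x) \<in> \<Omega>"
proof -
  have "(s + t, \<phi> (- t) (\<phi> t x)) \<in> \<Omega>"
    using flow_split[OF flow_inverse(1)[OF assms(1)], of "s + t"] assms by simp
  then show ?thesis by (simp add: flow_inverse(2)[OF assms(1)])
qed

end

section \<open>Linear vector fields\<close>

text \<open>\<open>ONB\<close> is orthogonal and free of 0, hence independent; this makes the space
  an instance of the abstract finite-dimensional vector spaces.\<close>

lemma linear_inj_imp_surj_finite_dim: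
  fixes f :: "'a::finite_dim_inner \<Rightarrow> 'a"
  assumes "linear f" "inj f"
  shows "surj f"
proof -
  have "pairwise orthogonal (ONB :: 'a set)"
    by (auto simp: pairwise_def orthogonal_def inner_ONB)
  moreover have "0 \<notin> (ONB :: 'a set)" using norm_ONB by fastforce
  ultimately have "independent (ONB :: 'a set)" by (rule pairwise_orthogonal_independent)
  then interpret finite_dimensional_vector_space "scaleR :: real \<Rightarrow> 'a \<Rightarrow> 'a" ONB
    by unfold_locales (simp_all add: dependent_raw_def[symmetric] span_raw_def[symmetric])
  show ?thesis
    using linear_inj_imp_surj assms by (simp add: linear_def)
qed

text \<open>The pointwise form of \<open>associated_vector_field\<close>, with its dual derivation
  \<open>D'\<close> as a parameter, to be instantiated for the bundle and for its dual
  alike.\<close>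

locale linear_vfield = prebundle B
  for B :: "('m, 'b::finite_dim_inner, 'e, 'f::finite_dim_inner) vbundle" +
  fixes X :: "'m vfield" and D' and V :: "'e vfield"
  assumes V_tangent: "g \<in> total B \<Longrightarrow> V g \<in> tangent_space (total_atlas B) g"
    and D'_sections: "\<gamma> \<in> sections (dual_bundle B) \<Longrightarrow> D' \<gamma> \<in> sections (dual_bundle B)"
    and V_fibre_linear: "\<gamma> \<in> sections (dual_bundle B) \<Longrightarrow> g \<in> total B \<Longrightarrow>
      V g (fibre_linear B \<gamma>) = snd (D' \<gamma> (proj B g)) g"
    and V_pullback: "f \<in> smooth_functions (base B) \<Longrightarrow> g \<in> total B \<Longrightarrow>
      V g (proj_pullback B f) = X (proj B g) f"
begin

text \<open>With \<open>integral_curve_base\<close> and \<open>integral_curve_fibre\<close> as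
  converses, this reduces integral curves of \<open>V\<close> to a curve in the base and scalar
  equations, one for each section of the dual.\<close>

lemma integral_curveI:
  assumes J: "open J" and c: "\<And>s. s \<in> J \<Longrightarrow> c s \<in> total B"
    and bas: "integral_curve (base B) X J (\<lambda>s. proj B (c s))"
    and fib: "\<And>\<gamma> t. \<gamma> \<in> sections (dual_bundle B) \<Longrightarrow> t \<in> J \<Longrightarrow>
      ((\<lambda>s. snd (\<gamma> (proj B (c s))) (c s)) has_real_derivative snd (D' \<gamma> (proj B (c t))) (c t)) (at t)"
  shows "integral_curve (total_atlas B) V J c"
  unfolding integral_curve_def points_total
proof (intro conjI ballI)
  show "c ` J \<subseteq> total B" using c by blast
  fix t F assume t: "t \<in> J" and F: "F \<in> smooth_functions (total_atlas B)"
  have ev: "\<forall>\<^sub>F s in nhds t. c s \<in> total B"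
    using eventually_nhds_in_open[OF J t] by (rule eventually_mono) (rule c)
  show "((\<lambda>s. F (c s)) has_real_derivative V (c t) F) (at t)"
  proof (rule curve_velocity[OF V_tangent[OF c[OF t]] ev _ _ F])
    fix f assume f: "f \<in> smooth_functions (base B)"
    show "((\<lambda>s. f (proj B (c s))) has_real_derivative V (c t) (proj_pullback B f)) (at t)"
      using bas t f unfolding V_pullback[OF f c[OF t]] integral_curve_def by blast
  next
    fix \<gamma> assume \<gamma>: "\<gamma> \<in> sections (dual_bundle B)"
    have "\<forall>\<^sub>F s in nhds t. snd (\<gamma> (proj B (c s))) (c s) = fibre_linear B \<gamma> (c s)"
      using ev by (rule eventually_mono) (simp add: fibre_linear_def)
    then show "((\<lambda>s. fibre_linear B \<gamma> (c s)) has_real_derivative V (c t) (fibre_linear B \<gamma>)) (at t)"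
      unfolding V_fibre_linear[OF \<gamma> c[OF t]]
      by (rule DERIV_cong_ev[OF refl _ refl, THEN iffD1, OF _ fib[OF \<gamma> t]])
  qed
qed

lemma integral_curve_total:
  "integral_curve (total_atlas B) V J c \<Longrightarrow> t \<in> J \<Longrightarrow> c t \<in> total B"
  unfolding integral_curve_def points_total by blast

lemma integral_curve_base:
  assumes J: "open J" and c: "integral_curve (total_atlas B) V J c"
  shows "integral_curve (base B) X J (\<lambda>s. proj B (c s))"
  unfolding integral_curve_def
proof (intro conjI ballI)
  show "(\<lambda>s. proj B (c s)) ` J \<subseteq> points (base B)"
    using integral_curve_total[OF c] proj_points by blast
  fix t f assume t: "t \<in> J" and f: "f \<in> smooth_functions (base B)"
  note ct = integral_curve_total[OF c]
  have "\<forall>\<^sub>F s in nhds t. proj_pullback B f (c s) = f (proj B (c s))"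
    using eventually_nhds_in_open[OF J t]
    by (rule eventually_mono) (simp add: proj_pullback_def ct)
  moreover have "((\<lambda>s. proj_pullback B f (c s)) has_real_derivative V (c t) (proj_pullback B f)) (at t)"
    using c t proj_pullback_smooth[OF f] unfolding integral_curve_def by blast
  ultimately show "((\<lambda>s. f (proj B (c s))) has_real_derivative X (proj B (c t)) f) (at t)"
    unfolding V_pullback[OF f ct[OF t]] by (rule DERIV_cong_ev[OF refl _ refl, THEN iffD1])
qed

lemma integral_curve_fibre:
  assumes J: "open J" and c: "integral_curve (total_atlas B) V J c" and t: "t \<in> J"
    and \<gamma>: "\<gamma> \<in> sections (dual_bundle B)"
  shows "((\<lambda>s. snd (\<gamma> (proj B (c s))) (c s)) has_real_derivative snd (D' \<gamma> (proj B (c t))) (c t)) (at t)"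
proof -
  note ct = integral_curve_total[OF c]
  have "\<forall>\<^sub>F s in nhds t. fibre_linear B \<gamma> (c s) = snd (\<gamma> (proj B (c s))) (c s)"
    using eventually_nhds_in_open[OF J t]
    by (rule eventually_mono) (simp add: fibre_linear_def ct)
  moreover have "((\<lambda>s. fibre_linear B \<gamma> (c s)) has_real_derivative V (c t) (fibre_linear B \<gamma>)) (at t)"
    using c t fibre_linear_smooth[OF \<gamma>] unfolding integral_curve_def by blast
  ultimately show ?thesis
    unfolding V_fibre_linear[OF \<gamma> ct[OF t]] by (rule DERIV_cong_ev[OF refl _ refl, THEN iffD1])
qed

end

section \<open>The flow of a linear vector field on the total space\<close>

locale linear_flow = linear_vfield B X D' V
  for B :: "('m, 'b::finite_dim_inner, 'e, 'f::finite_dim_inner) vbundle" and X D' V +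
  fixes \<Omega> \<phi> \<Omega>B \<Phi>
  assumes base_flow: "maximal_flow (base B) X \<Omega> \<phi>"
    and total_flow: "maximal_flow (total_atlas B) V \<Omega>B \<Phi>"
begin

lemma flow_proj:
  assumes "(t, e) \<in> \<Omega>B"
  shows "(t, proj B e) \<in> \<Omega>" "proj B (\<Phi> t e) = \<phi> t (proj B e)"
proof -
  note e = flow_domain_points[OF total_flow assms]
  note J = flow_domain_open[OF total_flow e]
  have "(t, proj B (\<Phi> 0 e)) \<in> \<Omega> \<and> \<phi> t (proj B (\<Phi> 0 e)) = proj B (\<Phi> t e)"
    by (rule flow_unique[OF base_flow J flow_domain_interval[OF total_flow e] _
          integral_curve_base[OF J flow_integral_curve[OF total_flow e]]])
      (use assms flow_domain_zero[OF total_flow e] in auto)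
  then show "(t, proj B e) \<in> \<Omega>" "proj B (\<Phi> t e) = \<phi> t (proj B e)"
    by (simp_all add: flow_zero[OF total_flow e])
qed

lemma flow_fibre:
  assumes "(t, e) \<in> \<Omega>B" "e \<in> fibre B x"
  shows "(t, x) \<in> \<Omega>" "\<Phi> t e \<in> fibre B (\<phi> t x)"
  using flow_proj[OF assms(1)] flow_points[OF total_flow assms(1)] fibreD(2)[OF assms(2)]
  by (auto simp: fibre_def points_total)

lemma fibre_points_total: "e \<in> fibre B x \<Longrightarrow> e \<in> points (total_atlas B)"
  using fibreD(1) points_total by simp

text \<open>\<open>lc\<close> stands for addition or scaling, so that one argument treats both.
  \<open>op_lin\<close> describes it as seen by covectors, which is how it enters the scalar
  equations for \<open>\<gamma>\<close> and for \<open>D' \<gamma>\<close>.\<close>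

lemma flow_linear_combination:
  assumes e: "e \<in> fibre B x" "e' \<in> fibre B x" and t: "(t, e) \<in> \<Omega>B" "(t, e') \<in> \<Omega>B"
    and op_fibre: "\<And>y g h. g \<in> fibre B y \<Longrightarrow> h \<in> fibre B y \<Longrightarrow> lc g h \<in> fibre B y"
    and op_lin: "\<And>y \<epsilon> g h. \<epsilon> \<in> fibre (dual_bundle B) y \<Longrightarrow> g \<in> fibre B y \<Longrightarrow> h \<in> fibre B y \<Longrightarrow>
      snd \<epsilon> (lc g h) = a * snd \<epsilon> g + b * snd \<epsilon> h"
  shows "(t, lc e e') \<in> \<Omega>B" "\<Phi> t (lc e e') = lc (\<Phi> t e) (\<Phi> t e')"
proof -
  interpret d: prebundle "dual_bundle B" by (rule prebundle_dual)
  note p = fibre_points_total[OF e(1)] fibre_points_total[OF e(2)]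
  define J where "J = {t. (t, e) \<in> \<Omega>B} \<inter> {t. (t, e') \<in> \<Omega>B}"
  have J: "open J" "is_interval J" "0 \<in> J"
    unfolding J_def
    using flow_domain_open[OF total_flow] flow_domain_interval[OF total_flow] flow_domain_zero[OF total_flow] p
    by (auto intro: is_interval_Int)
  have f: "\<Phi> s e \<in> fibre B (\<phi> s x)" "\<Phi> s e' \<in> fibre B (\<phi> s x)" if "s \<in> J" for s
    using flow_fibre(2) e that by (auto simp: J_def)
  have lf: "lc (\<Phi> s e) (\<Phi> s e') \<in> fibre B (\<phi> s x)" if "s \<in> J" for s
    by (rule op_fibre[OF f[OF that]])
  have ic: "integral_curve (total_atlas B) V J (\<lambda>s. lc (\<Phi> s e) (\<Phi> s e'))"
  proof (rule integral_curveI[OF J(1)])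
    show "lc (\<Phi> s e) (\<Phi> s e') \<in> total B" if "s \<in> J" for s using lf[OF that] fibreD(1) by blast
    have JO: "s \<in> J \<Longrightarrow> (s, x) \<in> \<Omega>" for s using flow_fibre(1)[OF _ e(1)] by (auto simp: J_def)
    have x: "x \<in> points (base B)" by (rule fibre_points[OF e(1)])
    have "((\<lambda>s. f (proj B (lc (\<Phi> s e) (\<Phi> s e')))) has_real_derivative
        X (proj B (lc (\<Phi> t e) (\<Phi> t e'))) f) (at t)"
      if t: "t \<in> J" and f: "f \<in> smooth_functions (base B)" for t f
    proof -
      have "\<forall>\<^sub>F s in nhds t. f (\<phi> s x) = f (proj B (lc (\<Phi> s e) (\<Phi> s e')))"
        using eventually_nhds_in_open[OF J(1) t] by (rule eventually_mono) (simp add: fibreD(2)[OF lf])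
      moreover have "((\<lambda>s. f (\<phi> s x)) has_real_derivative X (\<phi> t x) f) (at t)"
        using flow_integral_curve[OF base_flow x] JO[OF t] f unfolding integral_curve_def by blast
      ultimately show ?thesis
        unfolding fibreD(2)[OF lf[OF t]] by (rule DERIV_cong_ev[OF refl _ refl, THEN iffD1])
    qed
    moreover have "proj B (lc (\<Phi> s e) (\<Phi> s e')) \<in> points (base B)" if "s \<in> J" for s
      using lf[OF that] fibreD fibre_points by metis
    ultimately show "integral_curve (base B) X J (\<lambda>s. proj B (lc (\<Phi> s e) (\<Phi> s e')))"
      unfolding integral_curve_def by blast
    fix \<gamma> t assume \<gamma>: "\<gamma> \<in> sections (dual_bundle B)" and t: "t \<in> J"
    have g: "\<gamma>' (\<phi> s x) \<in> fibre (dual_bundle B) (\<phi> s x)"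
      if "\<gamma>' \<in> sections (dual_bundle B)" "s \<in> J" for s \<gamma>'
      using d.sections_in_fibre[OF that(1)] fibre_points[OF lf[OF that(2)]] by simp
    have D: "((\<lambda>s. snd (\<gamma> (proj B (\<Phi> s e0))) (\<Phi> s e0)) has_real_derivative
        snd (D' \<gamma> (proj B (\<Phi> t e0))) (\<Phi> t e0)) (at t)" if "(t, e0) \<in> \<Omega>B" for e0
      using integral_curve_fibre[OF flow_domain_open[OF total_flow] flow_integral_curve[OF total_flow] _ \<gamma>]
        flow_domain_points[OF total_flow that] that by simp
    have e1: "\<forall>\<^sub>F s in nhds t. a * snd (\<gamma> (proj B (\<Phi> s e))) (\<Phi> s e) + b * snd (\<gamma> (proj B (\<Phi> s e'))) (\<Phi> s e') =
        snd (\<gamma> (proj B (lc (\<Phi> s e) (\<Phi> s e')))) (lc (\<Phi> s e) (\<Phi> s e'))"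
      using eventually_nhds_in_open[OF J(1) t]
      by (rule eventually_mono) (simp add: fibreD(2)[OF lf] fibreD(2)[OF f(1)] fibreD(2)[OF f(2)]
          op_lin[OF g[OF \<gamma>] f])
    have e2: "((\<lambda>s. a * snd (\<gamma> (proj B (\<Phi> s e))) (\<Phi> s e) + b * snd (\<gamma> (proj B (\<Phi> s e'))) (\<Phi> s e'))
        has_real_derivative a * snd (D' \<gamma> (proj B (\<Phi> t e))) (\<Phi> t e) +
          b * snd (D' \<gamma> (proj B (\<Phi> t e'))) (\<Phi> t e')) (at t)"
      using t by (intro DERIV_add DERIV_cmult D) (auto simp: J_def)
    have e3: "a * snd (D' \<gamma> (proj B (\<Phi> t e))) (\<Phi> t e) + b * snd (D' \<gamma> (proj B (\<Phi> t e'))) (\<Phi> t e') =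
        snd (D' \<gamma> (proj B (lc (\<Phi> t e) (\<Phi> t e')))) (lc (\<Phi> t e) (\<Phi> t e'))"
      by (simp add: fibreD(2)[OF lf[OF t]] fibreD(2)[OF f(1)[OF t]] fibreD(2)[OF f(2)[OF t]]
          op_lin[OF g[OF D'_sections[OF \<gamma>] t] f[OF t]])
    show "((\<lambda>s. snd (\<gamma> (proj B (lc (\<Phi> s e) (\<Phi> s e')))) (lc (\<Phi> s e) (\<Phi> s e')))
        has_real_derivative snd (D' \<gamma> (proj B (lc (\<Phi> t e) (\<Phi> t e')))) (lc (\<Phi> t e) (\<Phi> t e'))) (at t)"
      unfolding e3[symmetric] by (rule DERIV_cong_ev[OF refl e1 refl, THEN iffD1, OF e2])
  qed
  have "t \<in> J" using t by (simp add: J_def)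
  from flow_unique[OF total_flow J ic this]
  show "(t, lc e e') \<in> \<Omega>B" "\<Phi> t (lc e e') = lc (\<Phi> t e) (\<Phi> t e')"
    by (simp_all add: flow_zero[OF total_flow p(1)] flow_zero[OF total_flow p(2)])
qed

lemma flow_add:
  assumes "e \<in> fibre B x" "e' \<in> fibre B x" "(t, e) \<in> \<Omega>B" "(t, e') \<in> \<Omega>B"
  shows "(t, vadd B e e') \<in> \<Omega>B" "\<Phi> t (vadd B e e') = vadd B (\<Phi> t e) (\<Phi> t e')"
  by (rule flow_linear_combination[where lc = "vadd B" and a = 1 and b = 1, OF assms];
      simp add: vadd_fibre fibre_dualD(3))+

lemma flow_scale:
  assumes "e \<in> fibre B x" "(t, e) \<in> \<Omega>B"
  shows "(t, vscale B r e) \<in> \<Omega>B" "\<Phi> t (vscale B r e) = vscale B r (\<Phi> t e)"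
  \<comment> \<open>Scaling is a binary operation that ignores its second argument, with coefficient
    0.\<close>
  by (rule flow_linear_combination[where lc = "\<lambda>g _. vscale B r g" and a = r and b = 0,
        OF assms(1,1,2,2)]; simp add: vscale_fibre fibre_dualD(4))+

text \<open>The lifetimes of the finitely many elements of a basis bound those of all elements of the fibre.\<close>

lemma uniform_lifetime:
  assumes y: "y \<in> points (base B)"
  shows "\<exists>\<delta>>0. \<forall>e\<in>fibre B y. \<forall>t. \<bar>t\<bar> < \<delta> \<longrightarrow> (t, e) \<in> \<Omega>B"
proof -
  obtain W \<psi> where W: "(W, \<psi>) \<in> trivs B" "y \<in> W" using trivs_cover[OF y] by blast
  \<comment> \<open>The vector 0 is added to the index set for the base case of the span induction,
    which cannot be drawn from \<open>ONB\<close> if the rank is 0.\<close>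
  define J where "J = (\<Inter>b\<in>insert 0 ONB. {t. (t, lift B \<psi> y b) \<in> \<Omega>B})"
  have o: "open {t. (t, lift B \<psi> y b) \<in> \<Omega>B}" "(0, lift B \<psi> y b) \<in> \<Omega>B" for b
    using flow_domain_open[OF total_flow] flow_domain_zero[OF total_flow]
      fibre_points_total[OF lift_fibre[OF W]] by auto
  have "open J" unfolding J_def by (rule open_INT) (use o in auto)
  moreover have "0 \<in> J" unfolding J_def using o by blast
  ultimately obtain \<delta> where \<delta>: "\<delta> > 0" "ball 0 \<delta> \<subseteq> J" using open_contains_ball by blast
  have "(t, lift B \<psi> y w) \<in> \<Omega>B" if t: "\<bar>t\<bar> < \<delta>" for t w
  proof -
    have tJ: "t \<in> J" using \<delta>(2) t by (auto simp: dist_real_def)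
    have "w \<in> span ONB" by simp
    then show ?thesis
    proof (induction w rule: span_induct_alt)
      case base
      then show ?case using tJ by (simp add: J_def)
    next
      case (step c b w)
      have "(t, lift B \<psi> y b) \<in> \<Omega>B" using tJ step(1) by (simp add: J_def)
      from flow_add(1)[OF vscale_fibre lift_fibre[OF W] flow_scale(1)[OF lift_fibre[OF W] this] step(2)]
      show ?case using lift_fibre[OF W] by (simp add: lift_add[OF W] lift_scale[OF W])
    qed
  qed
  then have "(t, e) \<in> \<Omega>B" if "\<bar>t\<bar> < \<delta>" "e \<in> fibre B y" for t e
    using that lift_triv[OF W that(2)] by metis
  then show ?thesis using \<delta>(1) by blast
qed

text \<open>Read in trivialisations at both ends, the time \<open>t\<close> map is a linear self-map
  of the model fibre. It is injective since the flow can be reversed.\<close>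

lemma flow_surj:
  assumes t: "\<And>e. e \<in> fibre B y \<Longrightarrow> (t, e) \<in> \<Omega>B" and g: "g \<in> fibre B (\<phi> t y)" and y: "y \<in> points (base B)"
  shows "\<exists>e\<in>fibre B y. \<Phi> t e = g"
proof -
  obtain W \<psi> where W: "(W, \<psi>) \<in> trivs B" "y \<in> W" using trivs_cover[OF y] by blast
  obtain W' \<psi>' where W': "(W', \<psi>') \<in> trivs B" "\<phi> t y \<in> W'"
    using trivs_cover[OF fibre_points[OF g]] by blast
  note l = lift_fibre[OF W]
  note fl = flow_fibre(2)[OF t[OF l] l]
  let ?L = "\<lambda>w. \<psi>' (\<Phi> t (lift B \<psi> y w))"
  have "linear ?L"
    by (rule linearI)
      (simp_all add: lift_add[OF W] lift_scale[OF W] flow_add[OF l l t[OF l] t[OF l]]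
        flow_scale[OF l t[OF l]] triv_add[OF W' fl fl] triv_scale[OF W' fl])
  moreover have "inj ?L"
  proof (rule injI)
    fix v w assume "?L v = ?L w"
    then have "\<Phi> t (lift B \<psi> y v) = \<Phi> t (lift B \<psi> y w)" by (rule triv_inject[OF W' fl fl])
    then have "lift B \<psi> y v = lift B \<psi> y w" using flow_inverse(2)[OF total_flow t[OF l]] by metis
    then show "v = w" using triv_lift[OF W] by metis
  qed
  ultimately have "surj ?L" by (rule linear_inj_imp_surj_finite_dim)
  then obtain w where "\<psi>' g = ?L w" by (rule surjE)
  then have "g = \<Phi> t (lift B \<psi> y w)" by (rule triv_inject[OF W' g fl])
  then show ?thesis using l by blast
qed

text \<open>The base time interval is connected, and the set of times at which the lifted curve
  exists is open in it and contains 0. It remains to see that its complement is open too: a curve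
  that is alive at a time close to \<open>T\<close> can be continued to \<open>T\<close>.\<close>

theorem flow_complete:
  assumes t: "(t, x) \<in> \<Omega>" and e: "e \<in> fibre B x"
  shows "(t, e) \<in> \<Omega>B"
proof (rule ccontr)
  assume nt: "(t, e) \<notin> \<Omega>B"
  let ?J = "{t. (t, x) \<in> \<Omega>}" and ?I = "{t. (t, e) \<in> \<Omega>B}"
  have x: "x \<in> points (base B)" by (rule fibre_points[OF e])
  have I: "open ?I" "0 \<in> ?I" "?I \<subseteq> ?J"
    using flow_domain_open[OF total_flow] flow_domain_zero[OF total_flow] fibre_points_total[OF e]
      flow_fibre(1)[OF _ e] by auto
  have J: "open ?J" "connected ?J"
    using flow_domain_open[OF base_flow x] flow_domain_interval[OF base_flow x] is_interval_connected_1
    by auto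
  have "open (?J - ?I)"
    unfolding open_contains_ball
  proof
    fix T assume T: "T \<in> ?J - ?I"
    then have y: "\<phi> T x \<in> points (base B)" by (intro flow_points[OF base_flow]) simp
    obtain \<delta> where \<delta>: "\<delta> > 0" "\<And>e t. e \<in> fibre B (\<phi> T x) \<Longrightarrow> \<bar>t\<bar> < \<delta> \<Longrightarrow> (t, e) \<in> \<Omega>B"
      using uniform_lifetime[OF y] by blast
    have "s \<notin> ?I" if s: "\<bar>s - T\<bar> < \<delta>" "s \<in> ?J" for s
    proof
      assume sI: "s \<in> ?I"
      have "\<phi> (s - T) (\<phi> T x) = \<phi> s x"
        using flow_split[OF base_flow, of T x "s - T"] T s(2) by simp
      then have "\<Phi> s e \<in> fibre B (\<phi> (s - T) (\<phi> T x))" using flow_fibre(2)[OF _ e] sI by simp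
      \<comment> \<open>\<open>e'\<close> is the value that the curve through \<open>e\<close> ought
        to have at time \<open>T\<close>. The uniform lifetime lets the whole fibre flow for time
        \<open>s - T\<close>, surjectivity finds \<open>e'\<close>, and flowing back from
        \<open>\<Phi> s e\<close> reaches time \<open>T\<close>.\<close>
      then obtain e' where e': "e' \<in> fibre B (\<phi> T x)" "\<Phi> (s - T) e' = \<Phi> s e"
        using flow_surj[OF \<delta>(2)[OF _ s(1)] _ y] by blast
      have "(- (s - T), \<Phi> (s - T) e') \<in> \<Omega>B"
        by (rule flow_inverse(1)[OF total_flow \<delta>(2)[OF e'(1) s(1)]])
      then have "(- (s - T) + s, e) \<in> \<Omega>B"
        using flow_join[OF total_flow, of s e "- (s - T)"] sI e'(2) by simp
      then show False using T by simp
    qed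
    moreover obtain \<delta>' where "\<delta>' > 0" "ball T \<delta>' \<subseteq> ?J" using J(1) T open_contains_ball by blast
    ultimately have "ball T (min \<delta> \<delta>') \<subseteq> ?J - ?I" by (auto simp: dist_real_def subset_iff abs_minus_commute)
    then show "\<exists>d>0. ball T d \<subseteq> ?J - ?I" using \<delta>(1) \<open>\<delta>' > 0\<close> by (intro exI[of _ "min \<delta> \<delta>'"]) simp
  qed
  from connectedD[OF J(2) I(1) this] have "?I \<inter> ?J = {} \<or> (?J - ?I) \<inter> ?J = {}" by blast
  then show False using nt t I(2,3) by blast
qed

end


section \<open>The flow on the dual bundle\<close>

text \<open>This avoids inverting the matrix-valued function \<open>1 + n\<close>: since \<open>n\<close> vanishes at \<open>t0\<close>, the
  solution \<open>z\<close> of \<open>(1 + n) z = u\<close> is first seen to be bounded near \<open>t0\<close>, then continuous at \<open>t0\<close>,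
  then differentiable.\<close>

lemma DERIV_perturbed_solution:
  fixes z u :: "'i \<Rightarrow> real \<Rightarrow> real" and n :: "'i \<Rightarrow> 'i \<Rightarrow> real \<Rightarrow> real"
  assumes I: "finite I"
    and z: "\<forall>\<^sub>F t in nhds t0. \<forall>c\<in>I. z c t = u c t - (\<Sum>b\<in>I. z b t * n c b t)"
    and u: "\<And>c. c \<in> I \<Longrightarrow> (u c has_real_derivative u' c) (at t0)"
    and n: "\<And>b c. b \<in> I \<Longrightarrow> c \<in> I \<Longrightarrow> (n c b has_real_derivative n' c b) (at t0)"
    and n0: "\<And>b c. b \<in> I \<Longrightarrow> c \<in> I \<Longrightarrow> n c b t0 = 0"
    and c: "c \<in> I"
  shows "(z c has_real_derivative u' c - (\<Sum>b\<in>I. u b t0 * n' c b)) (at t0)"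
proof -
  define Z where "Z t = (\<Sum>b\<in>I. \<bar>z b t\<bar>)" for t
  define U where "U t = (\<Sum>c\<in>I. \<bar>u c t\<bar>)" for t
  define M where "M t = (\<Sum>c\<in>I. \<Sum>b\<in>I. \<bar>n c b t\<bar>)" for t
  have u_lim: "(u c \<longlongrightarrow> u c t0) (at t0)" if "c \<in> I" for c
    using DERIV_isCont[OF u[OF that]] by (simp add: isCont_def)
  have n_lim: "(n c b \<longlongrightarrow> 0) (at t0)" if "b \<in> I" "c \<in> I" for b c
    using DERIV_isCont[OF n[OF that]] n0[OF that] by (simp add: isCont_def)
  have U_lim: "(U \<longlongrightarrow> U t0) (at t0)"
    unfolding U_def by (intro tendsto_sum tendsto_rabs u_lim)
  have "(M \<longlongrightarrow> (\<Sum>c\<in>I. \<Sum>b\<in>I. \<bar>0\<bar>)) (at t0)"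
    unfolding M_def by (intro tendsto_sum tendsto_rabs n_lim)
  then have M_lim: "(M \<longlongrightarrow> 0) (at t0)" by simp
  \<comment> \<open>With the bound 1/2 the term \<open>Z t * M t\<close> can be absorbed into the
    left-hand side, which leaves \<open>Z t \<le> 2 * U t\<close>.\<close>
  have M_half: "\<forall>\<^sub>F t in at t0. M t < 1 / 2" by (rule order_tendstoD(2)[OF M_lim]) simp
  have z_at: "\<forall>\<^sub>F t in at t0. \<forall>c\<in>I. z c t = u c t - (\<Sum>b\<in>I. z b t * n c b t)"
    using z by (simp add: eventually_nhds_conv_at)
  have rest: "\<bar>\<Sum>b\<in>I. z b t * n c b t\<bar> \<le> Z t * (\<Sum>b\<in>I. \<bar>n c b t\<bar>)" for c t
  proof -
    have "\<bar>\<Sum>b\<in>I. z b t * n c b t\<bar> \<le> (\<Sum>b\<in>I. \<bar>z b t\<bar> * \<bar>n c b t\<bar>)"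
      by (rule order_trans[OF sum_abs]) (simp add: abs_mult)
    also have "\<dots> \<le> (\<Sum>b\<in>I. Z t * \<bar>n c b t\<bar>)"
      unfolding Z_def by (intro sum_mono mult_right_mono member_le_sum I) auto
    finally show ?thesis by (simp add: sum_distrib_left)
  qed
  have bound: "\<forall>\<^sub>F t in at t0. Z t \<le> 2 * U t"
    using z_at M_half
  proof eventually_elim
    case (elim t)
    have "Z t \<le> (\<Sum>c\<in>I. \<bar>u c t\<bar> + Z t * (\<Sum>b\<in>I. \<bar>n c b t\<bar>))"
      unfolding Z_def
    proof (rule sum_mono)
      fix c assume "c \<in> I"
      then have "z c t = u c t - (\<Sum>b\<in>I. z b t * n c b t)" using elim(1) by blast
      then show "\<bar>z c t\<bar> \<le> \<bar>u c t\<bar> + (\<Sum>b\<in>I. \<bar>z b t\<bar>) * (\<Sum>b\<in>I. \<bar>n c b t\<bar>)"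
        using rest[of t c] unfolding Z_def by linarith
    qed
    also have "\<dots> = U t + Z t * M t"
      by (simp add: sum.distrib U_def M_def sum_distrib_left)
    also have "\<dots> \<le> U t + Z t * (1 / 2)"
      using elim(2) by (intro add_left_mono mult_left_mono) (auto simp: Z_def sum_nonneg)
    finally show ?case by simp
  qed
  have z_cont: "isCont (z c) t0" if c: "c \<in> I" for c
  proof -
    have zt0: "z c t0 = u c t0"
      using eventually_nhds_x_imp_x[OF z] c n0 by simp
    have "((\<lambda>t. \<Sum>b\<in>I. z b t * n c b t) \<longlongrightarrow> 0) (at t0)"
    proof (rule Lim_null_comparison)
      show "\<forall>\<^sub>F t in at t0. norm (\<Sum>b\<in>I. z b t * n c b t) \<le> 2 * U t * (\<Sum>b\<in>I. \<bar>n c b t\<bar>)"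
        using bound
      proof eventually_elim
        case (elim t)
        show ?case
          using order_trans[OF rest mult_right_mono[OF elim sum_nonneg]] by simp
      qed
      have "((\<lambda>t. 2 * U t * (\<Sum>b\<in>I. \<bar>n c b t\<bar>)) \<longlongrightarrow> 2 * U t0 * (\<Sum>b\<in>I. \<bar>0\<bar>)) (at t0)"
        using c by (intro tendsto_mult tendsto_const U_lim tendsto_sum tendsto_rabs n_lim)
      then show "((\<lambda>t. 2 * U t * (\<Sum>b\<in>I. \<bar>n c b t\<bar>)) \<longlongrightarrow> 0) (at t0)" by simp
    qed
    then have "((\<lambda>t. u c t - (\<Sum>b\<in>I. z b t * n c b t)) \<longlongrightarrow> u c t0 - 0) (at t0)"
      by (rule tendsto_diff[OF u_lim[OF c]])
    moreover have "\<forall>\<^sub>F t in at t0. u c t - (\<Sum>b\<in>I. z b t * n c b t) = z c t"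
      using z_at by (rule eventually_mono) (use c in simp)
    ultimately have "(z c \<longlongrightarrow> u c t0 - 0) (at t0)" by (rule Lim_transform_eventually)
    then show ?thesis by (simp add: isCont_def zt0)
  qed
  have zu: "z b t0 = u b t0" if "b \<in> I" for b
    using eventually_nhds_x_imp_x[OF z] that n0 by simp
  \<comment> \<open>Only continuity of \<open>z\<close> is known, but \<open>n\<close> vanishes at
    \<open>t0\<close>.\<close>
  have "((\<lambda>t. n c b t * z b t) has_real_derivative n' c b * z b t0) (at t0)" if "b \<in> I" for b
    by (rule DERIV_mult_vanishing[OF n[OF that c] n0[OF that c] z_cont[OF that]])
  then have h1: "((\<lambda>t. u c t - (\<Sum>b\<in>I. n c b t * z b t)) has_real_derivative
      u' c - (\<Sum>b\<in>I. n' c b * z b t0)) (at t0)"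
    by (intro DERIV_diff u[OF c] DERIV_sum)
  have h2: "(\<Sum>b\<in>I. n' c b * z b t0) = (\<Sum>b\<in>I. u b t0 * n' c b)"
    by (rule sum.cong) (simp_all add: zu)
  have h3: "\<forall>\<^sub>F t in nhds t0. u c t - (\<Sum>b\<in>I. n c b t * z b t) = z c t"
    using z by (rule eventually_mono) (use c in \<open>simp add: mult.commute\<close>)
  show ?thesis
    using h1 unfolding h2 by (rule DERIV_cong_ev[OF refl h3 refl, THEN iffD1])
qed

section \<open>The bidual, and the derivations behind the two vector fields\<close>

context prebundle
begin

lemma linear_dual_fibre:
  assumes W: "(W, \<psi>) \<in> trivs B" "x \<in> W" and \<epsilon>: "\<epsilon> \<in> fibre (dual_bundle B) x" and g: "g \<in> fibre B x"
  shows "snd \<epsilon> g = (\<Sum>b\<in>ONB. (\<psi> g \<bullet> b) * snd \<epsilon> (lift B \<psi> x b))"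
proof -
  have "linear (\<lambda>w. snd \<epsilon> (lift B \<psi> x w))"
    by (rule linearI) (simp_all add: lift_add[OF W] lift_scale[OF W] fibre_dualD[OF \<epsilon>] lift_fibre[OF W])
  from linear_ONB[OF this, of "\<psi> g"] show ?thesis by (simp add: lift_triv[OF W g])
qed

text \<open>Evaluation at \<open>s\<close>; its twice dualised coordinate is \<open>\<psi>\<close>
  of \<open>s\<close>, hence smooth. It converts the equation of a curve in the dual, stated for
  sections of the bidual, into one for sections of \<open>B\<close>.\<close>

lemma bidual_of_section:
  assumes s: "s \<in> sections B"
  shows "\<exists>\<gamma>\<in>sections (dual_bundle (dual_bundle B)).
    \<forall>x\<in>points (base B). \<forall>\<epsilon>\<in>fibre (dual_bundle B) x. snd (\<gamma> x) \<epsilon> = snd \<epsilon> (s x)"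
proof -
  interpret d: prebundle "dual_bundle B" by (rule prebundle_dual)
  interpret dd: prebundle "dual_bundle (dual_bundle B)" by (rule d.prebundle_dual)
  define \<gamma> where "\<gamma> = (\<lambda>x\<in>points (base B). (x, \<lambda>\<epsilon>\<in>fibre (dual_bundle B) x. snd \<epsilon> (s x)))"
  have sx: "s x \<in> fibre B x" if "x \<in> points (base B)" for x by (rule sections_in_fibre[OF s that])
  have "\<gamma> \<in> sections (dual_bundle (dual_bundle B))"
  proof (rule dd.sectionsI)
    show "\<gamma> \<in> extensional (points (base (dual_bundle (dual_bundle B))))" by (simp add: \<gamma>_def)
    fix x assume "x \<in> points (base (dual_bundle (dual_bundle B)))"
    then have x: "x \<in> points (base B)" by simp
    show "\<gamma> x \<in> fibre (dual_bundle (dual_bundle B)) x"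
      unfolding fibre_dual[of _ "dual_bundle B"]
    proof (intro conjI ballI allI)
      show "x \<in> points (base (dual_bundle B))" "fst (\<gamma> x) = x"
        "snd (\<gamma> x) \<in> extensional (fibre (dual_bundle B) x)"
        using x by (simp_all add: \<gamma>_def)
      fix g assume g: "g \<in> fibre (dual_bundle B) x"
      show "snd (\<gamma> x) (vadd (dual_bundle B) g h) = snd (\<gamma> x) g + snd (\<gamma> x) h"
        if h: "h \<in> fibre (dual_bundle B) x" for h
      proof -
        have "snd (\<gamma> x) (vadd (dual_bundle B) g h) = snd (vadd (dual_bundle B) g h) (s x)"
          using d.vadd_fibre[OF g h] x by (simp add: \<gamma>_def)
        then show ?thesis using x g h sx[OF x] unfolding vadd_dual[OF g] by (simp add: \<gamma>_def)
      qed
      show "snd (\<gamma> x) (vscale (dual_bundle B) r g) = r * snd (\<gamma> x) g" for r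
      proof -
        have "snd (\<gamma> x) (vscale (dual_bundle B) r g) = snd (vscale (dual_bundle B) r g) (s x)"
          using d.vscale_fibre[OF g] x by (simp add: \<gamma>_def)
        then show ?thesis using x g sx[OF x] unfolding vscale_dual[OF g] by (simp add: \<gamma>_def)
      qed
    qed
    obtain U \<phi> W \<psi> where c: "(U, \<phi>) \<in> base B" "(W, \<psi>) \<in> trivs B" "x \<in> U" "x \<in> W"
      by (rule chart_triv_exists[OF x])
    let ?\<theta> = "dual_triv (dual_bundle B) (dual_triv B \<psi>)"
    have "\<forall>x'\<in>U \<inter> W. ?\<theta> (\<gamma> x') = \<psi> (s (inv_into U \<phi> (\<phi> x')))"
    proof
      fix x' assume x': "x' \<in> U \<inter> W"
      then have W: "x' \<in> W" and p: "x' \<in> points (base B)" using triv_points[OF c(2)] by auto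
      have i: "inv_into U \<phi> (\<phi> x') = x'" using chart_inj_on[OF smooth_base c(1)] x' by simp
      show "?\<theta> (\<gamma> x') = \<psi> (s (inv_into U \<phi> (\<phi> x')))"
        unfolding i
        by (rule d.dual_triv_unique[OF trivs_dualI[OF c(2)] W])
          (auto simp: \<gamma>_def p dual_triv_eq(1)[OF c(2) W _ sx[OF p]] inner_commute)
    qed
    moreover have "smooth_on (\<phi> ` (U \<inter> W)) (\<lambda>y. \<psi> (s (inv_into U \<phi> y)))"
      by (rule sections_smooth[OF s c(1,2)])
    moreover have "(U, \<phi>) \<in> base (dual_bundle (dual_bundle B))"
      "openin (atlas_topology (base (dual_bundle (dual_bundle B)))) (U \<inter> W)" "x \<in> U \<inter> W" "U \<inter> W \<subseteq> U \<inter> W"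
      using c openin_chart_triv[OF c(1,2)] by simp_all
    ultimately show "\<exists>U \<phi> W \<psi> S g. (U, \<phi>) \<in> base (dual_bundle (dual_bundle B)) \<and>
      (W, \<psi>) \<in> trivs (dual_bundle (dual_bundle B)) \<and>
      openin (atlas_topology (base (dual_bundle (dual_bundle B)))) S \<and> S \<subseteq> U \<inter> W \<and> x \<in> S \<and>
      smooth_on (\<phi> ` S) g \<and> (\<forall>x'\<in>S. \<psi> (\<gamma> x') = g (\<phi> x'))"
      using trivs_dualI[OF trivs_dualI[OF c(2)]]
      by (intro exI[of _ U] exI[of _ \<phi>] exI[of _ W] exI[of _ ?\<theta>] exI[of _ "U \<inter> W"]
          exI[of _ "\<lambda>y. \<psi> (s (inv_into U \<phi> y))"] conjI)
  qed
  moreover have "snd (\<gamma> x) \<epsilon> = snd \<epsilon> (s x)" if "x \<in> points (base B)" "\<epsilon> \<in> fibre (dual_bundle B) x" for x \<epsilon>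
    using that by (simp add: \<gamma>_def)
  ultimately show ?thesis by blast
qed

text \<open>A combination of the local dual frame, extended globally. Derivations act on sections,
  so a single covector has to be extended before they can be tested on it.\<close>

lemma dual_section_through:
  assumes \<epsilon>: "\<epsilon> \<in> fibre (dual_bundle B) x"
  shows "\<exists>\<gamma>\<in>sections (dual_bundle B). \<gamma> x = \<epsilon>"
proof -
  interpret d: prebundle "dual_bundle B" by (rule prebundle_dual)
  have x: "x \<in> points (base B)" using \<epsilon> by (simp add: fibre_dual)
  obtain W \<psi> N where W: "(W, \<psi>) \<in> trivs B" and N: "x \<in> N" "N \<subseteq> W"
    and sec: "\<And>w. \<exists>\<gamma>\<in>sections (dual_bundle B). \<forall>x\<in>N. \<forall>g\<in>fibre B x. snd (\<gamma> x) g = w \<bullet> \<psi> g"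
    by (rule local_frame[OF x]) blast
  obtain \<gamma> where \<gamma>: "\<gamma> \<in> sections (dual_bundle B)" "\<And>g. g \<in> fibre B x \<Longrightarrow> snd (\<gamma> x) g = dual_triv B \<psi> \<epsilon> \<bullet> \<psi> g"
    using sec N(1) by blast
  have "x \<in> W" using N by blast
  have "\<gamma> x = \<epsilon>"
    using d.sections_in_fibre[OF \<gamma>(1)] x
    by (intro fibre_dual_eqI[OF _ \<epsilon>]) (simp_all add: \<gamma>(2) dual_triv_eq(1)[OF W \<open>x \<in> W\<close> \<epsilon>])
  then show ?thesis using \<gamma>(1) by blast
qed

text \<open>Under the canonical identification of the bidual with the bundle itself, the dual of the dual
  derivation is the original one.\<close>

lemma dual_derivation_bidual:
  assumes D: "D \<in> sections B \<rightarrow> sections B" and D1: "dual_derivation B X D D1"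
    and D2: "dual_derivation (dual_bundle B) X D1 D2"
    and s: "s \<in> sections B" and \<gamma>: "\<gamma> \<in> sections (dual_bundle (dual_bundle B))"
    and \<gamma>s: "\<forall>x\<in>points (base B). \<forall>\<epsilon>\<in>fibre (dual_bundle B) x. snd (\<gamma> x) \<epsilon> = snd \<epsilon> (s x)"
    and \<epsilon>: "\<epsilon> \<in> fibre (dual_bundle B) x"
  shows "snd (D2 \<gamma> x) \<epsilon> = snd \<epsilon> (D s x)"
proof -
  interpret d: prebundle "dual_bundle B" by (rule prebundle_dual)
  have x: "x \<in> points (base B)" using \<epsilon> by (simp add: fibre_dual)
  obtain \<delta> where \<delta>: "\<delta> \<in> sections (dual_bundle B)" "\<delta> x = \<epsilon>"
    using dual_section_through[OF \<epsilon>] by blast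
  have D1\<delta>: "D1 \<delta> \<in> sections (dual_bundle B)" using D1 \<delta>(1) unfolding dual_derivation_def by blast
  have *: "pairing (dual_bundle B) \<gamma> \<delta>' = pairing B \<delta>' s" if "\<delta>' \<in> sections (dual_bundle B)" for \<delta>'
    unfolding pairing_def using \<gamma>s d.sections_in_fibre[OF that] by (auto intro!: restrict_ext)
  have "pairing (dual_bundle B) (D2 \<gamma>) \<delta> x =
      X x (pairing (dual_bundle B) \<gamma> \<delta>) - pairing (dual_bundle B) \<gamma> (D1 \<delta>) x"
    using D2 \<gamma> \<delta>(1) x unfolding dual_derivation_def base_dual by blast
  also have "\<dots> = X x (pairing B \<delta> s) - pairing B (D1 \<delta>) s x"
    by (simp add: *[OF \<delta>(1)] *[OF D1\<delta>])
  \<comment> \<open>The sign in the definition of the dual derivation occurs twice, so the two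
    derivatives along \<open>X\<close> cancel.\<close>
  also have "\<dots> = pairing B \<delta> (D s) x"
    using D1 \<delta>(1) s x unfolding dual_derivation_def by simp
  finally show ?thesis using x \<delta>(2) by (simp add: pairing_def)
qed

lemma associated_linear_vfield:
  assumes "associated_vector_field B X D V"
  shows "\<exists>D'. dual_derivation B X D D' \<and> linear_vfield B X D' V"
proof -
  note a = assms[unfolded associated_vector_field_def linear_vector_field_def vector_field_def points_total]
  have 1: "\<forall>g\<in>total B. V g \<in> tangent_space (total_atlas B) g" using a by (elim conjE)
  have 2: "\<forall>f\<in>smooth_functions (base B).
        vf_apply (total_atlas B) V (proj_pullback B f) = proj_pullback B (vf_apply (base B) X f)"
    using a by (elim conjE)
  obtain D' where D': "dual_derivation B X D D'"
    "\<forall>\<gamma>\<in>sections (dual_bundle B). vf_apply (total_atlas B) V (fibre_linear B \<gamma>) = fibre_linear B (D' \<gamma>)"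
    using a by (elim conjE exE)
  have "linear_vfield B X D' V"
  proof
    show "V g \<in> tangent_space (total_atlas B) g" if "g \<in> total B" for g using 1 that by blast
    show "D' \<gamma> \<in> sections (dual_bundle B)" if "\<gamma> \<in> sections (dual_bundle B)" for \<gamma>
      using D'(1) that unfolding dual_derivation_def by blast
    show "V g (fibre_linear B \<gamma>) = snd (D' \<gamma> (proj B g)) g"
      if "\<gamma> \<in> sections (dual_bundle B)" "g \<in> total B" for \<gamma> g
      using fun_cong[OF bspec[OF D'(2) that(1)], of g] that(2)
      by (simp add: vf_apply_def points_total fibre_linear_def)
    show "V g (proj_pullback B f) = X (proj B g) f" if "f \<in> smooth_functions (base B)" "g \<in> total B" for f g
      using fun_cong[OF bspec[OF 2 that(1)], of g] that(2) proj_points[OF that(2)]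
      by (simp add: vf_apply_def points_total proj_pullback_def)
  qed
  then show ?thesis using D'(1) by blast
qed

end


section \<open>Transport of sections and the candidate flow on the dual\<close>

text \<open>\<open>D1_dual\<close> ties the equation of curves in \<open>B\<close> to
  \<open>D\<close>, and \<open>D2_bidual\<close> does so for curves in the dual. Comparing the two
  flows means eliminating \<open>D\<close> between them.\<close>

locale dual_flow = linear_flow B X D1 V \<Omega> \<phi> \<Omega>B \<Phi>
  for B :: "('m, 'b::finite_dim_inner, 'e, 'f::finite_dim_inner) vbundle" and X D1 V \<Omega> \<phi> \<Omega>B \<Phi> +
  fixes D D2 Vs
  assumes D_sections: "s \<in> sections B \<Longrightarrow> D s \<in> sections B"
    and D1_dual: "\<gamma> \<in> sections (dual_bundle B) \<Longrightarrow> s \<in> sections B \<Longrightarrow> x \<in> points (base B) \<Longrightarrow>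
      snd (D1 \<gamma> x) (s x) = X x (pairing B \<gamma> s) - snd (\<gamma> x) (D s x)"
    and dual_vfield: "linear_vfield (dual_bundle B) X D2 Vs"
    and D2_bidual: "s \<in> sections B \<Longrightarrow> \<delta> \<in> sections (dual_bundle (dual_bundle B)) \<Longrightarrow>
      \<forall>x\<in>points (base B). \<forall>\<epsilon>\<in>fibre (dual_bundle B) x. snd (\<delta> x) \<epsilon> = snd \<epsilon> (s x) \<Longrightarrow>
      \<epsilon> \<in> fibre (dual_bundle B) x \<Longrightarrow> snd (D2 \<delta> x) \<epsilon> = snd \<epsilon> (D s x)"
begin

text \<open>Gives meaning to precomposition with the flow at time \<open>- t\<close>: by
  \<open>flow_complete\<close> it is defined on the whole fibre over
  \<open>\<phi> t x\<close>.\<close>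

lemma flow_inverse_fibre:
  assumes t: "(t, x) \<in> \<Omega>" and e: "e \<in> fibre B (\<phi> t x)"
  shows "(- t, e) \<in> \<Omega>B" "\<Phi> (- t) e \<in> fibre B x" "\<Phi> t (\<Phi> (- t) e) = e"
proof -
  show 1: "(- t, e) \<in> \<Omega>B" by (rule flow_complete[OF flow_inverse(1)[OF base_flow t] e])
  show "\<Phi> (- t) e \<in> fibre B x" using flow_fibre(2)[OF 1 e] flow_inverse(2)[OF base_flow t] by simp
  show "\<Phi> t (\<Phi> (- t) e) = e" using flow_inverse(2)[OF total_flow 1] by simp
qed

lemma base_flow_derivative:
  assumes "(t, x) \<in> \<Omega>" "f \<in> smooth_functions (base B)"
  shows "((\<lambda>s. f (\<phi> s x)) has_real_derivative X (\<phi> t x) f) (at t)"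
  using flow_integral_curve[OF base_flow flow_domain_points[OF base_flow assms(1)]] assms
  unfolding integral_curve_def by blast

lemma eventually_domain:
  assumes "(t, x) \<in> \<Omega>"
  shows "\<forall>\<^sub>F s in nhds t. (s, x) \<in> \<Omega>"
  using eventually_nhds_in_open[OF flow_domain_open[OF base_flow flow_domain_points[OF base_flow assms]]] assms
  by simp

lemma eventually_flow_mem:
  assumes t: "(t, x) \<in> \<Omega>" and N: "openin (atlas_topology (base B)) N" "\<phi> t x \<in> N"
  shows "\<forall>\<^sub>F s in nhds t. \<phi> s x \<in> N"
proof (rule eventually_curve_mem[where c = "\<lambda>s. \<phi> s x", OF manifold_base N])
  show "\<forall>\<^sub>F s in nhds t. \<phi> s x \<in> points (base B)"
    using eventually_domain[OF t] by (rule eventually_mono) (rule flow_points[OF base_flow])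
  show "isCont (\<lambda>s. f (\<phi> s x)) t" if "f \<in> smooth_functions (base B)" for f
    by (rule DERIV_isCont[OF base_flow_derivative[OF t that]])
qed

text \<open>\<open>X x f\<close> is the derivative of \<open>f\<close> along the flow line of
  \<open>x\<close>, which stays in \<open>N\<close> for small times.\<close>

lemma X_locally_constant:
  assumes x: "x \<in> points (base B)" and f: "f \<in> smooth_functions (base B)"
    and N: "openin (atlas_topology (base B)) N" "x \<in> N" "\<And>y. y \<in> N \<Longrightarrow> f y = a"
  shows "X x f = 0"
proof -
  note z = flow_domain_zero[OF base_flow x] and z' = flow_zero[OF base_flow x]
  have "\<forall>\<^sub>F s in nhds 0. f (\<phi> s x) = a"
    using eventually_flow_mem[OF z N(1)] N(2) z' by (auto elim: eventually_mono simp: N(3))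
  then have "((\<lambda>s. f (\<phi> s x)) has_real_derivative 0) (at 0)"
    by (rule DERIV_cong_ev[OF refl _ refl, THEN iffD2]) (rule DERIV_const)
  from DERIV_unique[OF base_flow_derivative[OF z f] this] show ?thesis by (simp add: z')
qed

text \<open>The flow transports the section \<open>s\<close> along the base flow, and \<open>D\<close> is its Lie derivative.\<close>

lemma transported_section_derivative:
  assumes t0: "(t0, x) \<in> \<Omega>" and s: "s \<in> sections B" and \<epsilon>: "\<epsilon> \<in> fibre (dual_bundle B) x"
  shows "((\<lambda>t. snd \<epsilon> (\<Phi> (- t) (s (\<phi> t x)))) has_real_derivative
    snd \<epsilon> (\<Phi> (- t0) (D s (\<phi> t0 x)))) (at t0)"
proof -
  interpret d: prebundle "dual_bundle B" by (rule prebundle_dual)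
  let ?y = "\<phi> t0 x"
  have y: "?y \<in> points (base B)" by (rule flow_points[OF base_flow t0])
  have x: "x \<in> points (base B)" by (rule flow_domain_points[OF base_flow t0])
  have split: "(t - t0, ?y) \<in> \<Omega>" "\<phi> (t - t0) ?y = \<phi> t x" if "(t, x) \<in> \<Omega>" for t
    using flow_split[OF base_flow t0, of "t - t0"] that by simp_all
  obtain W \<psi> N where W: "(W, \<psi>) \<in> trivs B" and N: "?y \<in> N" "N \<subseteq> W"
    and sec: "\<And>w. \<exists>\<gamma>\<in>sections (dual_bundle B). \<forall>x\<in>N. \<forall>g\<in>fibre B x. snd (\<gamma> x) g = w \<bullet> \<psi> g"
    by (rule local_frame[OF y]) blast
  have yW: "?y \<in> W" using N by blast
  note l = lift_fibre[OF W yW]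
  have "\<forall>c. \<exists>\<gamma>. \<gamma> \<in> sections (dual_bundle B) \<and> (\<forall>g\<in>fibre B ?y. snd (\<gamma> ?y) g = c \<bullet> \<psi> g)"
    using sec N(1) by blast
  then obtain \<gamma> where \<gamma>: "\<And>c. \<gamma> c \<in> sections (dual_bundle B)"
    "\<And>c g. g \<in> fibre B ?y \<Longrightarrow> snd (\<gamma> c ?y) g = c \<bullet> \<psi> g"
    unfolding choice_iff by blast
  have \<gamma>f: "\<gamma> c p \<in> fibre (dual_bundle B) p" "D1 (\<gamma> c) p \<in> fibre (dual_bundle B) p"
    if "p \<in> points (base B)" for c p
    using d.sections_in_fibre[OF \<gamma>(1)] d.sections_in_fibre[OF D'_sections[OF \<gamma>(1)]] that by simp_all
  have sf: "s p \<in> fibre B p" "D s p \<in> fibre B p" if "p \<in> points (base B)" for p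
    using sections_in_fibre[OF s that] sections_in_fibre[OF D_sections[OF s] that] by simp_all
  \<comment> \<open>\<open>g t\<close> is the section value carried back to the fixed fibre over
    \<open>\<phi> t0 x\<close>, and \<open>z\<close> are its coordinates. \<open>u\<close> pairs the
    moving section with the dual frame \<open>\<gamma>\<close>; \<open>n\<close> is the matrix of
    the flow for time \<open>t - t0\<close> minus the identity. Pairing
    \<open>\<Phi> (t - t0) (g t) = s (\<phi> t x)\<close> with the frame gives a system for
    \<open>z\<close> in which \<open>u\<close> and \<open>n\<close> have known derivatives.\<close>
  define g where "g t = \<Phi> (t0 - t) (s (\<phi> t x))" for t
  define z where "z c t = \<psi> (g t) \<bullet> c" for c t
  define u where "u c t = snd (\<gamma> c (\<phi> t x)) (s (\<phi> t x))" for c t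
  define n where "n c b t = snd (\<gamma> c (\<phi> t x)) (\<Phi> (t - t0) (lift B \<psi> ?y b)) - b \<bullet> c" for c b t
  have g: "g t \<in> fibre B ?y" "\<Phi> (t - t0) (g t) = s (\<phi> t x)" "\<Phi> (- t0) (g t) = \<Phi> (- t) (s (\<phi> t x))"
    if t: "(t, x) \<in> \<Omega>" for t
  proof -
    have st: "s (\<phi> t x) \<in> fibre B (\<phi> (t - t0) ?y)" using sf(1)[OF flow_points[OF base_flow t]] split(2)[OF t] by simp
    note inv = flow_inverse_fibre[OF split(1)[OF t] st]
    show "g t \<in> fibre B ?y" "\<Phi> (t - t0) (g t) = s (\<phi> t x)" using inv(2,3) by (simp_all add: g_def)
    have "(- t, s (\<phi> t x)) \<in> \<Omega>B"
      by (rule flow_inverse_fibre(1)[OF t sf(1)[OF flow_points[OF base_flow t]]])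
    then show "\<Phi> (- t0) (g t) = \<Phi> (- t) (s (\<phi> t x))"
      using flow_split[OF total_flow inv(1), of "- t0"] by (simp add: g_def)
  qed
  have ev: "\<forall>\<^sub>F t in nhds t0. \<forall>c\<in>ONB. z c t = u c t - (\<Sum>b\<in>ONB. z b t * n c b t)"
    using eventually_domain[OF t0]
  proof eventually_elim
    case (elim t)
    show ?case
    proof
      fix c :: 'f
      have p: "\<phi> t x \<in> points (base B)" by (rule flow_points[OF base_flow elim])
      have dom: "(t - t0, e) \<in> \<Omega>B" if "e \<in> fibre B ?y" for e by (rule flow_complete[OF split(1)[OF elim] that])
      have fib: "\<Phi> (t - t0) e \<in> fibre B (\<phi> t x)" if "e \<in> fibre B ?y" for e
        using flow_fibre(2)[OF dom[OF that] that] split(2)[OF elim] by simp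
      have "linear (\<lambda>w. snd (\<gamma> c (\<phi> t x)) (\<Phi> (t - t0) (lift B \<psi> ?y w)))"
        by (rule linearI)
          (simp_all add: lift_add[OF W yW] lift_scale[OF W yW] flow_add[OF l l dom[OF l] dom[OF l]]
            flow_scale[OF l dom[OF l]] fibre_dualD(3)[OF \<gamma>f(1)[OF p] fib[OF l] fib[OF l]]
            fibre_dualD(4)[OF \<gamma>f(1)[OF p] fib[OF l]])
      from linear_ONB[OF this, of "\<psi> (g t)"]
      have "u c t = (\<Sum>b\<in>ONB. z b t * (n c b t + b \<bullet> c))"
        by (simp add: lift_triv[OF W yW g(1)[OF elim]] g(2)[OF elim] u_def z_def n_def)
      also have "\<dots> = (\<Sum>b\<in>ONB. z b t * n c b t) + (\<Sum>b\<in>ONB. (\<psi> (g t) \<bullet> b) *\<^sub>R b) \<bullet> c"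
        by (simp add: distrib_left sum.distrib inner_sum_left z_def)
      also have "(\<Sum>b\<in>ONB. (\<psi> (g t) \<bullet> b) *\<^sub>R b) = \<psi> (g t)" by (rule ONB_expansion)
      finally show "z c t = u c t - (\<Sum>b\<in>ONB. z b t * n c b t)" by (simp add: z_def)
    qed
  qed
  have u': "(u c has_real_derivative X ?y (pairing B (\<gamma> c) s)) (at t0)" for c
  proof -
    have e: "\<forall>\<^sub>F t in nhds t0. pairing B (\<gamma> c) s (\<phi> t x) = u c t"
      using eventually_domain[OF t0]
      by (rule eventually_mono) (simp add: pairing_def u_def flow_points[OF base_flow])
    show ?thesis
      by (rule DERIV_cong_ev[OF refl e refl, THEN iffD1, OF base_flow_derivative[OF t0 pairing_smooth[OF \<gamma>(1) s]]])
  qed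
  have n': "(n c b has_real_derivative snd (D1 (\<gamma> c) ?y) (lift B \<psi> ?y b)) (at t0)" for b c
  proof -
    let ?e = "lift B \<psi> ?y b"
    have pe: "?e \<in> points (total_atlas B)" by (rule fibre_points_total[OF l])
    have "((\<lambda>t. snd (\<gamma> c (proj B (\<Phi> t ?e))) (\<Phi> t ?e)) has_real_derivative
        snd (D1 (\<gamma> c) (proj B (\<Phi> 0 ?e))) (\<Phi> 0 ?e)) (at 0)"
      by (rule integral_curve_fibre[OF flow_domain_open[OF total_flow pe] flow_integral_curve[OF total_flow pe] _ \<gamma>(1)])
        (simp add: flow_domain_zero[OF total_flow pe])
    then have "((\<lambda>t. snd (\<gamma> c (proj B (\<Phi> t ?e))) (\<Phi> t ?e)) has_real_derivative
        snd (D1 (\<gamma> c) ?y) ?e) (at (t0 + - t0))"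
      by (simp add: flow_zero[OF total_flow pe] fibreD(2)[OF l])
    from DERIV_diff[OF this[unfolded DERIV_shift] DERIV_const]
    have D: "((\<lambda>t. snd (\<gamma> c (proj B (\<Phi> (t + - t0) ?e))) (\<Phi> (t + - t0) ?e) - b \<bullet> c) has_real_derivative
        snd (D1 (\<gamma> c) ?y) ?e) (at t0)" by simp
    have e: "\<forall>\<^sub>F t in nhds t0. snd (\<gamma> c (proj B (\<Phi> (t + - t0) ?e))) (\<Phi> (t + - t0) ?e) - b \<bullet> c = n c b t"
      using eventually_domain[OF t0]
    proof eventually_elim
      case (elim t)
      have "proj B (\<Phi> (t - t0) ?e) = \<phi> t x"
        using flow_proj(2)[OF flow_complete[OF split(1)[OF elim] l]] split(2)[OF elim] fibreD(2)[OF l] by simp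
      then show ?case by (simp add: n_def)
    qed
    show ?thesis by (rule DERIV_cong_ev[OF refl e refl, THEN iffD1, OF D])
  qed
  have n0: "n c b t0 = 0" for b c
    using \<gamma>(2)[OF l] by (simp add: n_def flow_zero[OF total_flow fibre_points_total[OF l]] triv_lift[OF W yW] inner_commute)
  have z': "(z c has_real_derivative \<psi> (D s ?y) \<bullet> c) (at t0)" if "c \<in> ONB" for c
  proof -
    \<comment> \<open>At \<open>t0\<close> the numbers \<open>u b t0\<close> are the coordinates of
      \<open>s\<close>, so the correction term is \<open>D1 (\<gamma> c)\<close> evaluated on
      \<open>s\<close>. Duality of \<open>D\<close> and \<open>D1\<close> then turns the derivative
      of \<open>z c\<close> into a coordinate of \<open>D s\<close>.\<close>
    have "(\<Sum>b\<in>ONB. u b t0 * snd (D1 (\<gamma> c) ?y) (lift B \<psi> ?y b)) = snd (D1 (\<gamma> c) ?y) (s ?y)"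
      unfolding linear_dual_fibre[OF W yW \<gamma>f(2)[OF y] sf(1)[OF y]]
      by (simp add: u_def \<gamma>(2)[OF sf(1)[OF y]] inner_commute)
    moreover have "X ?y (pairing B (\<gamma> c) s) - snd (D1 (\<gamma> c) ?y) (s ?y) = \<psi> (D s ?y) \<bullet> c"
      using D1_dual[OF \<gamma>(1) s y, of c] \<gamma>(2)[OF sf(2)[OF y]] by (simp add: inner_commute)
    ultimately show ?thesis
      using DERIV_perturbed_solution[OF finite_ONB ev u' n' n0 that] by simp
  qed
  \<comment> \<open>The remaining transport over the fixed time \<open>- t0\<close>, followed by
    \<open>\<epsilon>\<close>, is a fixed linear form on coordinates and passes through the
    derivative.\<close>
  let ?k = "\<lambda>w. snd \<epsilon> (\<Phi> (- t0) (lift B \<psi> ?y w))"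
  note inv0 = flow_inverse_fibre[OF t0 l]
  have "linear ?k"
    by (rule linearI)
      (simp_all add: lift_add[OF W yW] lift_scale[OF W yW] flow_add[OF l l inv0(1) inv0(1)]
        flow_scale[OF l inv0(1)] fibre_dualD(3)[OF \<epsilon> inv0(2) inv0(2)] fibre_dualD(4)[OF \<epsilon> inv0(2)])
  note k = linear_ONB[OF this]
  have "((\<lambda>t. \<Sum>c\<in>ONB. z c t * ?k c) has_real_derivative (\<Sum>c\<in>ONB. (\<psi> (D s ?y) \<bullet> c) * ?k c)) (at t0)"
    by (intro DERIV_sum DERIV_cmult_right z')
  moreover have "(\<Sum>c\<in>ONB. (\<psi> (D s ?y) \<bullet> c) * ?k c) = snd \<epsilon> (\<Phi> (- t0) (D s ?y))"
    using k[of "\<psi> (D s ?y)"] by (simp add: lift_triv[OF W yW sf(2)[OF y]])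
  ultimately have D: "((\<lambda>t. \<Sum>c\<in>ONB. z c t * ?k c) has_real_derivative snd \<epsilon> (\<Phi> (- t0) (D s ?y))) (at t0)"
    by (simp only:)
  have e: "\<forall>\<^sub>F t in nhds t0. (\<Sum>c\<in>ONB. z c t * ?k c) = snd \<epsilon> (\<Phi> (- t) (s (\<phi> t x)))"
    using eventually_domain[OF t0]
  proof eventually_elim
    case (elim t)
    show ?case using k[of "\<psi> (g t)"] by (simp add: z_def lift_triv[OF W yW g(1)[OF elim]] g(3)[OF elim])
  qed
  show ?thesis by (rule DERIV_cong_ev[OF refl e refl, THEN iffD1, OF D])
qed

text \<open>The argument order makes \<open>dual_curve \<epsilon>\<close> a curve. The form is cut
  down to the fibre since elements of the dual bundle carry extensional forms.\<close>

definition dual_curve :: "'m \<times> ('e \<Rightarrow> real) \<Rightarrow> real \<Rightarrow> 'm \<times> ('e \<Rightarrow> real)" where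
  "dual_curve \<epsilon> t = (\<phi> t (fst \<epsilon>), \<lambda>e\<in>fibre B (\<phi> t (fst \<epsilon>)). snd \<epsilon> (\<Phi> (- t) e))"

lemma dual_curve_fibre:
  assumes t: "(t, x) \<in> \<Omega>" and \<epsilon>: "\<epsilon> \<in> fibre (dual_bundle B) x"
  shows "dual_curve \<epsilon> t \<in> fibre (dual_bundle B) (\<phi> t x)"
proof -
  have x: "fst \<epsilon> = x" by (rule fibre_dualD(1)[OF \<epsilon>])
  show ?thesis
    unfolding fibre_dual dual_curve_def x
    using flow_inverse_fibre[OF t]
    by (auto simp: flow_points[OF base_flow t] vadd_fibre vscale_fibre flow_add flow_scale
        fibre_dualD(3,4)[OF \<epsilon>])
qed

text \<open>A test section of the bidual is evaluation at some section \<open>s\<close> of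
  \<open>B\<close>. Along the curve it takes the value of \<open>\<epsilon>\<close> on the
  transported section, so \<open>transported_section_derivative\<close> is exactly the scalar
  equation required.\<close>

lemma dual_curve_integral:
  assumes \<epsilon>: "\<epsilon> \<in> fibre (dual_bundle B) x"
  shows "integral_curve (total_atlas (dual_bundle B)) Vs {t. (t, x) \<in> \<Omega>} (dual_curve \<epsilon>)"
proof -
  interpret d: linear_vfield "dual_bundle B" X D2 Vs by (rule dual_vfield)
  have x: "fst \<epsilon> = x" "x \<in> points (base B)" using \<epsilon> by (simp_all add: fibre_dual)
  have c: "fst (dual_curve \<epsilon> t) = \<phi> t x" for t by (simp add: dual_curve_def x(1))
  show ?thesis
  proof (rule d.integral_curveI[OF flow_domain_open[OF base_flow x(2)]])
    show "dual_curve \<epsilon> t \<in> total (dual_bundle B)" if "t \<in> {t. (t, x) \<in> \<Omega>}" for t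
      using dual_curve_fibre[OF _ \<epsilon>] that d.fibreD(1) by blast
    show "integral_curve (base (dual_bundle B)) X {t. (t, x) \<in> \<Omega>} (\<lambda>t. proj (dual_bundle B) (dual_curve \<epsilon> t))"
      using flow_integral_curve[OF base_flow x(2)] by (simp add: c)
    fix \<gamma> t0 assume \<gamma>: "\<gamma> \<in> sections (dual_bundle (dual_bundle B))" and "t0 \<in> {t. (t, x) \<in> \<Omega>}"
    then have t0: "(t0, x) \<in> \<Omega>" by simp
    obtain s where s: "s \<in> sections B"
      "\<forall>x\<in>points (base B). \<forall>\<epsilon>\<in>fibre (dual_bundle B) x. snd (\<gamma> x) \<epsilon> = snd \<epsilon> (s x)"
      using section_of_bidual[OF \<gamma>] by blast
    have eval: "snd (dual_curve \<epsilon> t) (s' (\<phi> t x)) = snd \<epsilon> (\<Phi> (- t) (s' (\<phi> t x)))"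
      if "s' \<in> sections B" "(t, x) \<in> \<Omega>" for s' t
      using sections_in_fibre[OF that(1) flow_points[OF base_flow that(2)]] by (simp add: dual_curve_def x(1))
    have e: "\<forall>\<^sub>F t in nhds t0. snd \<epsilon> (\<Phi> (- t) (s (\<phi> t x))) =
        snd (\<gamma> (proj (dual_bundle B) (dual_curve \<epsilon> t))) (dual_curve \<epsilon> t)"
      using eventually_domain[OF t0]
    proof eventually_elim
      case (elim t)
      show ?case
        using s(2)[rule_format, OF flow_points[OF base_flow elim] dual_curve_fibre[OF elim \<epsilon>]]
        by (simp add: c eval[OF s(1) elim])
    qed
    have v: "snd \<epsilon> (\<Phi> (- t0) (D s (\<phi> t0 x))) =
        snd (D2 \<gamma> (proj (dual_bundle B) (dual_curve \<epsilon> t0))) (dual_curve \<epsilon> t0)"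
      using D2_bidual[OF s(1) \<gamma> s(2) dual_curve_fibre[OF t0 \<epsilon>]]
      by (simp add: c eval[OF D_sections[OF s(1)] t0])
    show "((\<lambda>t. snd (\<gamma> (proj (dual_bundle B) (dual_curve \<epsilon> t))) (dual_curve \<epsilon> t)) has_real_derivative
        snd (D2 \<gamma> (proj (dual_bundle B) (dual_curve \<epsilon> t0))) (dual_curve \<epsilon> t0)) (at t0)"
      unfolding v[symmetric]
      by (rule DERIV_cong_ev[OF refl e refl, THEN iffD1, OF transported_section_derivative[OF t0 s(1) \<epsilon>]])
  qed
qed

end


section \<open>Uniqueness of integral curves in the dual bundle\<close>

context dual_flow
begin

text \<open>In a local frame and its dual frame the pairing is a sum of products of coordinates, one
  factor from each curve. Its derivative vanishes because \<open>D\<close> on the frame and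
  \<open>D1\<close> on the dual frame are given by matrices that are negative transposes of each
  other.\<close>

lemma dual_integral_curve_pairing:
  assumes I: "open I" "is_interval I" "0 \<in> I"
    and c: "integral_curve (total_atlas (dual_bundle B)) Vs I c"
    and c0: "c 0 \<in> fibre (dual_bundle B) x" and t: "t \<in> I" and e: "e \<in> fibre B x"
  shows "(t, x) \<in> \<Omega>" "c t \<in> fibre (dual_bundle B) (\<phi> t x)" "snd (c t) (\<Phi> t e) = snd (c 0) e"
proof -
  interpret d: linear_vfield "dual_bundle B" X D2 Vs by (rule dual_vfield)
  have x: "fst (c 0) = x" "x \<in> points (base B)" using c0 by (simp_all add: fibre_dual)
  have base: "(t, x) \<in> \<Omega>" "c t \<in> fibre (dual_bundle B) (\<phi> t x)" if "t \<in> I" for t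
  proof -
    have "(t, proj (dual_bundle B) (c 0)) \<in> \<Omega> \<and> \<phi> t (proj (dual_bundle B) (c 0)) = proj (dual_bundle B) (c t)"
      using flow_unique[OF base_flow I _ that] d.integral_curve_base[OF I(1) c] by simp
    then show "(t, x) \<in> \<Omega>" "c t \<in> fibre (dual_bundle B) (\<phi> t x)"
      using d.fibreI[OF d.integral_curve_total[OF c that]] x(1) by simp_all
  qed
  then show "(t, x) \<in> \<Omega>" "c t \<in> fibre (dual_bundle B) (\<phi> t x)" using t by blast+
  have evI: "\<forall>\<^sub>F t in nhds t0. t \<in> I" if "t0 \<in> I" for t0 by (rule eventually_nhds_in_open[OF I(1) that])
  have pr: "fst (c t) = \<phi> t x" if "t \<in> I" for t by (rule fibre_dualD(1)[OF base(2)[OF that]])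
  have dom: "(t, e) \<in> \<Omega>B" "\<Phi> t e \<in> fibre B (\<phi> t x)" "proj B (\<Phi> t e) = \<phi> t x" if "t \<in> I" for t
  proof -
    show "(t, e) \<in> \<Omega>B" by (rule flow_complete[OF base(1)[OF that] e])
    from flow_fibre(2)[OF this e] show "\<Phi> t e \<in> fibre B (\<phi> t x)" "proj B (\<Phi> t e) = \<phi> t x"
      using fibreD(2) by blast+
  qed
  have "((\<lambda>t. snd (c t) (\<Phi> t e)) has_real_derivative 0) (at t0)" if t0: "t0 \<in> I" for t0
  proof -
    let ?y = "\<phi> t0 x"
    note t0\<Omega> = base(1)[OF t0]
    have y: "?y \<in> points (base B)" by (rule flow_points[OF base_flow t0\<Omega>])
    obtain W \<psi> N where W: "(W, \<psi>) \<in> trivs B"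
      and N: "openin (atlas_topology (base B)) N" "?y \<in> N" "N \<subseteq> W"
      and ext_s: "\<And>w. \<exists>s\<in>sections B. \<forall>x\<in>N. s x = lift B \<psi> x w"
      and ext_\<gamma>: "\<And>w. \<exists>\<gamma>\<in>sections (dual_bundle B). \<forall>x\<in>N. \<forall>g\<in>fibre B x. snd (\<gamma> x) g = w \<bullet> \<psi> g"
      by (rule local_frame[OF y]) blast
    have NW: "p \<in> W" if "p \<in> N" for p using N(3) that by blast
    have "\<forall>b. \<exists>s. s \<in> sections B \<and> (\<forall>x\<in>N. s x = lift B \<psi> x b)" using ext_s by blast
    then obtain s where s: "\<And>b. s b \<in> sections B" "\<And>b x. x \<in> N \<Longrightarrow> s b x = lift B \<psi> x b"
      unfolding choice_iff by blast
    have "\<forall>b. \<exists>\<gamma>. \<gamma> \<in> sections (dual_bundle B) \<and> (\<forall>x\<in>N. \<forall>g\<in>fibre B x. snd (\<gamma> x) g = b \<bullet> \<psi> g)"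
      using ext_\<gamma> by blast
    then obtain \<gamma> where \<gamma>: "\<And>b. \<gamma> b \<in> sections (dual_bundle B)"
      "\<And>b x g. x \<in> N \<Longrightarrow> g \<in> fibre B x \<Longrightarrow> snd (\<gamma> b x) g = b \<bullet> \<psi> g"
      unfolding choice_iff by blast
    \<comment> \<open>\<open>p\<close> are the coordinates of \<open>c t\<close> with respect to the
      dual frame, obtained by evaluating on \<open>s b\<close>; \<open>q\<close> are those of
      \<open>\<Phi> t e\<close> with respect to the frame. Each has a derivative from the equation
      of its own curve.\<close>
    define p where "p b t = snd (c t) (s b (\<phi> t x))" for b t
    define q where "q b t = snd (\<gamma> b (\<phi> t x)) (\<Phi> t e)" for b t
    have p': "(p b has_real_derivative snd (c t0) (D (s b) ?y)) (at t0)" for b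
    proof -
      obtain \<delta> where \<delta>: "\<delta> \<in> sections (dual_bundle (dual_bundle B))"
        "\<forall>x\<in>points (base B). \<forall>\<epsilon>\<in>fibre (dual_bundle B) x. snd (\<delta> x) \<epsilon> = snd \<epsilon> (s b x)"
        using bidual_of_section[OF s(1)] by blast
      have v: "snd (D2 \<delta> (proj (dual_bundle B) (c t0))) (c t0) = snd (c t0) (D (s b) ?y)"
        using D2_bidual[OF s(1) \<delta> base(2)[OF t0]] by (simp add: pr[OF t0])
      have ev: "\<forall>\<^sub>F t in nhds t0. snd (\<delta> (proj (dual_bundle B) (c t))) (c t) = p b t"
        using evI[OF t0]
      proof eventually_elim
        case (elim t)
        show ?case
          using \<delta>(2)[rule_format, OF flow_points[OF base_flow base(1)[OF elim]] base(2)[OF elim]]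
          by (simp add: p_def pr[OF elim])
      qed
      show ?thesis
        using d.integral_curve_fibre[OF I(1) c t0 \<delta>(1)]
        unfolding v by (rule DERIV_cong_ev[OF refl ev refl, THEN iffD1])
    qed
    have q': "(q b has_real_derivative snd (D1 (\<gamma> b) ?y) (\<Phi> t0 e)) (at t0)" for b
    proof -
      have pe: "e \<in> points (total_atlas B)" by (rule fibre_points_total[OF e])
      have "((\<lambda>t. snd (\<gamma> b (proj B (\<Phi> t e))) (\<Phi> t e)) has_real_derivative
          snd (D1 (\<gamma> b) (proj B (\<Phi> t0 e))) (\<Phi> t0 e)) (at t0)"
        by (rule integral_curve_fibre[OF flow_domain_open[OF total_flow pe] flow_integral_curve[OF total_flow pe] _ \<gamma>(1)])
          (simp add: dom(1)[OF t0])
      moreover have ev: "\<forall>\<^sub>F t in nhds t0. snd (\<gamma> b (proj B (\<Phi> t e))) (\<Phi> t e) = q b t"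
        using evI[OF t0] by (rule eventually_mono) (simp add: q_def dom(3))
      ultimately show ?thesis
        unfolding dom(3)[OF t0] by (rule DERIV_cong_ev[OF refl _ refl, THEN iffD1, rotated])
    qed
    let ?h = "\<Phi> t0 e" and ?\<eta> = "snd (c t0)"
    note h = dom(2)[OF t0] and \<eta> = base(2)[OF t0]
    have Ds: "D (s b) ?y \<in> fibre B ?y" for b by (rule sections_in_fibre[OF D_sections[OF s(1)] y])
    \<comment> \<open>The pairing of \<open>\<gamma> b\<close> with \<open>s j\<close> is constant
      near the point, so its derivative along \<open>X\<close> vanishes and duality leaves only the
      sign.\<close>
    have D1\<gamma>: "snd (D1 (\<gamma> b) ?y) ?h = - (\<Sum>j\<in>ONB. (\<psi> ?h \<bullet> j) * (b \<bullet> \<psi> (D (s j) ?y)))" for b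
    proof -
      have "snd (D1 (\<gamma> b) ?y) (lift B \<psi> ?y j) = - (b \<bullet> \<psi> (D (s j) ?y))" for j
      proof -
        have "pairing B (\<gamma> b) (s j) p = b \<bullet> j" if "p \<in> N" for p
          using triv_points[OF W NW[OF that]]
          by (simp add: pairing_def s(2)[OF that] \<gamma>(2)[OF that lift_fibre[OF W NW[OF that]]] triv_lift[OF W NW[OF that]])
        then have "X ?y (pairing B (\<gamma> b) (s j)) = 0"
          by (rule X_locally_constant[OF y pairing_smooth[OF \<gamma>(1) s(1)] N(1,2)])
        then show ?thesis
          using D1_dual[OF \<gamma>(1) s(1) y, of b j] \<gamma>(2)[OF N(2) Ds] by (simp add: s(2)[OF N(2)])
      qed
      moreover have "D1 (\<gamma> b) ?y \<in> fibre (dual_bundle B) ?y"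
        using d.sections_in_fibre[OF D'_sections[OF \<gamma>(1)]] y by simp
      ultimately show ?thesis
        using linear_dual_fibre[OF W NW[OF N(2)] _ h] by (simp add: sum_negf)
    qed
    have ps: "p b t0 = ?\<eta> (lift B \<psi> ?y b)" "q b t0 = b \<bullet> \<psi> ?h" for b
      by (simp_all add: p_def q_def s(2)[OF N(2)] \<gamma>(2)[OF N(2) h])
    have "(\<Sum>b\<in>ONB. p b t0 * snd (D1 (\<gamma> b) ?y) ?h) =
        - (\<Sum>b\<in>ONB. \<Sum>j\<in>ONB. ?\<eta> (lift B \<psi> ?y b) * ((\<psi> ?h \<bullet> j) * (b \<bullet> \<psi> (D (s j) ?y))))"
      by (simp add: ps D1\<gamma> sum_negf sum_distrib_left)
    also have "\<dots> = - (\<Sum>j\<in>ONB. \<Sum>b\<in>ONB. ?\<eta> (lift B \<psi> ?y b) * ((\<psi> ?h \<bullet> j) * (b \<bullet> \<psi> (D (s j) ?y))))"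
      by (subst sum.swap) (rule refl)
    also have "\<dots> = - (\<Sum>j\<in>ONB. q j t0 * ?\<eta> (D (s j) ?y))"
    proof -
      have "(\<Sum>b\<in>ONB. ?\<eta> (lift B \<psi> ?y b) * ((\<psi> ?h \<bullet> j) * (b \<bullet> \<psi> (D (s j) ?y)))) =
          q j t0 * ?\<eta> (D (s j) ?y)" for j
        unfolding linear_dual_fibre[OF W NW[OF N(2)] \<eta> Ds, of j] sum_distrib_left
        by (rule sum.cong) (simp_all add: ps inner_commute)
      then show ?thesis by simp
    qed
    finally have zero: "(\<Sum>b\<in>ONB. ?\<eta> (D (s b) ?y) * q b t0 + snd (D1 (\<gamma> b) ?y) ?h * p b t0) = 0"
      by (simp add: sum.distrib mult.commute)
    have "((\<lambda>t. \<Sum>b\<in>ONB. p b t * q b t) has_real_derivative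
        (\<Sum>b\<in>ONB. ?\<eta> (D (s b) ?y) * q b t0 + snd (D1 (\<gamma> b) ?y) ?h * p b t0)) (at t0)"
      by (intro DERIV_sum DERIV_mult p' q')
    then have D: "((\<lambda>t. \<Sum>b\<in>ONB. p b t * q b t) has_real_derivative 0) (at t0)" by (simp only: zero)
    have ev: "\<forall>\<^sub>F t in nhds t0. (\<Sum>b\<in>ONB. p b t * q b t) = snd (c t) (\<Phi> t e)"
      using evI[OF t0] eventually_flow_mem[OF t0\<Omega> N(1,2)]
    proof eventually_elim
      case (elim t)
      show ?case
        unfolding linear_dual_fibre[OF W NW[OF elim(2)] base(2)[OF elim(1)] dom(2)[OF elim(1)]]
        by (rule sum.cong)
          (simp_all add: p_def q_def s(2)[OF elim(2)] \<gamma>(2)[OF elim(2) dom(2)[OF elim(1)]] inner_commute)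
    qed
    show ?thesis by (rule DERIV_cong_ev[OF refl ev refl, THEN iffD1, OF D])
  qed
  then have "\<exists>k. \<forall>t\<in>I. snd (c t) (\<Phi> t e) = k"
    by (intro has_field_derivative_zero_constant[OF is_interval_convex[OF I(2)]])
      (rule has_field_derivative_at_within)
  then have "snd (c t) (\<Phi> t e) = snd (c 0) (\<Phi> 0 e)" using t I(3) by auto
  then show "snd (c t) (\<Phi> t e) = snd (c 0) e"
    by (simp add: flow_zero[OF total_flow fibre_points_total[OF e]])
qed

text \<open>Supplies a vector \<open>e\<close> for the conclusions of
  \<open>dual_integral_curve_pairing\<close> in which \<open>e\<close> does not occur.\<close>

lemma fibre_nonempty: "x \<in> points (base B) \<Longrightarrow> \<exists>e. e \<in> fibre B x"
  using trivs_cover lift_fibre by blast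

text \<open>A vector \<open>g\<close> over \<open>\<phi> t x\<close> is the time \<open>t\<close>
  value of the flow line of \<open>\<Phi> (- t) g\<close>; constancy of the pairing along that line
  gives the value of \<open>c t\<close> on \<open>g\<close>.\<close>

lemma dual_integral_curve_unique:
  assumes I: "open I" "is_interval I" "0 \<in> I"
    and c: "integral_curve (total_atlas (dual_bundle B)) Vs I c"
    and c0: "c 0 \<in> fibre (dual_bundle B) x" and t: "t \<in> I"
  shows "(t, x) \<in> \<Omega>" "c t = dual_curve (c 0) t"
proof -
  have x: "x \<in> points (base B)" using c0 by (simp add: fibre_dual)
  note P = dual_integral_curve_pairing[OF I c c0 t]
  show t\<Omega>: "(t, x) \<in> \<Omega>" using P(1) fibre_nonempty[OF x] by blast
  have ct: "c t \<in> fibre (dual_bundle B) (\<phi> t x)" using P(2) fibre_nonempty[OF x] by blast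
  show "c t = dual_curve (c 0) t"
  proof (rule fibre_dual_eqI[OF ct dual_curve_fibre[OF t\<Omega> c0]])
    fix g assume g: "g \<in> fibre B (\<phi> t x)"
    note inv = flow_inverse_fibre[OF t\<Omega> g]
    show "snd (c t) g = snd (dual_curve (c 0) t) g"
      using P(3)[OF inv(2)] g by (simp add: inv(3) dual_curve_def fibre_dualD(1)[OF c0])
  qed
qed

text \<open>The projection of any competing curve is an integral curve of \<open>X\<close>, which
  confines its times to \<open>\<Omega>\<close>; the curve \<open>dual_curve \<epsilon>\<close> is
  defined for all of these.\<close>

theorem maximal_flow_dual:
  "maximal_flow (total_atlas (dual_bundle B)) Vs
    {(t, \<epsilon>). \<epsilon> \<in> total (dual_bundle B) \<and> (t, proj (dual_bundle B) \<epsilon>) \<in> \<Omega>} (\<lambda>t \<epsilon>. dual_curve \<epsilon> t)"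
proof -
  interpret d: prebundle "dual_bundle B" by (rule prebundle_dual)
  show ?thesis
    unfolding maximal_flow_def d.points_total Let_def
  proof (intro conjI ballI allI impI)
    fix \<epsilon> assume \<epsilon>: "\<epsilon> \<in> total (dual_bundle B)"
    let ?x = "fst \<epsilon>"
    have f: "\<epsilon> \<in> fibre (dual_bundle B) ?x" using d.fibreI[OF \<epsilon>] by simp
    have x: "?x \<in> points (base B)" using f by (simp add: fibre_dual)
    have J: "{t. (t, \<epsilon>) \<in> {(t, \<epsilon>). \<epsilon> \<in> total (dual_bundle B) \<and> (t, proj (dual_bundle B) \<epsilon>) \<in> \<Omega>}} =
        {t. (t, ?x) \<in> \<Omega>}" using \<epsilon> by simp
    show "open {t. (t, \<epsilon>) \<in> {(t, \<epsilon>). \<epsilon> \<in> total (dual_bundle B) \<and> (t, proj (dual_bundle B) \<epsilon>) \<in> \<Omega>}}"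
      unfolding J by (rule flow_domain_open[OF base_flow x])
    show "is_interval {t. (t, \<epsilon>) \<in> {(t, \<epsilon>). \<epsilon> \<in> total (dual_bundle B) \<and> (t, proj (dual_bundle B) \<epsilon>) \<in> \<Omega>}}"
      unfolding J by (rule flow_domain_interval[OF base_flow x])
    show "0 \<in> {t. (t, \<epsilon>) \<in> {(t, \<epsilon>). \<epsilon> \<in> total (dual_bundle B) \<and> (t, proj (dual_bundle B) \<epsilon>) \<in> \<Omega>}}"
      unfolding J using flow_domain_zero[OF base_flow x] by simp
    show "integral_curve (total_atlas (dual_bundle B)) Vs
        {t. (t, \<epsilon>) \<in> {(t, \<epsilon>). \<epsilon> \<in> total (dual_bundle B) \<and> (t, proj (dual_bundle B) \<epsilon>) \<in> \<Omega>}}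
        (\<lambda>t. dual_curve \<epsilon> t)"
      unfolding J by (rule dual_curve_integral[OF f])
    have z: "(0, ?x) \<in> \<Omega>" by (rule flow_domain_zero[OF base_flow x])
    show "dual_curve \<epsilon> 0 = \<epsilon>"
    proof (rule fibre_dual_eqI[OF _ f])
      show "dual_curve \<epsilon> 0 \<in> fibre (dual_bundle B) ?x"
        using dual_curve_fibre[OF z f] flow_zero[OF base_flow x] by simp
      show "snd (dual_curve \<epsilon> 0) g = snd \<epsilon> g" if "g \<in> fibre B ?x" for g
        using that flow_zero[OF total_flow fibre_points_total[OF that]]
        by (simp add: dual_curve_def flow_zero[OF base_flow x])
    qed
    fix I c
    assume Ic: "open I \<and> is_interval I \<and> 0 \<in> I \<and>
      integral_curve (total_atlas (dual_bundle B)) Vs I c \<and> c 0 = \<epsilon>"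
    then have c0: "c 0 \<in> fibre (dual_bundle B) ?x" using f by simp
    have u: "(t, ?x) \<in> \<Omega>" "c t = dual_curve \<epsilon> t" if "t \<in> I" for t
      using dual_integral_curve_unique[where c = c, OF _ _ _ _ c0 that] Ic by auto
    show "I \<subseteq> {t. (t, \<epsilon>) \<in> {(t, \<epsilon>). \<epsilon> \<in> total (dual_bundle B) \<and> (t, proj (dual_bundle B) \<epsilon>) \<in> \<Omega>}}"
      unfolding J using u(1) by blast
    show "c t = dual_curve \<epsilon> t" if "t \<in> I" for t by (rule u(2)[OF that])
  qed auto
qed

end

text \<open>The first conjunct makes the formula meaningful: a HOL function has values outside the
  flow domain too, so it has to be stated that \<open>\<Phi>E (- t)\<close> is only evaluated inside
  it and lands in the right fibre.\<close>

theorem mainTheorem7: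
  fixes E :: "('m, 'b::finite_dim_inner, 'e, 'f::finite_dim_inner) vbundle"
    and X :: "'m vfield"
    and D :: "('m \<Rightarrow> 'e) \<Rightarrow> ('m \<Rightarrow> 'e)"
    and Dstar :: "('m \<Rightarrow> 'm \<times> ('e \<Rightarrow> real)) \<Rightarrow> ('m \<Rightarrow> 'm \<times> ('e \<Rightarrow> real))"
    and V :: "'e vfield"
    and Vstar :: "('m \<times> ('e \<Rightarrow> real)) vfield"
    and \<Omega> :: "(real \<times> 'm) set" and \<phi> :: "real \<Rightarrow> 'm \<Rightarrow> 'm"
    and \<Omega>E :: "(real \<times> 'e) set" and \<Phi>E :: "real \<Rightarrow> 'e \<Rightarrow> 'e"
  assumes "vector_bundle E"
    and "linear_derivation E X D"
    and "dual_derivation E X D Dstar"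
    and "associated_vector_field E X D V"
    and "associated_vector_field (dual_bundle E) X Dstar Vstar"
    and "maximal_flow (base E) X \<Omega> \<phi>"
    and "maximal_flow (total_atlas E) V \<Omega>E \<Phi>E"
  shows "(\<forall>(t, x)\<in>\<Omega>. \<forall>e\<in>fibre E (\<phi> t x). (- t, e) \<in> \<Omega>E \<and> \<Phi>E (- t) e \<in> fibre E x) \<and>
    maximal_flow (total_atlas (dual_bundle E)) Vstar
      {(t, \<epsilon>). \<epsilon> \<in> total (dual_bundle E) \<and> (t, proj (dual_bundle E) \<epsilon>) \<in> \<Omega>}
      (\<lambda>t (x, \<epsilon>). (\<phi> t x, \<lambda>e\<in>fibre E (\<phi> t x). \<epsilon> (\<Phi>E (- t) e)))"
proof -
  interpret E: prebundle E by (rule prebundle_if_vector_bundle[OF assms(1)])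
  interpret Es: prebundle "dual_bundle E" by (rule E.prebundle_dual)
  \<comment> \<open>The dual derivation inside \<open>associated_vector_field\<close> is
    existentially bound, so \<open>D1\<close> need not be \<open>Dstar\<close> as a HOL function.
    Both satisfy the defining identity of the dual of \<open>D\<close>; \<open>D2\<close> is a dual
    of \<open>Dstar\<close>.\<close>
  obtain D1 where D1: "dual_derivation E X D D1" "linear_vfield E X D1 V"
    using E.associated_linear_vfield[OF assms(4)] by blast
  obtain D2 where D2: "dual_derivation (dual_bundle E) X Dstar D2" "linear_vfield (dual_bundle E) X D2 Vstar"
    using Es.associated_linear_vfield[OF assms(5)] by blast
  have D: "D \<in> sections E \<rightarrow> sections E" using assms(2) unfolding linear_derivation_def by (elim conjE)
  interpret dual_flow E X D1 V \<Omega> \<phi> \<Omega>E \<Phi>E D D2 Vstar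
  proof (intro dual_flow.intro linear_flow.intro linear_flow_axioms.intro dual_flow_axioms.intro)
    show "D s \<in> sections E" if "s \<in> sections E" for s using D that by blast
    show "snd (D1 \<gamma> x) (s x) = X x (pairing E \<gamma> s) - snd (\<gamma> x) (D s x)"
      if "\<gamma> \<in> sections (dual_bundle E)" "s \<in> sections E" "x \<in> points (base E)" for \<gamma> s x
    proof -
      have "pairing E (D1 \<gamma>) s x = X x (pairing E \<gamma> s) - pairing E \<gamma> (D s) x"
        using D1(1) that unfolding dual_derivation_def by blast
      then show ?thesis by (simp add: pairing_def that(3))
    qed
    show "snd (D2 \<delta> x) \<epsilon> = snd \<epsilon> (D s x)"
      if "s \<in> sections E" "\<delta> \<in> sections (dual_bundle (dual_bundle E))"
        "\<forall>x\<in>points (base E). \<forall>\<epsilon>\<in>fibre (dual_bundle E) x. snd (\<delta> x) \<epsilon> = snd \<epsilon> (s x)"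
        "\<epsilon> \<in> fibre (dual_bundle E) x" for s \<delta> \<epsilon> x
      by (rule E.dual_derivation_bidual[OF D assms(3) D2(1) that])
  qed (rule assms D1(2) D2(2))+
  have "(\<lambda>t (x, \<epsilon>). (\<phi> t x, \<lambda>e\<in>fibre E (\<phi> t x). \<epsilon> (\<Phi>E (- t) e))) = (\<lambda>t \<epsilon>. dual_curve \<epsilon> t)"
    by (auto simp: dual_curve_def fun_eq_iff)
  then show ?thesis using flow_inverse_fibre maximal_flow_dual by auto
qed

end
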